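(* Let $\lambda=(\varnothing,(1^n))^R$, where $(\varnothing,(1^n))^R=(\varnothing,(1^n))$ if $n<l$ and $(\varnothing,(1^n))^R=((\{n-l\}),(1^l))$ if $n\ge l$. Then $$[S_{(\varnothing,(1^n))}:D_\lambda]_v=\begin{cases}v^{2\lfloor n/e\rfloor}&\text{if }\kappa_2\equiv\kappa_1-1\pmod e,\\ v^{\lfloor n/e\rfloor+\lfloor (n-l-1)/e\rfloor+1}&\text{if }\kappa_2\not\equiv\kappa_1-1\pmod e.\end{cases}$$ Moreover, $[S_{(\varnothing,(1^n))}:D_\mu]_v=0$ for all other $\mu\in\mathscr{RP}_n^2$.
   Context: Setting. $\mathbb F$ is an arbitrary field, $e\ge 3$ an integer, $I=\mathbb Z/e\mathbb Z$, $\kappa=(\kappa_1,\kappa_2)\in I^2$, $n\geq 1$, and $l\in\{0,\dots,e-1\}$ is the residue of $\kappa_2-\kappa_1$ modulo $e$. Algebra. $\mathscr H_n^\Lambda$ (with $\Lambda=\Lambda_{\kappa_1}+\Lambda_{\kappa_2}$) is the cyclotomic Khovanov--Lauda--Rouquier algebra: the unital associative $\mathbb F$-algebra with generators $e(\mathbf i)$ ($\mathbf i\in I^n$), $y_1,\dots,y_n$, $\psi_1,\dots,\psi_{n-1}$ and relations $e(\mathbf i)e(\mathbf j)=\delta_{\mathbf i\mathbf j}e(\mathbf i)$, $\sum_{\mathbf i}e(\mathbf i)=1$, $y_re(\mathbf i)=e(\mathbf i)y_r$, $\psi_re(\mathbf i)=e(s_r\mathbf i)\psi_r$, $y_ry_s=y_sy_r$,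 $\psi_ry_s=y_s\psi_r$ if $s\ne r,r+1$, $\psi_r\psi_s=\psi_s\psi_r$ if $|r-s|>1$, $\psi_ry_{r+1}e(\mathbf i)=(y_r\psi_r+\delta_{i_r,i_{r+1}})e(\mathbf i)$, $y_{r+1}\psi_re(\mathbf i)=(\psi_ry_r+\delta_{i_r,i_{r+1}})e(\mathbf i)$; $\psi_r^2e(\mathbf i)$ equals $0$ if $i_r=i_{r+1}$, $(y_{r+1}-y_r)e(\mathbf i)$ if $i_{r+1}=i_r+1$, $(y_r-y_{r+1})e(\mathbf i)$ if $i_{r+1}=i_r-1$, and $e(\mathbf i)$ otherwise; $\psi_r\psi_{r+1}\psi_re(\mathbf i)=(\psi_{r+1}\psi_r\psi_{r+1}+\varepsilon)e(\mathbf i)$ with $\varepsilon=1$ if $i_{r+2}=i_r=i_{r+1}-1$, $\varepsilon=-1$ if $i_{r+2}=i_r=i_{r+1}+1$, $\varepsilon=0$ otherwise; and $y_1^{\#\{k:\kappa_k=i_1\}}e(\mathbf i)=0$. It is $\mathbb Z$-graded by $\deg e(\mathbf i)=0$, $\deg y_r=2$, $\deg\psi_re(\mathbf i)=-2,1,0$ according as $i_r=i_{r+1}$, $i_r=i_{r+1}\pm1$, or neither. Modules are finitely generated graded left modules; $(M\langle k\rangle)_i=M_{i-k}$; $M^\circledast$ is the graded dual with respect to the anti-involution fixing all the generators. Bipartitions. Nodes of a bipartition $\lambda=(\lambda^{(1)},\lambda^{(2)})$ are $(i,j,c)$ (row, column, component), $\operatorname{res}(i,j,c)=\kappa_c+j-i\in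 I$, and $(i_1,j_1,c_1)$ is strictly above $(i_2,j_2,c_2)$ if $c_1<c_2$, or $c_1=c_2$ and $i_1<i_2$. The $i$-signature of $\lambda$ lists, from top to bottom, a $+$ for each addable node of residue $i$ and a $-$ for each removable node of residue $i$; successively deleting adjacent pairs $+-$ gives the reduced $i$-signature $-\cdots-+\cdots+$. Addable nodes corresponding to $+$ in the reduced signature are conormal; $\lambda\uparrow_i$ is $\lambda$ with its highest conormal $i$-node added (when one exists). $\lambda$ is regular if it is obtained from $\varnothing=(\varnothing,\varnothing)$ by a sequence of operations $\uparrow_{i_1},\dots,\uparrow_{i_n}$; $\mathscr{RP}_n^2$ is the set of regular bipartitions of $n$. Simple modules. For $\mu\in\mathscr{RP}_n^2$, $D_\mu=S_\mu/\operatorname{rad}S_\mu$ is the self-dual graded irreducible head of the graded column Specht module $S_\mu$ (of Kleshchev--Mathas--Ram). Equivalently these modules are characterised recursively: $D_\varnothing=\mathbb F$ in degree $0$, and if $\nu=\mu\uparrow_i$ then $D_\nu\cong D_\nu^\circledast$ is the irreducible module with $\operatorname{soc}(e_iD_\nu)\cong D_\mu$ up to grading shift, where $e_iM=\bigoplus_{\mathbf j}e(j_1,\dots,j_{n-1},i)M$ is viewed as an $\mathscr H_{n-1}^\Lambda$-module. The Specht module. $S_{(\varnothing,(1^n))}$ is the one-dimensional graded $\mathscr H_n^\Lambda$-module spanned by $z$ with $e(\mathbf i)z=z$ for $\mathbf i=(\kappa_2,\kappa_2-1,\dots,\kappa_2-n+1)$ and $y_rz=0$, $\psi_rz=0$ for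 all $r$; the degree of $z$ is $\deg T$ for the unique standard $(\varnothing,(1^n))$-tableau $T$, where $\deg T$ is the sum over $k=1,\dots,n$ of the number of addable minus the number of removable nodes of $(\varnothing,(1^k))$ having the same residue as, and lying strictly above, the node $(k,1,2)$. $[S:D]_v=\sum_{k\in\mathbb Z}[S:D\langle k\rangle]v^k$ is the graded composition multiplicity. For an integer $a\ge0$, $\{a\}$ denotes the weakly decreasing sequence of $e-1$ integers $\lfloor\frac{a+e-2}{e-1}\rfloor,\lfloor\frac{a+e-3}{e-1}\rfloor,\dots,\lfloor\frac{a}{e-1}\rfloor$ (which sum to $a$); zero parts of partitions are ignored. *)

theory Defs
  imports
    "HOL-Algebra.QuotRing"
    "HOL-Algebra.Module"
    "HOL-Library.FuncSet"
    "HOL-Library.Poly_Mapping"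
    "HOL-Number_Theory.Cong"
begin

section \<open>The cyclotomic Khovanov--Lauda--Rouquier algebra\<close>

text \<open>
  The set \<open>I = \<int>/e\<int>\<close> is represented by the integers \<open>{0..<e}\<close>, with arithmetic modulo \<open>e\<close>.
  The pair \<open>(\<kappa>\<^sub>1, \<kappa>\<^sub>2)\<close> is the function \<open>\<kappa>\<close> on \<open>{1, 2}\<close>.  A residue sequence
  \<open>(i\<^sub>1, \<dots>, i\<^sub>n)\<close> is a list, so that its entry \<open>i\<^sub>r\<close> is \<open>is ! (r - 1)\<close>.
\<close>

datatype gen = E "int list" | Y nat | Psi nat

text \<open>Words under concatenation; finitely supported functions on words then carry the
  convolution product and form the free associative algebra.\<close>

instantiation list :: (type) monoid_add
begin
definition zero_list :: "'a list" where "zero_list = []"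
definition plus_list :: "'a list \<Rightarrow> 'a list \<Rightarrow> 'a list" where "plus_list = (@)"
instance by standard (simp_all add: zero_list_def plus_list_def)
end

type_synonym 'f free = "gen list \<Rightarrow>\<^sub>0 'f"

definition res_seqs :: "nat \<Rightarrow> nat \<Rightarrow> int list set" where
  "res_seqs e n = {is. length is = n \<and> set is \<subseteq> {0..<int e}}"

definition gens :: "nat \<Rightarrow> nat \<Rightarrow> gen set" where
  "gens e n = E ` res_seqs e n \<union> Y ` {1..n} \<union> Psi ` {1..<n}"

definition free_algebra :: "nat \<Rightarrow> nat \<Rightarrow> 'f::field free ring" where
  "free_algebra e n =
    \<lparr>carrier = {p. \<forall>w \<in> Poly_Mapping.keys p. set w \<subseteq> gens e n},
     monoid.mult = (*), one = 1, zero = 0, add = (+)\<rparr>"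

definition X :: "gen \<Rightarrow> 'f::field free" where
  "X g = Poly_Mapping.single [g] 1"

abbreviation ee :: "int list \<Rightarrow> 'f::field free" where "ee is \<equiv> X (E is)"
abbreviation yy :: "nat \<Rightarrow> 'f::field free" where "yy r \<equiv> X (Y r)"
abbreviation psi :: "nat \<Rightarrow> 'f::field free" where "psi r \<equiv> X (Psi r)"

abbreviation ent :: "int list \<Rightarrow> nat \<Rightarrow> int" where "ent is r \<equiv> is ! (r - 1)"

definition swap_res :: "nat \<Rightarrow> int list \<Rightarrow> int list" where
  "swap_res r is = is[r - 1 := ent is (r + 1), r := ent is r]"

definition succ_res :: "nat \<Rightarrow> int \<Rightarrow> int" where "succ_res e i = (i + 1) mod int e"
definition pred_res :: "nat \<Rightarrow> int \<Rightarrow> int" where "pred_res e i = (i - 1) mod int e"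

definition delta :: "int \<Rightarrow> int \<Rightarrow> 'f::field free" where
  "delta i j = (if i = j then 1 else 0)"

definition psi_square :: "nat \<Rightarrow> nat \<Rightarrow> int list \<Rightarrow> 'f::field free" where
  "psi_square e r is =
    (if ent is r = ent is (r + 1) then 0
     else if ent is (r + 1) = succ_res e (ent is r) then yy (r + 1) - yy r
     else if ent is (r + 1) = pred_res e (ent is r) then yy r - yy (r + 1)
     else 1)"

definition braid_error :: "nat \<Rightarrow> nat \<Rightarrow> int list \<Rightarrow> 'f::field free" where
  "braid_error e r is =
    (if ent is (r + 2) = ent is r \<and> ent is r = pred_res e (ent is (r + 1)) then 1
     else if ent is (r + 2) = ent is r \<and> ent is r = succ_res e (ent is (r + 1)) then - 1
     else 0)"

text \<open>Each defining relation \<open>a = b\<close> is recorded as \<open>a - b\<close>.\<close>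

inductive_set klr_relators :: "nat \<Rightarrow> (nat \<Rightarrow> int) \<Rightarrow> nat \<Rightarrow> 'f::field free set"
  for e :: nat and \<kappa> :: "nat \<Rightarrow> int" and n :: nat where
  idem: "\<lbrakk>is \<in> res_seqs e n; js \<in> res_seqs e n\<rbrakk> \<Longrightarrow>
    ee is * ee js - (if is = js then ee is else 0) \<in> klr_relators e \<kappa> n"
| idem_sum: "(\<Sum>is \<in> res_seqs e n. ee is) - 1 \<in> klr_relators e \<kappa> n"
| y_idem: "\<lbrakk>1 \<le> r; r \<le> n; is \<in> res_seqs e n\<rbrakk> \<Longrightarrow>
    yy r * ee is - ee is * yy r \<in> klr_relators e \<kappa> n"
| psi_idem: "\<lbrakk>1 \<le> r; r < n; is \<in> res_seqs e n\<rbrakk> \<Longrightarrow>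
    psi r * ee is - ee (swap_res r is) * psi r \<in> klr_relators e \<kappa> n"
| y_y: "\<lbrakk>1 \<le> r; r \<le> n; 1 \<le> s; s \<le> n\<rbrakk> \<Longrightarrow>
    yy r * yy s - yy s * yy r \<in> klr_relators e \<kappa> n"
| psi_y: "\<lbrakk>1 \<le> r; r < n; 1 \<le> s; s \<le> n; s \<noteq> r; s \<noteq> r + 1\<rbrakk> \<Longrightarrow>
    psi r * yy s - yy s * psi r \<in> klr_relators e \<kappa> n"
| psi_psi: "\<lbrakk>1 \<le> r; r < n; 1 \<le> s; s < n; r + 1 < s \<or> s + 1 < r\<rbrakk> \<Longrightarrow>
    psi r * psi s - psi s * psi r \<in> klr_relators e \<kappa> n"
| psi_y_next: "\<lbrakk>1 \<le> r; r < n; is \<in> res_seqs e n\<rbrakk> \<Longrightarrow>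
    psi r * yy (r + 1) * ee is - (yy r * psi r + delta (ent is r) (ent is (r + 1))) * ee is
      \<in> klr_relators e \<kappa> n"
| y_next_psi: "\<lbrakk>1 \<le> r; r < n; is \<in> res_seqs e n\<rbrakk> \<Longrightarrow>
    yy (r + 1) * psi r * ee is - (psi r * yy r + delta (ent is r) (ent is (r + 1))) * ee is
      \<in> klr_relators e \<kappa> n"
| psi_sq: "\<lbrakk>1 \<le> r; r < n; is \<in> res_seqs e n\<rbrakk> \<Longrightarrow>
    psi r * psi r * ee is - psi_square e r is * ee is \<in> klr_relators e \<kappa> n"
| braid: "\<lbrakk>1 \<le> r; r + 1 < n; is \<in> res_seqs e n\<rbrakk> \<Longrightarrow>
    psi r * psi (r + 1) * psi r * ee is
      - (psi (r + 1) * psi r * psi (r + 1) + braid_error e r is) * ee is \<in> klr_relators e \<kappa> n"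
| cyclotomic: "\<lbrakk>1 \<le> n; is \<in> res_seqs e n\<rbrakk> \<Longrightarrow>
    yy 1 ^ card {k \<in> {1, 2}. \<kappa> k = ent is 1} * ee is \<in> klr_relators e \<kappa> n"

definition klr_ideal :: "nat \<Rightarrow> (nat \<Rightarrow> int) \<Rightarrow> nat \<Rightarrow> 'f::field free set" where
  "klr_ideal e \<kappa> n = genideal (free_algebra e n) (klr_relators e \<kappa> n)"

definition klr_algebra :: "nat \<Rightarrow> (nat \<Rightarrow> int) \<Rightarrow> nat \<Rightarrow> 'f::field free set ring" where
  "klr_algebra e \<kappa> n = free_algebra e n Quot klr_ideal e \<kappa> n"

definition klr_class :: "nat \<Rightarrow> (nat \<Rightarrow> int) \<Rightarrow> nat \<Rightarrow> 'f::field free \<Rightarrow> 'f free set" where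
  "klr_class e \<kappa> n p = klr_ideal e \<kappa> n +>\<^bsub>free_algebra e n\<^esub> p"

definition klr_scalar :: "nat \<Rightarrow> (nat \<Rightarrow> int) \<Rightarrow> nat \<Rightarrow> 'f::field \<Rightarrow> 'f free set" where
  "klr_scalar e \<kappa> n c = klr_class e \<kappa> n (Poly_Mapping.single [] c)"

definition psi_deg :: "nat \<Rightarrow> nat \<Rightarrow> int list \<Rightarrow> int" where
  "psi_deg e r is =
    (if ent is r = ent is (r + 1) then - 2
     else if ent is r = succ_res e (ent is (r + 1)) \<or> ent is r = pred_res e (ent is (r + 1)) then 1
     else 0)"

text \<open>\<open>klr_homog e \<kappa> n d\<close> is the homogeneous component of degree \<open>d\<close>.\<close>

inductive klr_homogp :: "nat \<Rightarrow> (nat \<Rightarrow> int) \<Rightarrow> nat \<Rightarrow> int \<Rightarrow> 'f::field free set \<Rightarrow> bool"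
  for e :: nat and \<kappa> :: "nat \<Rightarrow> int" and n :: nat where
  "is \<in> res_seqs e n \<Longrightarrow> klr_homogp e \<kappa> n 0 (klr_class e \<kappa> n (ee is))"
| "\<lbrakk>1 \<le> r; r \<le> n\<rbrakk> \<Longrightarrow> klr_homogp e \<kappa> n 2 (klr_class e \<kappa> n (yy r))"
| "\<lbrakk>1 \<le> r; r < n; is \<in> res_seqs e n\<rbrakk> \<Longrightarrow>
    klr_homogp e \<kappa> n (psi_deg e r is) (klr_class e \<kappa> n (psi r * ee is))"
| "\<lbrakk>klr_homogp e \<kappa> n d a; klr_homogp e \<kappa> n d' b\<rbrakk> \<Longrightarrow>
    klr_homogp e \<kappa> n (d + d') (a \<otimes>\<^bsub>klr_algebra e \<kappa> n\<^esub> b)"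
| "klr_homogp e \<kappa> n d \<zero>\<^bsub>klr_algebra e \<kappa> n\<^esub>"
| "\<lbrakk>klr_homogp e \<kappa> n d a; klr_homogp e \<kappa> n d b\<rbrakk> \<Longrightarrow>
    klr_homogp e \<kappa> n d (a \<oplus>\<^bsub>klr_algebra e \<kappa> n\<^esub> b)"
| "klr_homogp e \<kappa> n d a \<Longrightarrow>
    klr_homogp e \<kappa> n d (klr_scalar e \<kappa> n c \<otimes>\<^bsub>klr_algebra e \<kappa> n\<^esub> a)"

definition klr_homog :: "nat \<Rightarrow> (nat \<Rightarrow> int) \<Rightarrow> nat \<Rightarrow> int \<Rightarrow> 'f::field free set set" where
  "klr_homog e \<kappa> n d = {a. klr_homogp e \<kappa> n d a}"


section \<open>Graded modules\<close>

text \<open>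
  The module locale of the library requires a commutative base ring, hence the locale below.
  The record fields \<open>mult\<close> and \<open>one\<close> inherited from rings play no role, as in the library.
\<close>

record ('a, 'b) gmodule = "('a, 'b) module" +
  deg_part :: "int \<Rightarrow> 'b set"

locale left_module = R?: ring R + M?: abelian_group M for R (structure) and M (structure) +
  assumes left_smult_closed:
      "\<lbrakk>a \<in> carrier R; x \<in> carrier M\<rbrakk> \<Longrightarrow> a \<odot>\<^bsub>M\<^esub> x \<in> carrier M"
    and left_smult_l_distr:
      "\<lbrakk>a \<in> carrier R; b \<in> carrier R; x \<in> carrier M\<rbrakk> \<Longrightarrow>
        (a \<oplus> b) \<odot>\<^bsub>M\<^esub> x = a \<odot>\<^bsub>M\<^esub> x \<oplus>\<^bsub>M\<^esub> b \<odot>\<^bsub>M\<^esub> x"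
    and left_smult_r_distr:
      "\<lbrakk>a \<in> carrier R; x \<in> carrier M; y \<in> carrier M\<rbrakk> \<Longrightarrow>
        a \<odot>\<^bsub>M\<^esub> (x \<oplus>\<^bsub>M\<^esub> y) = a \<odot>\<^bsub>M\<^esub> x \<oplus>\<^bsub>M\<^esub> a \<odot>\<^bsub>M\<^esub> y"
    and left_smult_assoc:
      "\<lbrakk>a \<in> carrier R; b \<in> carrier R; x \<in> carrier M\<rbrakk> \<Longrightarrow>
        (a \<otimes> b) \<odot>\<^bsub>M\<^esub> x = a \<odot>\<^bsub>M\<^esub> (b \<odot>\<^bsub>M\<^esub> x)"
    and left_smult_one:
      "x \<in> carrier M \<Longrightarrow> \<one> \<odot>\<^bsub>M\<^esub> x = x"

definition homog_decomp :: "('a, 'b) gmodule \<Rightarrow> 'b \<Rightarrow> (int \<Rightarrow> 'b) \<Rightarrow> bool" where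
  "homog_decomp M x f \<longleftrightarrow>
    (\<forall>d. f d \<in> deg_part M d) \<and> finite {d. f d \<noteq> \<zero>\<^bsub>M\<^esub>} \<and>
    x = finsum M f {d. f d \<noteq> \<zero>\<^bsub>M\<^esub>}"

definition fin_gen :: "'a ring \<Rightarrow> ('a, 'b) gmodule \<Rightarrow> bool" where
  "fin_gen R M \<longleftrightarrow> (\<exists>A. finite A \<and> A \<subseteq> carrier M \<and>
    (\<forall>N. submodule N R M \<and> A \<subseteq> N \<longrightarrow> N = carrier M))"

text \<open>\<open>Rd d\<close> is the degree \<open>d\<close> component of the graded ring \<open>R\<close>.\<close>

definition graded_module :: "'a ring \<Rightarrow> (int \<Rightarrow> 'a set) \<Rightarrow> ('a, 'b) gmodule \<Rightarrow> bool" where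
  "graded_module R Rd M \<longleftrightarrow>
    left_module R M \<and> fin_gen R M \<and>
    (\<forall>d. subgroup (deg_part M d) (add_monoid M)) \<and>
    (\<forall>x \<in> carrier M. \<exists>!f. homog_decomp M x f) \<and>
    (\<forall>d d' a x. a \<in> Rd d \<and> x \<in> deg_part M d' \<longrightarrow> a \<odot>\<^bsub>M\<^esub> x \<in> deg_part M (d + d'))"

definition graded_submodule :: "'a ring \<Rightarrow> ('a, 'b) gmodule \<Rightarrow> 'b set \<Rightarrow> bool" where
  "graded_submodule R M N \<longleftrightarrow>
    submodule N R M \<and> (\<forall>x \<in> N. \<exists>f. homog_decomp M x f \<and> (\<forall>d. f d \<in> N))"

definition sub_gmodule :: "('a, 'b) gmodule \<Rightarrow> 'b set \<Rightarrow> ('a, 'b) gmodule" where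
  "sub_gmodule M N = M\<lparr>carrier := N, deg_part := \<lambda>d. deg_part M d \<inter> N\<rparr>"

definition quot_gmodule :: "('a, 'b) gmodule \<Rightarrow> 'b set \<Rightarrow> ('a, 'b set) gmodule" where
  "quot_gmodule M N =
    \<lparr>carrier = a_rcosets\<^bsub>M\<^esub> N, monoid.mult = undefined, one = undefined,
     zero = N, add = set_add M,
     smult = \<lambda>a C. (\<Union>x \<in> C. N +>\<^bsub>M\<^esub> (a \<odot>\<^bsub>M\<^esub> x)),
     deg_part = \<lambda>d. (\<lambda>x. N +>\<^bsub>M\<^esub> x) ` deg_part M d\<rparr>"

definition irreducible_gmodule :: "'a ring \<Rightarrow> ('a, 'b) gmodule \<Rightarrow> bool" where
  "irreducible_gmodule R M \<longleftrightarrow>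
    carrier M \<noteq> {\<zero>\<^bsub>M\<^esub>} \<and>
    (\<forall>N. graded_submodule R M N \<longrightarrow> N = {\<zero>\<^bsub>M\<^esub>} \<or> N = carrier M)"

definition gmodule_iso :: "'a ring \<Rightarrow> ('a, 'b) gmodule \<Rightarrow> ('a, 'c) gmodule \<Rightarrow> bool" where
  "gmodule_iso R M N \<longleftrightarrow> (\<exists>\<phi>.
    bij_betw \<phi> (carrier M) (carrier N) \<and>
    (\<forall>x \<in> carrier M. \<forall>y \<in> carrier M. \<phi> (x \<oplus>\<^bsub>M\<^esub> y) = \<phi> x \<oplus>\<^bsub>N\<^esub> \<phi> y) \<and>
    (\<forall>a \<in> carrier R. \<forall>x \<in> carrier M. \<phi> (a \<odot>\<^bsub>M\<^esub> x) = a \<odot>\<^bsub>N\<^esub> \<phi> x) \<and>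
    (\<forall>d. \<phi> ` deg_part M d = deg_part N d))"

definition grade_shift :: "int \<Rightarrow> ('a, 'b) gmodule \<Rightarrow> ('a, 'b) gmodule" where
  "grade_shift k M = M\<lparr>deg_part := \<lambda>d. deg_part M (d - k)\<rparr>"

text \<open>The smallest graded submodule containing every irreducible one, i.e. their sum.\<close>

definition socle :: "'a ring \<Rightarrow> ('a, 'b) gmodule \<Rightarrow> ('a, 'b) gmodule" where
  "socle R M = sub_gmodule M
    (\<Inter>{N. graded_submodule R M N \<and>
          (\<forall>L. graded_submodule R M L \<and> irreducible_gmodule R (sub_gmodule M L) \<longrightarrow> L \<subseteq> N)})"

definition comp_factor :: "('a, 'b) gmodule \<Rightarrow> 'b set list \<Rightarrow> nat \<Rightarrow> ('a, 'b set) gmodule" where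
  "comp_factor M Ns j = quot_gmodule (sub_gmodule M (Ns ! Suc j)) (Ns ! j)"

definition comp_series :: "'a ring \<Rightarrow> ('a, 'b) gmodule \<Rightarrow> 'b set list \<Rightarrow> bool" where
  "comp_series R M Ns \<longleftrightarrow>
    Ns \<noteq> [] \<and> hd Ns = {\<zero>\<^bsub>M\<^esub>} \<and> last Ns = carrier M \<and>
    (\<forall>N \<in> set Ns. graded_submodule R M N) \<and>
    (\<forall>j. Suc j < length Ns \<longrightarrow>
      Ns ! j \<subseteq> Ns ! Suc j \<and> irreducible_gmodule R (comp_factor M Ns j))"

text \<open>By the Jordan--Hoelder theorem the choice of the series is immaterial.\<close>

definition comp_mult :: "'a ring \<Rightarrow> ('a, 'b) gmodule \<Rightarrow> ('a, 'c) gmodule \<Rightarrow> nat" where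
  "comp_mult R M D =
    (let Ns = (SOME Ns. comp_series R M Ns)
     in card {j. Suc j < length Ns \<and> gmodule_iso R (comp_factor M Ns j) D})"

text \<open>Laurent polynomials in \<open>v\<close> are finitely supported functions of the exponent.\<close>

definition graded_mult :: "'a ring \<Rightarrow> ('a, 'b) gmodule \<Rightarrow> ('a, 'c) gmodule \<Rightarrow> (int \<Rightarrow>\<^sub>0 int)" where
  "graded_mult R M D =
    (\<Sum>k. Poly_Mapping.single k (int (comp_mult R M (grade_shift k D))))"

definition vpow :: "int \<Rightarrow> (int \<Rightarrow>\<^sub>0 int)" where
  "vpow k = Poly_Mapping.single k 1"


section \<open>Modules for the cyclotomic algebra\<close>

type_synonym ('f, 'b) klr_gmodule = "('f free set, 'b) gmodule"

definition klr_graded_module ::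
    "nat \<Rightarrow> (nat \<Rightarrow> int) \<Rightarrow> nat \<Rightarrow> ('f::field, 'b) klr_gmodule \<Rightarrow> bool" where
  "klr_graded_module e \<kappa> n = graded_module (klr_algebra e \<kappa> n) (klr_homog e \<kappa> n)"

definition push_words :: "(gen list \<Rightarrow> gen list) \<Rightarrow> 'f::field free \<Rightarrow> 'f free" where
  "push_words \<phi> p = (\<Sum>w \<in> Poly_Mapping.keys p. Poly_Mapping.single (\<phi> w) (Poly_Mapping.lookup p w))"

text \<open>The anti-involution fixing the generators; it sends cosets to cosets.\<close>

definition klr_star :: "'f::field free set \<Rightarrow> 'f free set" where
  "klr_star a = push_words rev ` a"

text \<open>Functionals on \<open>M\<close> are extended by \<open>undefined\<close> outside the carrier.  Only functionals
  vanishing on all but finitely many components are included, and a functional of degree \<open>d\<close> is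
  supported on the component of degree \<open>-d\<close>.\<close>

definition graded_dual ::
    "nat \<Rightarrow> (nat \<Rightarrow> int) \<Rightarrow> nat \<Rightarrow> ('f::field, 'b) klr_gmodule \<Rightarrow> ('f, 'b \<Rightarrow> 'f) klr_gmodule" where
  "graded_dual e \<kappa> n M =
    (let V = {f \<in> extensional (carrier M).
               (\<forall>x \<in> carrier M. \<forall>y \<in> carrier M. f (x \<oplus>\<^bsub>M\<^esub> y) = f x + f y) \<and>
               (\<forall>c. \<forall>x \<in> carrier M. f (klr_scalar e \<kappa> n c \<odot>\<^bsub>M\<^esub> x) = c * f x) \<and>
               finite {d. \<exists>x \<in> deg_part M d. f x \<noteq> 0}}
     in \<lparr>carrier = V, monoid.mult = undefined, one = undefined,
         zero = (\<lambda>x \<in> carrier M. 0),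
         add = (\<lambda>f g. \<lambda>x \<in> carrier M. f x + g x),
         smult = (\<lambda>a f. \<lambda>x \<in> carrier M. f (klr_star a \<odot>\<^bsub>M\<^esub> x)),
         deg_part = (\<lambda>d. {f \<in> V. \<forall>d'. d' \<noteq> - d \<longrightarrow> (\<forall>x \<in> deg_part M d'. f x = 0)})\<rparr>)"

fun append_res :: "int \<Rightarrow> gen \<Rightarrow> gen" where
  "append_res i (E js) = E (js @ [i])"
| "append_res i (Y r) = Y r"
| "append_res i (Psi r) = Psi r"

definition tail_idem :: "nat \<Rightarrow> nat \<Rightarrow> int \<Rightarrow> 'f::field free" where
  "tail_idem e n i = (\<Sum>js \<in> res_seqs e n. ee (js @ [i]))"

text \<open>The (non-unital) homomorphism from the algebra for \<open>n\<close> to the one for \<open>n + 1\<close> that underlies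
  \<open>e\<^sub>i\<close>.  All the cosets in the union coincide.\<close>

definition res_hom :: "nat \<Rightarrow> (nat \<Rightarrow> int) \<Rightarrow> nat \<Rightarrow> int \<Rightarrow> 'f::field free set \<Rightarrow> 'f free set" where
  "res_hom e \<kappa> n i a =
    (\<Union>p \<in> a. klr_class e \<kappa> (n + 1) (push_words (map (append_res i)) p * tail_idem e n i))"

text \<open>\<open>e\<^sub>i M\<close> for a module \<open>M\<close> over the algebra for \<open>n + 1\<close>, as a module over the algebra for \<open>n\<close>.\<close>

definition i_restriction ::
    "nat \<Rightarrow> (nat \<Rightarrow> int) \<Rightarrow> nat \<Rightarrow> int \<Rightarrow> ('f::field, 'b) klr_gmodule \<Rightarrow> ('f, 'b) klr_gmodule" where
  "i_restriction e \<kappa> n i M =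
    (let V = (\<lambda>x. klr_class e \<kappa> (n + 1) (tail_idem e n i) \<odot>\<^bsub>M\<^esub> x) ` carrier M
     in \<lparr>carrier = V, monoid.mult = undefined, one = undefined,
         zero = \<zero>\<^bsub>M\<^esub>, add = add M,
         smult = (\<lambda>a x. res_hom e \<kappa> n i a \<odot>\<^bsub>M\<^esub> x),
         deg_part = (\<lambda>d. deg_part M d \<inter> V)\<rparr>)"

text \<open>The one-dimensional module on which the idempotent of \<open>is\<close> acts as 1 and all the other
  generators as 0, concentrated in degree \<open>d\<close>.  The scalar by which a word acts is 1 if the word
  only consists of letters \<open>E is\<close>, and 0 otherwise.  When the module exists, the images of all
  the elements of a coset coincide.\<close>

definition one_dim_char :: "int list \<Rightarrow> 'f::field free \<Rightarrow> 'f" where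
  "one_dim_char is p =
    (\<Sum>w \<in> Poly_Mapping.keys p. if set w \<subseteq> {E is} then Poly_Mapping.lookup p w else 0)"

definition one_dim_module :: "int list \<Rightarrow> int \<Rightarrow> ('f::field, 'f) klr_gmodule" where
  "one_dim_module is d =
    \<lparr>carrier = UNIV, monoid.mult = undefined, one = undefined, zero = 0, add = (+),
     smult = (\<lambda>a x. the_elem ((\<lambda>p. one_dim_char is p * x) ` a)),
     deg_part = (\<lambda>d'. if d' = d then UNIV else {0})\<rparr>"


section \<open>Bipartitions\<close>

type_synonym bipartition = "nat list \<times> nat list"
type_synonym node = "nat \<times> nat \<times> nat"

definition is_partition :: "nat list \<Rightarrow> bool" where
  "is_partition p \<longleftrightarrow> sorted_wrt (\<ge>) p \<and> 0 \<notin> set p"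

definition is_bipartition :: "bipartition \<Rightarrow> bool" where
  "is_bipartition \<mu> \<longleftrightarrow> is_partition (fst \<mu>) \<and> is_partition (snd \<mu>)"

definition bip_size :: "bipartition \<Rightarrow> nat" where
  "bip_size \<mu> = sum_list (fst \<mu>) + sum_list (snd \<mu>)"

definition component :: "bipartition \<Rightarrow> nat \<Rightarrow> nat list" where
  "component \<mu> c = (if c = 1 then fst \<mu> else snd \<mu>)"

definition nodes :: "bipartition \<Rightarrow> node set" where
  "nodes \<mu> = {(i, j, c). c \<in> {1, 2} \<and> 1 \<le> i \<and> i \<le> length (component \<mu> c) \<and>
                        1 \<le> j \<and> j \<le> component \<mu> c ! (i - 1)}"

definition res :: "nat \<Rightarrow> (nat \<Rightarrow> int) \<Rightarrow> node \<Rightarrow> int" where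
  "res e \<kappa> = (\<lambda>(i, j, c). (\<kappa> c + int j - int i) mod int e)"

definition above :: "node \<Rightarrow> node \<Rightarrow> bool" where
  "above = (\<lambda>(i1, j1, c1) (i2, j2, c2). c1 < c2 \<or> c1 = c2 \<and> i1 < i2)"

definition adds_to :: "bipartition \<Rightarrow> node \<Rightarrow> bipartition \<Rightarrow> bool" where
  "adds_to \<mu> A \<nu> \<longleftrightarrow>
    is_bipartition \<nu> \<and> A \<notin> nodes \<mu> \<and> nodes \<nu> = insert A (nodes \<mu>)"

definition addable :: "bipartition \<Rightarrow> node \<Rightarrow> bool" where
  "addable \<mu> A \<longleftrightarrow> (\<exists>\<nu>. adds_to \<mu> A \<nu>)"

definition removable :: "bipartition \<Rightarrow> node \<Rightarrow> bool" where
  "removable \<mu> A \<longleftrightarrow> (\<exists>\<nu>. is_bipartition \<nu> \<and> A \<in> nodes \<mu> \<and> nodes \<nu> = nodes \<mu> - {A})"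

text \<open>A sign \<open>True\<close> stands for \<open>+\<close> and \<open>False\<close> for \<open>-\<close>.  Addable and removable nodes of the
  same residue lie in pairwise different rows, so the list below is unique.\<close>

definition signature :: "nat \<Rightarrow> (nat \<Rightarrow> int) \<Rightarrow> int \<Rightarrow> bipartition \<Rightarrow> (bool \<times> node) list" where
  "signature e \<kappa> i \<mu> =
    (THE xs. sorted_wrt (\<lambda>x y. above (snd x) (snd y)) xs \<and>
       set xs = {(True, A) | A. addable \<mu> A \<and> res e \<kappa> A = i} \<union>
                {(False, A) | A. removable \<mu> A \<and> res e \<kappa> A = i})"

inductive cancel :: "(bool \<times> node) list \<Rightarrow> (bool \<times> node) list \<Rightarrow> bool" where
  "cancel (us @ [(True, A), (False, B)] @ vs) (us @ vs)"

definition conormal :: "nat \<Rightarrow> (nat \<Rightarrow> int) \<Rightarrow> int \<Rightarrow> bipartition \<Rightarrow> node \<Rightarrow> bool" where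
  "conormal e \<kappa> i \<mu> A \<longleftrightarrow>
    (\<exists>xs. cancel\<^sup>*\<^sup>* (signature e \<kappa> i \<mu>) xs \<and> (\<nexists>ys. cancel xs ys) \<and> (True, A) \<in> set xs)"

text \<open>\<open>up_arrow e \<kappa> i \<mu> \<nu>\<close> says that \<open>\<mu>\<up>\<^sub>i\<close> exists and is equal to \<open>\<nu>\<close>.\<close>

definition up_arrow :: "nat \<Rightarrow> (nat \<Rightarrow> int) \<Rightarrow> int \<Rightarrow> bipartition \<Rightarrow> bipartition \<Rightarrow> bool" where
  "up_arrow e \<kappa> i \<mu> \<nu> \<longleftrightarrow>
    (\<exists>A. conormal e \<kappa> i \<mu> A \<and> (\<forall>B. conormal e \<kappa> i \<mu> B \<longrightarrow> B = A \<or> above A B) \<and> adds_to \<mu> A \<nu>)"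

inductive regular :: "nat \<Rightarrow> (nat \<Rightarrow> int) \<Rightarrow> bipartition \<Rightarrow> bool"
  for e :: nat and \<kappa> :: "nat \<Rightarrow> int" where
  "regular e \<kappa> ([], [])"
| "\<lbrakk>regular e \<kappa> \<mu>; i \<in> {0..<int e}; up_arrow e \<kappa> i \<mu> \<nu>\<rbrakk> \<Longrightarrow> regular e \<kappa> \<nu>"

definition reg_bipartitions :: "nat \<Rightarrow> (nat \<Rightarrow> int) \<Rightarrow> nat \<Rightarrow> bipartition set" where
  "reg_bipartitions e \<kappa> n = {\<mu>. regular e \<kappa> \<mu> \<and> bip_size \<mu> = n}"

text \<open>The partition \<open>({a})\<close>: the terms are \<open>\<lfloor>(a + t)/(e - 1)\<rfloor>\<close> for \<open>t = e - 2, \<dots>, 0\<close>.\<close>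

definition braces :: "nat \<Rightarrow> nat \<Rightarrow> nat list" where
  "braces e a = filter (\<lambda>x. x \<noteq> 0) (map (\<lambda>t. (a + t) div (e - 1)) (rev [0..<e - 1]))"


section \<open>Simple modules and the Specht module\<close>

text \<open>\<open>is_simple_D e \<kappa> n \<mu> D\<close> says that \<open>D\<close> is (a copy of) \<open>D\<^sub>\<mu>\<close>, where \<open>\<mu>\<close> has size \<open>n\<close>,
  by the recursive characterisation.  All modules in the recursion live on the same carrier type;
  being finite-dimensional, they have copies on the type of functions from \<open>nat\<close> to the field.\<close>

inductive is_simple_D ::
    "nat \<Rightarrow> (nat \<Rightarrow> int) \<Rightarrow> nat \<Rightarrow> bipartition \<Rightarrow> ('f::field, 'b) klr_gmodule \<Rightarrow> bool"
  for e :: nat and \<kappa> :: "nat \<Rightarrow> int" where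
  empty: "\<lbrakk>klr_graded_module e \<kappa> 0 D;
           gmodule_iso (klr_algebra e \<kappa> 0) D (one_dim_module [] 0 :: ('f, 'f) klr_gmodule)\<rbrakk> \<Longrightarrow>
    is_simple_D e \<kappa> 0 ([], []) D"
| step: "\<lbrakk>is_simple_D e \<kappa> n \<mu> D; i \<in> {0..<int e}; up_arrow e \<kappa> i \<mu> \<nu>;
          klr_graded_module e \<kappa> (n + 1) D';
          irreducible_gmodule (klr_algebra e \<kappa> (n + 1)) D';
          gmodule_iso (klr_algebra e \<kappa> (n + 1)) D' (graded_dual e \<kappa> (n + 1) D');
          gmodule_iso (klr_algebra e \<kappa> n)
            (socle (klr_algebra e \<kappa> n) (i_restriction e \<kappa> n i D')) (grade_shift k D)\<rbrakk> \<Longrightarrow>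
    is_simple_D e \<kappa> (n + 1) \<nu> D'"

text \<open>The residue sequence and the degree of the unique standard tableau of shape
  \<open>(\<emptyset>, (1\<^sup>n))\<close>.\<close>

definition col_res :: "nat \<Rightarrow> (nat \<Rightarrow> int) \<Rightarrow> nat \<Rightarrow> int list" where
  "col_res e \<kappa> n = map (\<lambda>k. (\<kappa> 2 - int k) mod int e) [0..<n]"

definition col_deg :: "nat \<Rightarrow> (nat \<Rightarrow> int) \<Rightarrow> nat \<Rightarrow> int" where
  "col_deg e \<kappa> n =
    (\<Sum>k = 1..n.
       int (card {A. addable ([], replicate k 1) A \<and> res e \<kappa> A = res e \<kappa> (k, 1, 2) \<and>
                     above A (k, 1, 2)})
     - int (card {A. removable ([], replicate k 1) A \<and> res e \<kappa> A = res e \<kappa> (k, 1, 2) \<and>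
                     above A (k, 1, 2)}))"

definition specht_col :: "nat \<Rightarrow> (nat \<Rightarrow> int) \<Rightarrow> nat \<Rightarrow> ('f::field, 'f) klr_gmodule" where
  "specht_col e \<kappa> n = one_dim_module (col_res e \<kappa> n) (col_deg e \<kappa> n)"

end

theory Submission
  imports Defs
begin

text \<open>
  The Specht module is one-dimensional, so it has a single composition factor, and the task is to
  identify its label.  Restricting a one-dimensional module removes the last entry of its residue
  sequence, so that the label is computed by climbing from the empty bipartition along the residues
  \<open>\<kappa>\<^sub>2, \<kappa>\<^sub>2 - 1, \<dots>\<close>; each step adds the top node of the signature.  Conversely, every module
  carrying this label is one-dimensional: the signatures show that the label has a unique
  predecessor, and an irreducible module whose restriction has a one-dimensional socle spanned by
  \<open>x\<close> satisfies \<open>y\<^sub>n\<^sub>+\<^sub>1 x = 0\<close> (by degree) and \<open>\<psi>\<^sub>n x = 0\<close>, because the vectors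
  \<open>\<psi>\<^sub>k \<dots> \<psi>\<^sub>n x\<close> span a proper submodule.  Self-duality then fixes the degree, and the grading
  shift is the degree of the tableau.
\<close>


section \<open>The free algebra and the cyclotomic quotient\<close>

text \<open>The labelling of simple modules is a relation, \<open>is_simple_D\<close>, and is
  followed in both directions. From module to label it suffices that a one-dimensional module
  restricts to a one-dimensional module or to zero, because the arrow is a partial function. From
  label to module, a module must be rebuilt from the socle of its restriction, which sees neither
  \<open>y\<^sub>n\<^sub>+\<^sub>1\<close> nor \<open>\<psi>\<^sub>n\<close>. The delicate point
  there is to keep \<open>x\<close> out of the span. Moving a generator past
  \<open>\<psi>\<^sub>r\<close> leaves correction terms, and these lie in the span unless they are
  multiples of \<open>x\<close> itself. If \<open>i\<close> is the new residue and \<open>a\<close>,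
  \<open>b\<close> are the last and the last but one of the old ones, a multiple of \<open>x\<close>
  can only come from the relations for \<open>y\<close> if \<open>i = a\<close>, from the braid
  relation if \<open>i = b\<close>, or from the square of \<open>\<psi>\<^sub>n\<close> if
  \<open>i\<close> and \<open>a\<close> are distinct and not neighbours. Along the column
  \<open>i = a - 1 = b - 2\<close>, and \<open>e >= 3\<close> excludes all three. The shape of the
  label has its origin in \<open>l\<close>: after \<open>l\<close> nodes of the column, the node
  \<open>(1, 1, 1)\<close> has the next residue and lies higher. From then on component 1 is filled
  by columns of height \<open>e - 1\<close>.\<close>

lemma poly_mapping_eq_sum_single:
  "(p :: 'a \<Rightarrow>\<^sub>0 'b::comm_monoid_add) =
    (\<Sum>w\<in>Poly_Mapping.keys p. Poly_Mapping.single w (Poly_Mapping.lookup p w))"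
proof (rule poly_mapping_eqI)
  fix k
  have "Poly_Mapping.lookup (\<Sum>w\<in>Poly_Mapping.keys p. Poly_Mapping.single w (Poly_Mapping.lookup p w)) k
      = (\<Sum>w\<in>Poly_Mapping.keys p. if w = k then Poly_Mapping.lookup p w else 0)"
    by (simp add: lookup_sum lookup_single when_def)
  also have "\<dots> = Poly_Mapping.lookup p k"
    by (simp add: sum.delta in_keys_iff)
  finally show "Poly_Mapping.lookup p k =
    Poly_Mapping.lookup (\<Sum>w\<in>Poly_Mapping.keys p. Poly_Mapping.single w (Poly_Mapping.lookup p w)) k"
    by simp
qed

lemma free_algebra_simps [simp]:
  "carrier (free_algebra e n) = {p. \<forall>w \<in> Poly_Mapping.keys p. set w \<subseteq> gens e n}"
  "monoid.mult (free_algebra e n) = (*)" "one (free_algebra e n) = 1"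
  "zero (free_algebra e n) = 0" "add (free_algebra e n) = (+)"
  by (simp_all add: free_algebra_def)

text \<open>The simplifier unfolds \<open>carrier (free_algebra e n)\<close> into a condition on
  keys; under a name of its own, membership can be proved by introduction rules.\<close>

definition words_in :: "nat \<Rightarrow> nat \<Rightarrow> 'f::field free set" where
  "words_in e n = {p. \<forall>w \<in> Poly_Mapping.keys p. set w \<subseteq> gens e n}"

lemma carrier_free_algebra: "carrier (free_algebra e n) = words_in e n"
  by (simp add: words_in_def)

lemma free_induct_UNIV [case_names zero single add]:
  assumes "P 0" and "\<And>w c. P (Poly_Mapping.single w c)"
    and "\<And>p q. P p \<Longrightarrow> P q \<Longrightarrow> P (p + q)"
  shows "P (p :: 'a \<Rightarrow>\<^sub>0 'b::comm_monoid_add)"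
proof -
  have "P (\<Sum>w\<in>A. Poly_Mapping.single w (Poly_Mapping.lookup p w))" if "finite A" for A
    using that by (induction A rule: finite_induct) (use assms in auto)
  from this[of "Poly_Mapping.keys p"] show ?thesis
    by (subst poly_mapping_eq_sum_single) simp
qed

lemma words_in_zero [simp]: "0 \<in> words_in e n"
  and words_in_one [simp]: "1 \<in> words_in e n"
  by (auto simp: words_in_def zero_list_def)

lemma words_in_add [intro, simp]: "p \<in> words_in e n \<Longrightarrow> q \<in> words_in e n \<Longrightarrow> p + q \<in> words_in e n"
  unfolding words_in_def using Poly_Mapping.keys_add[of p q] by blast

lemma words_in_uminus [intro, simp]: "p \<in> words_in e n \<Longrightarrow> - p \<in> words_in e n"
  by (simp add: words_in_def)

lemma words_in_diff [intro, simp]: "p \<in> words_in e n \<Longrightarrow> q \<in> words_in e n \<Longrightarrow> p - q \<in> words_in e n"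
  using words_in_add[of p e n "- q"] by simp

lemma words_in_mult [intro, simp]: "p \<in> words_in e n \<Longrightarrow> q \<in> words_in e n \<Longrightarrow> p * q \<in> words_in e n"
  unfolding words_in_def using Poly_Mapping.keys_mult[of p q] by (fastforce simp: plus_list_def)

lemma words_in_sum [intro, simp]:
  "(\<And>i. i \<in> A \<Longrightarrow> f i \<in> words_in e n) \<Longrightarrow> sum f A \<in> words_in e n"
  by (induction A rule: infinite_finite_induct) auto

lemma words_in_power [intro, simp]: "p \<in> words_in e n \<Longrightarrow> p ^ k \<in> words_in e n"
  by (induction k) auto

lemma words_in_single [intro, simp]: "set w \<subseteq> gens e n \<Longrightarrow> Poly_Mapping.single w c \<in> words_in e n"
  by (auto simp: words_in_def)

text \<open>Unlike \<open>free_induct_UNIV\<close>, this induction never leaves the carrier, so the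
  induction hypotheses come with membership in \<open>words_in\<close>.\<close>

lemma free_induct [consumes 1, case_names zero single add]:
  assumes "p \<in> words_in e n"
    and "P 0" and "\<And>w c. set w \<subseteq> gens e n \<Longrightarrow> P (Poly_Mapping.single w c)"
    and "\<And>p q. p \<in> words_in e n \<Longrightarrow> q \<in> words_in e n \<Longrightarrow> P p \<Longrightarrow> P q \<Longrightarrow> P (p + q)"
  shows "P p"
proof -
  have "P (\<Sum>w\<in>A. Poly_Mapping.single w (Poly_Mapping.lookup p w))"
    if "finite A" "A \<subseteq> Poly_Mapping.keys p" for A
    using that
  proof (induction A rule: finite_induct)
    case (insert w A)
    have keys: "set v \<subseteq> gens e n" if "v \<in> Poly_Mapping.keys p" for v
      using assms(1) that by (auto simp: words_in_def)
    have "P (Poly_Mapping.single w (Poly_Mapping.lookup p w) +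
        (\<Sum>w\<in>A. Poly_Mapping.single w (Poly_Mapping.lookup p w)))"
      by (rule assms(4)) (use insert keys assms(3) in \<open>auto intro!: words_in_sum words_in_single\<close>)
    then show ?case
      using insert by simp
  qed (use assms(2) in simp)
  from this[of "Poly_Mapping.keys p"] show ?thesis
    by (subst poly_mapping_eq_sum_single) simp
qed

lemma words_in_X [intro, simp]: "g \<in> gens e n \<Longrightarrow> X g \<in> words_in e n"
  by (simp add: X_def)

lemma words_in_delta [simp]: "delta i j \<in> words_in e n"
  by (simp add: delta_def)

lemma gens_simps [simp]:
  "E is \<in> gens e n \<longleftrightarrow> is \<in> res_seqs e n"
  "Y r \<in> gens e n \<longleftrightarrow> 1 \<le> r \<and> r \<le> n"
  "Psi r \<in> gens e n \<longleftrightarrow> 1 \<le> r \<and> r < n"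
  by (auto simp: gens_def)

lemma free_algebra_ring: "ring (free_algebra e n :: 'f::field free ring)"
proof (rule ringI)
  show "abelian_group (free_algebra e n :: 'f free ring)"
  proof (rule abelian_groupI)
    fix x :: "'f free" assume "x \<in> carrier (free_algebra e n)"
    then show "\<exists>y\<in>carrier (free_algebra e n). y \<oplus>\<^bsub>free_algebra e n\<^esub> x = \<zero>\<^bsub>free_algebra e n\<^esub>"
      by (intro bexI[of _ "- x"]) auto
  qed (auto simp: algebra_simps carrier_free_algebra simp del: free_algebra_simps(1))
  show "monoid (free_algebra e n :: 'f free ring)"
    by (rule monoidI) (auto simp: algebra_simps carrier_free_algebra simp del: free_algebra_simps(1))
qed (simp_all add: algebra_simps)

lemma finite_res_seqs: "finite (res_seqs e n)"
proof -
  have "res_seqs e n \<subseteq> {xs. set xs \<subseteq> {0..<int e} \<and> length xs = n}"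
    by (auto simp: res_seqs_def)
  then show ?thesis
    by (rule finite_subset) (simp add: finite_lists_length_eq)
qed

lemma length_swap_res [simp]: "length (swap_res r is) = length is"
  by (simp add: swap_res_def)

lemma swap_res_in_res_seqs:
  assumes "1 \<le> r" "r < n" "is \<in> res_seqs e n" shows "swap_res r is \<in> res_seqs e n"
proof -
  have "ent is (r + 1) \<in> set is" "ent is r \<in> set is"
    using assms by (auto simp: res_seqs_def)
  moreover have "set (swap_res r is) \<subseteq> insert (ent is (r + 1)) (insert (ent is r) (set is))"
    unfolding swap_res_def
    using set_update_subset_insert[of "is[r - 1 := ent is (r + 1)]" r "ent is r"]
      set_update_subset_insert[of "is" "r - 1" "ent is (r + 1)"] by blast
  ultimately have "set (swap_res r is) \<subseteq> set is"
    by blast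
  then show ?thesis
    using assms by (auto simp: res_seqs_def)
qed

section \<open>The ideal generated by the relators\<close>

lemma klr_relators_in_words: "klr_relators e \<kappa> n \<subseteq> words_in e n"
proof
  fix p :: "'a free" assume "p \<in> klr_relators e \<kappa> n"
  then show "p \<in> words_in e n"
    by cases (auto simp: finite_res_seqs swap_res_in_res_seqs psi_square_def braid_error_def)
qed

lemma klr_ideal_ideal: "ideal (klr_ideal e \<kappa> n) (free_algebra e n)"
  unfolding klr_ideal_def
  by (rule ring.genideal_ideal[OF free_algebra_ring])
     (use klr_relators_in_words in \<open>simp only: carrier_free_algebra\<close>)

lemma klr_relator_in_ideal: "p \<in> klr_relators e \<kappa> n \<Longrightarrow> p \<in> klr_ideal e \<kappa> n"
  unfolding klr_ideal_def
  using ring.genideal_self[OF free_algebra_ring, of "klr_relators e \<kappa> n" e n] klr_relators_in_words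
  by (metis carrier_free_algebra subsetD)

text \<open>The elements of the carrier that satisfy \<open>P\<close> form an ideal, and the
  generated ideal is the smallest one that contains the relators. Statements about the whole ideal
  are thus reduced to the families of relators.\<close>

lemma klr_ideal_induct [consumes 1, case_names relator zero add uminus mult_right mult_left]:
  assumes "p \<in> klr_ideal e \<kappa> n"
    and "\<And>p. p \<in> klr_relators e \<kappa> n \<Longrightarrow> P p"
    and "P 0" "\<And>p q. p \<in> words_in e n \<Longrightarrow> q \<in> words_in e n \<Longrightarrow> P p \<Longrightarrow> P q \<Longrightarrow> P (p + q)"
    and "\<And>p. p \<in> words_in e n \<Longrightarrow> P p \<Longrightarrow> P (- p)"
    and "\<And>p q. p \<in> words_in e n \<Longrightarrow> q \<in> words_in e n \<Longrightarrow> P p \<Longrightarrow> P (p * q)"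
    and "\<And>p q. p \<in> words_in e n \<Longrightarrow> q \<in> words_in e n \<Longrightarrow> P p \<Longrightarrow> P (q * p)"
  shows "P p"
proof -
  interpret R: ring "free_algebra e n :: 'a free ring" by (rule free_algebra_ring)
  have neg: "\<ominus>\<^bsub>free_algebra e n\<^esub> x = - x" if "x \<in> words_in e n" for x :: "'a free"
    using that by (intro R.minus_equality) (auto simp: words_in_def)
  have "ideal {p \<in> words_in e n. P p} (free_algebra e n)"
  proof (rule idealI[OF free_algebra_ring])
    show "subgroup {p \<in> words_in e n. P p} (add_monoid (free_algebra e n))"
      by (rule subgroup.intro, simp_all add: carrier_free_algebra del: free_algebra_simps(1))
         (use assms(3-5) neg in \<open>auto simp: a_inv_def carrier_free_algebra simp del: free_algebra_simps(1)\<close>)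
  qed (use assms(6,7) in \<open>auto simp: carrier_free_algebra simp del: free_algebra_simps(1)\<close>)
  then have "klr_ideal e \<kappa> n \<subseteq> {p \<in> words_in e n. P p}"
    unfolding klr_ideal_def
    by (rule R.genideal_minimal) (use klr_relators_in_words assms(2) in auto)
  with assms(1) show ?thesis by auto
qed

section \<open>The quotient map and its cosets\<close>

lemma klr_class_ring_hom: "klr_class e \<kappa> n \<in> ring_hom (free_algebra e n) (klr_algebra e \<kappa> n)"
  using ideal.rcos_ring_hom[OF klr_ideal_ideal[where e=e and n=n and \<kappa>=\<kappa>]]
  unfolding klr_algebra_def by (simp add: klr_class_def[abs_def])

lemma klr_algebra_ring: "ring (klr_algebra e \<kappa> n)"
  unfolding klr_algebra_def by (rule ideal.quotient_is_ring[OF klr_ideal_ideal])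

lemma klr_class_closed [intro, simp]:
  "p \<in> words_in e n \<Longrightarrow> klr_class e \<kappa> n p \<in> carrier (klr_algebra e \<kappa> n)"
  using ring_hom_closed[OF klr_class_ring_hom] unfolding carrier_free_algebra .

lemma klr_class_mult: "p \<in> words_in e n \<Longrightarrow> q \<in> words_in e n \<Longrightarrow>
    klr_class e \<kappa> n (p * q) = klr_class e \<kappa> n p \<otimes>\<^bsub>klr_algebra e \<kappa> n\<^esub> klr_class e \<kappa> n q"
  using ring_hom_mult[OF klr_class_ring_hom[where e=e and n=n and \<kappa>=\<kappa>], of p q]
  by (simp add: carrier_free_algebra del: free_algebra_simps(1))

lemma klr_class_add: "p \<in> words_in e n \<Longrightarrow> q \<in> words_in e n \<Longrightarrow>
    klr_class e \<kappa> n (p + q) = klr_class e \<kappa> n p \<oplus>\<^bsub>klr_algebra e \<kappa> n\<^esub> klr_class e \<kappa> n q"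
  using ring_hom_add[OF klr_class_ring_hom[where e=e and n=n and \<kappa>=\<kappa>], of p q]
  by (simp add: carrier_free_algebra del: free_algebra_simps(1))

lemma klr_class_one: "klr_class e \<kappa> n 1 = \<one>\<^bsub>klr_algebra e \<kappa> n\<^esub>"
  using ring_hom_one[OF klr_class_ring_hom[where e=e and n=n and \<kappa>=\<kappa>]] by simp

lemma klr_class_iff: "q \<in> klr_class e \<kappa> n p \<longleftrightarrow> q - p \<in> klr_ideal e \<kappa> n"
proof -
  have "q \<in> klr_class e \<kappa> n p \<longleftrightarrow> (\<exists>h \<in> klr_ideal e \<kappa> n. q = h + p)"
    by (auto simp: klr_class_def a_r_coset_def r_coset_def)
  also have "\<dots> \<longleftrightarrow> q - p \<in> klr_ideal e \<kappa> n"
    by (auto intro: bexI[of _ "q - p"])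
  finally show ?thesis .
qed

lemma klr_class_self: "p \<in> klr_class e \<kappa> n p"
  using additive_subgroup.zero_closed[OF ideal.axioms(1)[OF klr_ideal_ideal[of e \<kappa> n]]]
  by (simp add: klr_class_iff)

lemma klr_ideal_add: "p \<in> klr_ideal e \<kappa> n \<Longrightarrow> q \<in> klr_ideal e \<kappa> n \<Longrightarrow> p + q \<in> klr_ideal e \<kappa> n"
  using additive_subgroup.a_closed[OF ideal.axioms(1)[OF klr_ideal_ideal]]
  unfolding free_algebra_simps(5) .

lemma klr_ideal_mult_right:
  "p \<in> klr_ideal e \<kappa> n \<Longrightarrow> q \<in> words_in e n \<Longrightarrow> p * q \<in> klr_ideal e \<kappa> n"
  using ideal.I_r_closed[OF klr_ideal_ideal] unfolding free_algebra_simps(2) carrier_free_algebra .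

lemma klr_ideal_mult_left:
  "p \<in> klr_ideal e \<kappa> n \<Longrightarrow> q \<in> words_in e n \<Longrightarrow> q * p \<in> klr_ideal e \<kappa> n"
  using ideal.I_l_closed[OF klr_ideal_ideal] unfolding free_algebra_simps(2) carrier_free_algebra .

lemma klr_ideal_zero [simp]: "0 \<in> klr_ideal e \<kappa> n"
  using klr_class_self[of 0 e \<kappa> n] by (simp add: klr_class_iff)

lemma klr_ideal_uminus: "p \<in> klr_ideal e \<kappa> n \<Longrightarrow> - p \<in> klr_ideal e \<kappa> n"
  using klr_ideal_mult_left[of p e \<kappa> n "- 1"] by simp

lemma klr_ideal_diff: "p \<in> klr_ideal e \<kappa> n \<Longrightarrow> q \<in> klr_ideal e \<kappa> n \<Longrightarrow> p - q \<in> klr_ideal e \<kappa> n"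
  using klr_ideal_add[of p e \<kappa> n "- q"] klr_ideal_uminus by auto

lemma klr_class_eqI:
  assumes pq: "p - q \<in> klr_ideal e \<kappa> n"
  shows "klr_class e \<kappa> n p = klr_class e \<kappa> n q"
proof (rule Set.set_eqI)
  fix r
  show "r \<in> klr_class e \<kappa> n p \<longleftrightarrow> r \<in> klr_class e \<kappa> n q"
    unfolding klr_class_iff
    using klr_ideal_add[OF _ pq, of "r - p"] klr_ideal_diff[OF _ pq, of "r - q"]
    by (metis add_diff_eq diff_add_cancel diff_diff_eq2)
qed

lemma carrier_klr_algebra: "carrier (klr_algebra e \<kappa> n) = klr_class e \<kappa> n ` words_in e n"
proof -
  have "carrier (klr_algebra e \<kappa> n) =
      (\<Union>p\<in>carrier (free_algebra e n). {klr_class e \<kappa> n p})"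
    unfolding klr_algebra_def FactRing_def A_RCOSETS_def RCOSETS_def klr_class_def a_r_coset_def
    by simp
  then show ?thesis
    unfolding carrier_free_algebra by blast
qed

lemma klr_algebra_cases:
  assumes "a \<in> carrier (klr_algebra e \<kappa> n)"
  obtains p where "p \<in> words_in e n" "a = klr_class e \<kappa> n p"
  using assms unfolding carrier_klr_algebra by (elim imageE)

lemma klr_zero: "\<zero>\<^bsub>klr_algebra e \<kappa> n\<^esub> = klr_class e \<kappa> n 0"
proof -
  have "\<zero>\<^bsub>klr_algebra e \<kappa> n\<^esub> = klr_ideal e \<kappa> n"
    by (simp add: klr_algebra_def FactRing_def)
  also have "\<dots> = klr_class e \<kappa> n 0"
    by (rule Set.set_eqI) (simp add: klr_class_iff)
  finally show ?thesis .
qed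

lemma klr_scalar_closed [intro, simp]: "klr_scalar e \<kappa> n c \<in> carrier (klr_algebra e \<kappa> n)"
  unfolding klr_scalar_def by (intro klr_class_closed words_in_single) simp

section \<open>One-dimensional modules\<close>

lemma one_dim_char_superset:
  assumes "finite A" "Poly_Mapping.keys p \<subseteq> A"
  shows "one_dim_char is p = (\<Sum>w \<in> A. if set w \<subseteq> {E is} then Poly_Mapping.lookup p w else 0)"
  unfolding one_dim_char_def
  by (rule sum.mono_neutral_left) (use assms in \<open>auto simp: in_keys_iff\<close>)

lemma one_dim_char_zero [simp]: "one_dim_char is 0 = 0"
  by (simp add: one_dim_char_def)

lemma one_dim_char_single [simp]:
  "one_dim_char is (Poly_Mapping.single w c) = (if set w \<subseteq> {E is} then c else 0)"
  by (simp add: one_dim_char_def)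

lemma one_dim_char_add [simp]: "one_dim_char is (p + q) = one_dim_char is p + one_dim_char is q"
  using Poly_Mapping.keys_add[of p q]
  by (subst (1 2 3) one_dim_char_superset[of "Poly_Mapping.keys p \<union> Poly_Mapping.keys q"])
     (auto simp: lookup_add sum.distrib[symmetric] intro!: sum.cong)

lemma one_dim_char_uminus [simp]: "one_dim_char is (- p) = - one_dim_char is p"
  using one_dim_char_add[of "is" p "- p"] by (simp add: eq_neg_iff_add_eq_0 add.commute)

lemma one_dim_char_diff [simp]: "one_dim_char is (p - q) = one_dim_char is p - one_dim_char is q"
  using one_dim_char_add[of "is" p "- q"] by simp

text \<open>A word contributes exactly if all its letters are \<open>E is\<close>, and a
  concatenation has this property exactly if both factors have it.\<close>

lemma one_dim_char_mult [simp]: "one_dim_char is (p * q) = one_dim_char is p * one_dim_char is q"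
proof (induction p rule: free_induct_UNIV)
  case (single w c)
  show ?case
  proof (induction q rule: free_induct_UNIV)
    case (single w' c')
    show ?case by (auto simp: mult_single plus_list_def)
  qed (simp_all add: algebra_simps)
qed (simp_all add: algebra_simps)

lemma one_dim_char_one [simp]: "one_dim_char is 1 = 1"
  using one_dim_char_single[of "is" "[]" 1] by (metis empty_set empty_subsetI single_one zero_list_def)

lemma one_dim_char_X [simp]: "one_dim_char is (X g) = (if g = E is then 1 else 0)"
  by (simp add: X_def)

lemma one_dim_char_sum: "one_dim_char is (sum f A) = (\<Sum>i\<in>A. one_dim_char is (f i))"
  by (induction A rule: infinite_finite_induct) auto

lemma one_dim_char_power: "one_dim_char is (p ^ k) = one_dim_char is p ^ k"
  by (induction k) auto

section \<open>Isomorphisms of graded modules\<close>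

lemma gmodule_isoE:
  assumes "gmodule_iso R M N"
  obtains \<phi> where "bij_betw \<phi> (carrier M) (carrier N)"
    "\<And>x y. x \<in> carrier M \<Longrightarrow> y \<in> carrier M \<Longrightarrow> \<phi> (x \<oplus>\<^bsub>M\<^esub> y) = \<phi> x \<oplus>\<^bsub>N\<^esub> \<phi> y"
    "\<And>a x. a \<in> carrier R \<Longrightarrow> x \<in> carrier M \<Longrightarrow> \<phi> (a \<odot>\<^bsub>M\<^esub> x) = a \<odot>\<^bsub>N\<^esub> \<phi> x"
    "\<And>d. \<phi> ` deg_part M d = deg_part N d"
  using assms unfolding gmodule_iso_def
  by (elim exE conjE) (rule that, assumption, (drule (1) bspec)+, assumption, (drule (1) bspec)+, assumption,
    erule allE, assumption)

lemma gmodule_iso_trans: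
  assumes "gmodule_iso R M N" "gmodule_iso R N P"
  shows "gmodule_iso R M P"
proof -
  obtain \<phi> where \<phi>: "bij_betw \<phi> (carrier M) (carrier N)"
    "\<And>x y. x \<in> carrier M \<Longrightarrow> y \<in> carrier M \<Longrightarrow> \<phi> (x \<oplus>\<^bsub>M\<^esub> y) = \<phi> x \<oplus>\<^bsub>N\<^esub> \<phi> y"
    "\<And>a x. a \<in> carrier R \<Longrightarrow> x \<in> carrier M \<Longrightarrow> \<phi> (a \<odot>\<^bsub>M\<^esub> x) = a \<odot>\<^bsub>N\<^esub> \<phi> x"
    "\<And>d. \<phi> ` deg_part M d = deg_part N d"
    by (rule gmodule_isoE[OF assms(1)]) (rule that)
  obtain \<psi> where \<psi>: "bij_betw \<psi> (carrier N) (carrier P)"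
    "\<And>x y. x \<in> carrier N \<Longrightarrow> y \<in> carrier N \<Longrightarrow> \<psi> (x \<oplus>\<^bsub>N\<^esub> y) = \<psi> x \<oplus>\<^bsub>P\<^esub> \<psi> y"
    "\<And>a x. a \<in> carrier R \<Longrightarrow> x \<in> carrier N \<Longrightarrow> \<psi> (a \<odot>\<^bsub>N\<^esub> x) = a \<odot>\<^bsub>P\<^esub> \<psi> x"
    "\<And>d. \<psi> ` deg_part N d = deg_part P d"
    by (rule gmodule_isoE[OF assms(2)]) (rule that)
  have in_N: "\<phi> x \<in> carrier N" if "x \<in> carrier M" for x
    using that \<phi>(1) by (auto simp: bij_betw_def)
  show ?thesis
    unfolding gmodule_iso_def
  proof (intro exI[of _ "\<psi> \<circ> \<phi>"] conjI ballI allI)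
    show "bij_betw (\<psi> \<circ> \<phi>) (carrier M) (carrier P)"
      using \<phi>(1) \<psi>(1) by (rule bij_betw_trans)
    show "(\<psi> \<circ> \<phi>) ` deg_part M d = deg_part P d" for d
      unfolding image_comp[symmetric] \<phi>(4) \<psi>(4) ..
  qed (simp_all add: \<phi>(2-3) \<psi>(2-3) in_N)
qed

text \<open>The records are arbitrary, so closure of \<open>M\<close> is a premise: the inverse map
  respects an operation only because the result in \<open>M\<close> lies in the carrier, where the
  inverse undoes \<open>\<phi>\<close>.\<close>

lemma gmodule_iso_sym:
  assumes "gmodule_iso R M N"
    and "\<And>x y. x \<in> carrier M \<Longrightarrow> y \<in> carrier M \<Longrightarrow> x \<oplus>\<^bsub>M\<^esub> y \<in> carrier M"
    and "\<And>a x. a \<in> carrier R \<Longrightarrow> x \<in> carrier M \<Longrightarrow> a \<odot>\<^bsub>M\<^esub> x \<in> carrier M"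
    and "\<And>d. deg_part M d \<subseteq> carrier M"
  shows "gmodule_iso R N M"
proof -
  obtain \<phi> where \<phi>: "bij_betw \<phi> (carrier M) (carrier N)"
    "\<And>x y. x \<in> carrier M \<Longrightarrow> y \<in> carrier M \<Longrightarrow> \<phi> (x \<oplus>\<^bsub>M\<^esub> y) = \<phi> x \<oplus>\<^bsub>N\<^esub> \<phi> y"
    "\<And>a x. a \<in> carrier R \<Longrightarrow> x \<in> carrier M \<Longrightarrow> \<phi> (a \<odot>\<^bsub>M\<^esub> x) = a \<odot>\<^bsub>N\<^esub> \<phi> x"
    "\<And>d. \<phi> ` deg_part M d = deg_part N d"
    by (rule gmodule_isoE[OF assms(1)]) (rule that)
  define \<psi> where "\<psi> = inv_into (carrier M) \<phi>"
  have \<psi>: "\<psi> y \<in> carrier M" "\<phi> (\<psi> y) = y" if "y \<in> carrier N" for y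
    using that \<phi>(1) unfolding \<psi>_def bij_betw_def by (auto intro: inv_into_into f_inv_into_f)
  have \<psi>\<phi>: "\<psi> (\<phi> x) = x" if "x \<in> carrier M" for x
    using that \<phi>(1) unfolding \<psi>_def bij_betw_def by (auto intro: inv_into_f_f)
  show ?thesis
    unfolding gmodule_iso_def
  proof (intro exI[of _ \<psi>] conjI ballI allI)
    show "bij_betw \<psi> (carrier N) (carrier M)"
      unfolding \<psi>_def by (rule bij_betw_inv_into[OF \<phi>(1)])
    show "\<psi> (x \<oplus>\<^bsub>N\<^esub> y) = \<psi> x \<oplus>\<^bsub>M\<^esub> \<psi> y" if "x \<in> carrier N" "y \<in> carrier N" for x y
      using that \<psi> \<phi>(2) \<psi>\<phi> assms(2) by metis
    show "\<psi> (a \<odot>\<^bsub>N\<^esub> x) = a \<odot>\<^bsub>M\<^esub> \<psi> x" if "a \<in> carrier R" "x \<in> carrier N" for a x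
      using that \<psi> \<phi>(3) \<psi>\<phi> assms(3) by metis
    show "\<psi> ` deg_part N d = deg_part M d" for d
    proof -
      have "\<psi> ` deg_part N d = (\<lambda>x. \<psi> (\<phi> x)) ` deg_part M d"
        unfolding \<phi>(4)[symmetric] image_image ..
      also have "\<dots> = (\<lambda>x. x) ` deg_part M d"
        by (rule image_cong) (use assms(4)[of d] \<psi>\<phi> in blast)+
      finally show ?thesis by simp
    qed
  qed
qed

lemma gmodule_iso_grade_shift:
  "gmodule_iso R (grade_shift k M) N \<longleftrightarrow> gmodule_iso R M (grade_shift (- k) N)"
proof -
  have "(\<forall>d. \<phi> ` deg_part M (d - k) = deg_part N d) \<longleftrightarrow> (\<forall>d. \<phi> ` deg_part M d = deg_part N (d + k))" for \<phi>
    by (metis add_diff_cancel diff_add_cancel)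
  then show ?thesis
    by (simp add: gmodule_iso_def grade_shift_def)
qed

lemma grade_shift_one_dim [simp]: "grade_shift k (one_dim_module is d) = one_dim_module is (d + k)"
  by (auto simp: grade_shift_def one_dim_module_def fun_eq_iff)

lemma grade_shift_0 [simp]: "grade_shift 0 M = M"
  by (simp add: grade_shift_def)

section \<open>Characters of the free algebra that vanish on the ideal\<close>

locale klr_char =
  fixes e :: nat and \<kappa> :: "nat \<Rightarrow> int" and n :: nat and "is" :: "int list" and F :: "'f::field itself"
  assumes seq: "is \<in> res_seqs e n"
    and kills: "\<And>p :: 'f free. p \<in> klr_ideal e \<kappa> n \<Longrightarrow> one_dim_char is p = 0"
begin

text \<open>The character is constant on cosets by \<open>kills\<close>, so the
  \<open>the_elem\<close> in \<open>one_dim_module\<close> is applied to a singleton.\<close>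

lemma one_dim_smult:
  "klr_class e \<kappa> n p \<odot>\<^bsub>one_dim_module is d\<^esub> x = one_dim_char is p * (x :: 'f)"
proof -
  have "(\<lambda>q. one_dim_char is q * x) ` klr_class e \<kappa> n p = {one_dim_char is p * x}"
    using kills klr_class_self[of p e \<kappa> n] by (fastforce simp: klr_class_iff)
  then show ?thesis
    by (simp add: one_dim_module_def)
qed

lemma gmodule_iso_one_dim:
  fixes M :: "('f, 'b) klr_gmodule"
  shows "gmodule_iso (klr_algebra e \<kappa> n) M (one_dim_module is d :: ('f, 'f) klr_gmodule) \<longleftrightarrow>
    (\<exists>\<phi>. bij_betw \<phi> (carrier M) UNIV \<and>
      (\<forall>x \<in> carrier M. \<forall>y \<in> carrier M. \<phi> (x \<oplus>\<^bsub>M\<^esub> y) = \<phi> x + \<phi> y) \<and>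
      (\<forall>p \<in> words_in e n. \<forall>x \<in> carrier M.
        \<phi> (klr_class e \<kappa> n p \<odot>\<^bsub>M\<^esub> x) = one_dim_char is p * \<phi> x) \<and>
      (\<forall>d'. \<phi> ` deg_part M d' = (if d' = d then UNIV else {0})))"
  unfolding gmodule_iso_def carrier_klr_algebra ball_simps one_dim_smult
  by (simp add: one_dim_module_def)

lemma gmodule_iso_one_dimE:
  fixes M :: "('f, 'b) klr_gmodule"
  assumes "gmodule_iso (klr_algebra e \<kappa> n) M (one_dim_module is d :: ('f, 'f) klr_gmodule)"
  obtains \<phi> where "bij_betw \<phi> (carrier M) UNIV"
    "\<And>x y. x \<in> carrier M \<Longrightarrow> y \<in> carrier M \<Longrightarrow> \<phi> (x \<oplus>\<^bsub>M\<^esub> y) = \<phi> x + \<phi> y"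
    "\<And>p x. p \<in> words_in e n \<Longrightarrow> x \<in> carrier M \<Longrightarrow>
      \<phi> (klr_class e \<kappa> n p \<odot>\<^bsub>M\<^esub> x) = one_dim_char is p * \<phi> x"
    "\<And>d'. \<phi> ` deg_part M d' = (if d' = d then UNIV else {0})"
proof -
  from assms[unfolded gmodule_iso_one_dim] obtain \<phi> where
    1: "bij_betw \<phi> (carrier M) UNIV" and
    2: "\<forall>x \<in> carrier M. \<forall>y \<in> carrier M. \<phi> (x \<oplus>\<^bsub>M\<^esub> y) = \<phi> x + \<phi> y" and
    3: "\<forall>p \<in> words_in e n. \<forall>x \<in> carrier M.
        \<phi> (klr_class e \<kappa> n p \<odot>\<^bsub>M\<^esub> x) = one_dim_char is p * \<phi> x" and
    4: "\<forall>d'. \<phi> ` deg_part M d' = (if d' = d then UNIV else {0})"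
    by (elim exE conjE)
  show ?thesis
    by (rule that[OF 1 2[rule_format] 3[rule_format] 4[rule_format]])
qed

text \<open>This makes a module concentrated in one degree graded: an element of nonzero degree must
  act by zero. The character kills \<open>y\<^sub>r\<close> and \<open>\<psi>\<^sub>r\<close>, and
  in a product of nonzero total degree at least one factor has nonzero degree.\<close>

lemma homog_char:
  assumes "klr_homogp e \<kappa> n d (a :: 'f free set)"
  shows "\<exists>p \<in> words_in e n. a = klr_class e \<kappa> n p \<and> (d \<noteq> 0 \<longrightarrow> one_dim_char is p = 0)"
  using assms
proof (induction rule: klr_homogp.induct)
  case (1 js)
  then show ?case by (intro bexI[of _ "ee js"]) auto
next
  case (2 r)
  then show ?case by (intro bexI[of _ "yy r"]) auto
next
  case (3 r js)
  then show ?case by (intro bexI[of _ "psi r * ee js"]) auto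
next
  case (4 d a d' b)
  then obtain p q where "p \<in> words_in e n" "a = klr_class e \<kappa> n p" "d \<noteq> 0 \<longrightarrow> one_dim_char is p = 0"
    "q \<in> words_in e n" "b = klr_class e \<kappa> n q" "d' \<noteq> 0 \<longrightarrow> one_dim_char is q = 0"
    by blast
  then show ?case by (intro bexI[of _ "p * q"]) (auto simp: klr_class_mult)
next
  case (5 d)
  then show ?case by (intro bexI[of _ 0]) (auto simp: klr_zero)
next
  case (6 d a b)
  then obtain p q where "p \<in> words_in e n" "a = klr_class e \<kappa> n p" "d \<noteq> 0 \<longrightarrow> one_dim_char is p = 0"
    "q \<in> words_in e n" "b = klr_class e \<kappa> n q" "d \<noteq> 0 \<longrightarrow> one_dim_char is q = 0"
    by blast
  then show ?case by (intro bexI[of _ "p + q"]) (auto simp: klr_class_add)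
next
  case (7 d a c)
  then obtain p where "p \<in> words_in e n" "a = klr_class e \<kappa> n p" "d \<noteq> 0 \<longrightarrow> one_dim_char is p = 0"
    by blast
  moreover have "Poly_Mapping.single [] c \<in> words_in e n"
    by (rule words_in_single) simp
  ultimately show ?case
    by (intro bexI[of _ "Poly_Mapping.single [] c * p"]) (auto simp: klr_scalar_def klr_class_mult)
qed

lemma one_dim_left_module:
  "left_module (klr_algebra e \<kappa> n) (one_dim_module is d :: ('f, 'f) klr_gmodule)"
proof -
  let ?M = "one_dim_module is d :: ('f, 'f) klr_gmodule"
  have M: "carrier ?M = UNIV" "\<zero>\<^bsub>?M\<^esub> = 0" "x \<oplus>\<^bsub>?M\<^esub> y = x + y" for x y
    by (simp_all add: one_dim_module_def)
  have "abelian_group ?M"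
  proof (rule abelian_groupI)
    fix x assume "x \<in> carrier ?M"
    show "\<exists>y\<in>carrier ?M. y \<oplus>\<^bsub>?M\<^esub> x = \<zero>\<^bsub>?M\<^esub>"
      unfolding M by (rule bexI[of _ "- x"]) auto
  qed (simp_all add: M)
  moreover have "left_module_axioms (klr_algebra e \<kappa> n) ?M"
  proof (rule left_module_axioms.intro)
    fix a b :: "'f free set" and x y
    assume "a \<in> carrier (klr_algebra e \<kappa> n)"
    then obtain p where p: "p \<in> words_in e n" "a = klr_class e \<kappa> n p"
      by (rule klr_algebra_cases)
    show "a \<odot>\<^bsub>?M\<^esub> x \<in> carrier ?M"
      unfolding M by simp
    show "a \<odot>\<^bsub>?M\<^esub> (x \<oplus>\<^bsub>?M\<^esub> y) = a \<odot>\<^bsub>?M\<^esub> x \<oplus>\<^bsub>?M\<^esub> a \<odot>\<^bsub>?M\<^esub> y"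
      unfolding M p(2) one_dim_smult by (rule distrib_left)
    assume "b \<in> carrier (klr_algebra e \<kappa> n)"
    then obtain q where q: "q \<in> words_in e n" "b = klr_class e \<kappa> n q"
      by (rule klr_algebra_cases)
    show "(a \<oplus>\<^bsub>klr_algebra e \<kappa> n\<^esub> b) \<odot>\<^bsub>?M\<^esub> x = a \<odot>\<^bsub>?M\<^esub> x \<oplus>\<^bsub>?M\<^esub> b \<odot>\<^bsub>?M\<^esub> x"
      unfolding M p(2) q(2) klr_class_add[OF p(1) q(1), symmetric] one_dim_smult
      by (simp add: distrib_right)
    show "(a \<otimes>\<^bsub>klr_algebra e \<kappa> n\<^esub> b) \<odot>\<^bsub>?M\<^esub> x = a \<odot>\<^bsub>?M\<^esub> (b \<odot>\<^bsub>?M\<^esub> x)"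
      unfolding M p(2) q(2) klr_class_mult[OF p(1) q(1), symmetric] one_dim_smult
      by simp
  next
    fix x
    show "\<one>\<^bsub>klr_algebra e \<kappa> n\<^esub> \<odot>\<^bsub>?M\<^esub> x = x"
      unfolding klr_class_one[symmetric] one_dim_smult by simp
  qed
  ultimately show ?thesis
    unfolding left_module_def by (simp add: klr_algebra_ring)
qed

lemma one_dim_graded_module:
  "klr_graded_module e \<kappa> n (one_dim_module is d :: ('f, 'f) klr_gmodule)"
proof -
  let ?M = "one_dim_module is d :: ('f, 'f) klr_gmodule"
  interpret left_module "klr_algebra e \<kappa> n" ?M
    by (rule one_dim_left_module)
  have M: "carrier ?M = UNIV" "\<zero>\<^bsub>?M\<^esub> = 0" "x \<oplus>\<^bsub>?M\<^esub> y = x + y"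
    "deg_part ?M d' = (if d' = d then UNIV else {0})" for x y d'
    by (simp_all add: one_dim_module_def)
  have "N = UNIV" if N: "submodule N (klr_algebra e \<kappa> n) ?M" "{1} \<subseteq> N" for N
  proof -
    have "c \<in> N" for c
    proof -
      have "klr_scalar e \<kappa> n c \<odot>\<^bsub>?M\<^esub> 1 \<in> N"
        using submodule.smult_closed[OF N(1) klr_scalar_closed] N(2) by auto
      then show ?thesis
        by (simp add: klr_scalar_def one_dim_smult)
    qed
    then show ?thesis by blast
  qed
  then have fg: "fin_gen (klr_algebra e \<kappa> n) ?M"
    unfolding fin_gen_def M by (intro exI[of _ "{1}"] conjI allI impI) simp_all
  have sg: "\<forall>d'. subgroup (deg_part ?M d') (add_monoid ?M)"
  proof (rule allI, rule group.subgroupI[OF M.a_group])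
    show "inv\<^bsub>add_monoid ?M\<^esub> a \<in> deg_part ?M d'" if "a \<in> deg_part ?M d'" for a d'
      using that M.add.inv_one by (auto simp: M split: if_splits)
  qed (auto simp: M split: if_splits)
  have dec: "\<forall>x\<in>carrier ?M. \<exists>!f. homog_decomp ?M x f"
  proof (rule ballI, rule ex1I)
    fix x
    show "homog_decomp ?M x (\<lambda>d'. if d' = d then x else 0)"
      unfolding homog_decomp_def M by (cases "x = 0") (auto simp: M)
    fix f assume f: "homog_decomp ?M x f"
    then have "f d' = 0" if "d' \<noteq> d" for d'
      using that by (auto simp: homog_decomp_def M split: if_splits)
    moreover have "f d = x"
    proof (cases "f d = 0")
      case True
      then have "f d' = 0" for d' using \<open>\<And>d'. d' \<noteq> d \<Longrightarrow> f d' = 0\<close> by (cases "d' = d") auto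
      then have "{d'. f d' \<noteq> 0} = {}" by simp
      then show ?thesis using f True by (simp add: homog_decomp_def M)
    next
      case False
      then have "{d'. f d' \<noteq> 0} = {d}" using \<open>\<And>d'. d' \<noteq> d \<Longrightarrow> f d' = 0\<close> by auto
      then show ?thesis using f by (simp add: homog_decomp_def M)
    qed
    ultimately show "f = (\<lambda>d'. if d' = d then x else 0)" by auto
  qed
  have act: "a \<odot>\<^bsub>?M\<^esub> x \<in> deg_part ?M (d1 + d2)"
    if "a \<in> klr_homog e \<kappa> n d1" "x \<in> deg_part ?M d2" for d1 d2 a x
  proof -
    have "klr_homogp e \<kappa> n d1 a"
      using that(1) by (simp add: klr_homog_def)
    then obtain p where p: "a = klr_class e \<kappa> n p" "d1 \<noteq> 0 \<longrightarrow> one_dim_char is p = 0"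
      by (elim homog_char[THEN bexE] conjE) (rule that)
    show ?thesis
      using that(2) p(2) unfolding p(1) one_dim_smult by (auto simp: M split: if_splits)
  qed
  show ?thesis
    unfolding klr_graded_module_def graded_module_def
    by (intro conjI one_dim_left_module fg sg dec allI impI) (erule conjE, rule act)
qed

end

section \<open>Graded modules over the cyclotomic algebra\<close>

abbreviation scal :: "'f::field \<Rightarrow> 'f free" where "scal c \<equiv> Poly_Mapping.single [] c"

lemma scal_in_words [simp, intro]: "scal c \<in> words_in e n"
  by (rule words_in_single) simp

lemma scal_mult_single: "scal c * Poly_Mapping.single w d = Poly_Mapping.single w (c * d)"
  by (simp add: mult_single plus_list_def)

lemma single_Cons: "Poly_Mapping.single (g # w) c = X g * Poly_Mapping.single w c"
  by (simp add: X_def mult_single plus_list_def)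

lemma scal_commute: "scal c * p = p * scal c"
  by (induction p rule: free_induct_UNIV) (simp_all add: mult_single plus_list_def algebra_simps)

lemma scal_one: "scal 1 = 1"
  by (metis single_one zero_list_def)

lemma scal_add: "scal (c + d) = scal c + scal d"
  by (rule single_add)

text \<open>The unit is not among the generators of the grading. It is reached as the sum of the
  idempotents, by the relator \<open>idem_sum\<close>, and then scaled.\<close>

lemma klr_homogp_scalar: "klr_homogp e \<kappa> n 0 (klr_scalar e \<kappa> n c)"
proof -
  have "klr_homogp e \<kappa> n 0 (klr_class e \<kappa> n (\<Sum>is\<in>A. ee is :: 'a free))" if "finite A" "A \<subseteq> res_seqs e n" for A
    using that
  proof (induction A rule: finite_induct)
    case empty
    show ?case using klr_homogp.intros(5)[of e \<kappa> n 0] by (simp add: klr_zero)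
  next
    case (insert js A)
    have "klr_homogp e \<kappa> n 0 (klr_class e \<kappa> n (ee js) \<oplus>\<^bsub>klr_algebra e \<kappa> n\<^esub>
        klr_class e \<kappa> n (\<Sum>is\<in>A. ee is :: 'a free))"
      using insert by (intro klr_homogp.intros(6) klr_homogp.intros(1)) auto
    then show ?case
      using insert by (subst (asm) klr_class_add[symmetric]) (auto intro!: words_in_sum words_in_X)
  qed
  from this[of "res_seqs e n"]
  have "klr_homogp e \<kappa> n 0 (klr_class e \<kappa> n (\<Sum>is\<in>res_seqs e n. ee is :: 'a free))"
    by (simp add: finite_res_seqs)
  also have "klr_class e \<kappa> n (\<Sum>is\<in>res_seqs e n. ee is :: 'a free) = klr_class e \<kappa> n 1"
    by (rule klr_class_eqI[OF klr_relator_in_ideal[OF klr_relators.idem_sum]])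
  finally have "klr_homogp e \<kappa> n 0
      (klr_scalar e \<kappa> n c \<otimes>\<^bsub>klr_algebra e \<kappa> n\<^esub> klr_class e \<kappa> n (1 :: 'a free))"
    by (rule klr_homogp.intros(7))
  then show ?thesis
    unfolding klr_scalar_def by (subst (asm) klr_class_mult[symmetric]) auto
qed

section \<open>Operators on a module given by representatives\<close>

locale klr_lmod =
  fixes e :: nat and \<kappa> :: "nat \<Rightarrow> int" and n :: nat and M :: "('f::field, 'b) klr_gmodule"
  assumes lm: "left_module (klr_algebra e \<kappa> n) M"
begin

sublocale left_module "klr_algebra e \<kappa> n" M
  by (rule lm)

text \<open>With representatives in place of classes, every relator becomes an equation between
  operators; see \<open>act_relator\<close>.\<close>

definition act :: "'f free \<Rightarrow> 'b \<Rightarrow> 'b" where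
  "act p x = klr_class e \<kappa> n p \<odot>\<^bsub>M\<^esub> x"

lemma act_closed [simp, intro]: "p \<in> words_in e n \<Longrightarrow> x \<in> carrier M \<Longrightarrow> act p x \<in> carrier M"
  unfolding act_def by (intro left_smult_closed klr_class_closed)

lemma act_add: "p \<in> words_in e n \<Longrightarrow> q \<in> words_in e n \<Longrightarrow> x \<in> carrier M \<Longrightarrow>
    act (p + q) x = act p x \<oplus>\<^bsub>M\<^esub> act q x"
  unfolding act_def klr_class_add by (intro left_smult_l_distr klr_class_closed)

lemma act_add_right: "p \<in> words_in e n \<Longrightarrow> x \<in> carrier M \<Longrightarrow> y \<in> carrier M \<Longrightarrow>
    act p (x \<oplus>\<^bsub>M\<^esub> y) = act p x \<oplus>\<^bsub>M\<^esub> act p y"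
  unfolding act_def by (intro left_smult_r_distr klr_class_closed)

lemma act_mult: "p \<in> words_in e n \<Longrightarrow> q \<in> words_in e n \<Longrightarrow> x \<in> carrier M \<Longrightarrow>
    act (p * q) x = act p (act q x)"
  unfolding act_def klr_class_mult by (intro left_smult_assoc klr_class_closed)

lemma act_one [simp]: "x \<in> carrier M \<Longrightarrow> act 1 x = x"
  unfolding act_def klr_class_one by (rule left_smult_one)

lemma act_eqI: "p - q \<in> klr_ideal e \<kappa> n \<Longrightarrow> act p x = act q x"
  unfolding act_def by (simp only: klr_class_eqI)

lemma act_relator: "p - q \<in> klr_relators e \<kappa> n \<Longrightarrow> act p x = act q x"
  by (intro act_eqI klr_relator_in_ideal)

lemma act_zero_right [simp]: "p \<in> words_in e n \<Longrightarrow> act p \<zero>\<^bsub>M\<^esub> = \<zero>\<^bsub>M\<^esub>"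
  using act_add_right[of p "\<zero>\<^bsub>M\<^esub>" "\<zero>\<^bsub>M\<^esub>"] act_closed[of p "\<zero>\<^bsub>M\<^esub>"]
  by (simp add: M.add.r_cancel_one' M.add.l_cancel_one')

lemma act_zero [simp]: "x \<in> carrier M \<Longrightarrow> act 0 x = \<zero>\<^bsub>M\<^esub>"
  using act_add[of 0 0 x] act_closed[of 0 x]
  by (simp add: M.add.r_cancel_one' M.add.l_cancel_one')

lemma act_scal_commute: "p \<in> words_in e n \<Longrightarrow> x \<in> carrier M \<Longrightarrow>
    act p (act (scal c) x) = act (scal c) (act p x)"
  by (simp add: act_mult[symmetric] scal_commute)

lemma act_scal_scal: "x \<in> carrier M \<Longrightarrow> act (scal c) (act (scal d) x) = act (scal (c * d)) x"
  by (simp add: act_mult[symmetric] scal_mult_single)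

lemma act_scal_one [simp]: "x \<in> carrier M \<Longrightarrow> act (scal 1) x = x"
  by (simp add: scal_one)

lemma act_scal_inverse: "c \<noteq> 0 \<Longrightarrow> x \<in> carrier M \<Longrightarrow> act (scal (inverse c)) (act (scal c) x) = x"
  by (simp add: act_scal_scal)

lemma act_uminus: "x \<in> carrier M \<Longrightarrow> act (scal (- 1)) x = \<ominus>\<^bsub>M\<^esub> x"
proof -
  assume x: "x \<in> carrier M"
  have "act (scal (- 1)) x \<oplus>\<^bsub>M\<^esub> x = act (scal (- 1) + scal 1) x"
    using x by (simp add: act_add)
  also have "\<dots> = \<zero>\<^bsub>M\<^esub>"
    using x by (simp add: scal_add[symmetric])
  finally show ?thesis
    using x by (intro M.minus_equality[symmetric]) auto
qed

text \<open>Words are built letter by letter and every representative is a sum of scaled words, so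
  closure under letters and scalars is enough; negatives come from the scalar
  \<open>- 1\<close>.\<close>

lemma submoduleI:
  assumes "N \<subseteq> carrier M" "\<zero>\<^bsub>M\<^esub> \<in> N"
    and add: "\<And>x y. x \<in> N \<Longrightarrow> y \<in> N \<Longrightarrow> x \<oplus>\<^bsub>M\<^esub> y \<in> N"
    and scal: "\<And>c x. x \<in> N \<Longrightarrow> act (scal c) x \<in> N"
    and gen: "\<And>g x. g \<in> gens e n \<Longrightarrow> x \<in> N \<Longrightarrow> act (X g) x \<in> N"
  shows "submodule N (klr_algebra e \<kappa> n) M"
proof -
  have sub: "x \<in> carrier M" if "x \<in> N" for x
    using that assms(1) by auto
  have act_N: "act p x \<in> N" if "p \<in> words_in e n" "x \<in> N" for p x
    using that(1)
  proof (induction p rule: free_induct)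
    case (single w c)
    then show ?case
    proof (induction w)
      case (Cons g w)
      then have "act (X g) (act (Poly_Mapping.single w c) x) \<in> N"
        by (intro gen) auto
      then show ?case
        using Cons sub[OF that(2)] by (simp add: act_mult[symmetric] single_Cons)
    qed (simp add: scal that)
  next
    case (add p q)
    then show ?case using assms(3) that sub by (simp add: act_add)
  qed (use assms that sub in auto)
  show ?thesis
  proof (intro submodule.intro group.subgroupI[OF M.a_group] submodule_axioms.intro)
    show "inv\<^bsub>add_monoid M\<^esub> x \<in> N" if "x \<in> N" for x
      using act_N[OF scal_in_words[of "- 1"] that] sub[OF that]
      by (simp add: act_uminus a_inv_def)
    show "a \<odot>\<^bsub>M\<^esub> x \<in> N" if a: "a \<in> carrier (klr_algebra e \<kappa> n)" and x: "x \<in> N" for a x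
      by (rule klr_algebra_cases[OF a]) (use act_N x in \<open>simp add: act_def\<close>)
  qed (use assms in auto)
qed

lemma submodule_act: "submodule N (klr_algebra e \<kappa> n) M \<Longrightarrow> p \<in> words_in e n \<Longrightarrow> x \<in> N \<Longrightarrow> act p x \<in> N"
  unfolding act_def by (rule submodule.smult_closed[OF _ klr_class_closed])

lemma submodule_zero: "submodule N (klr_algebra e \<kappa> n) M \<Longrightarrow> \<zero>\<^bsub>M\<^esub> \<in> N"
  using subgroup.one_closed[OF submodule.axioms(1)] by fastforce

definition line :: "'b \<Rightarrow> 'b set" where
  "line x = range (\<lambda>c. act (scal c) x)"

lemma line_self: "x \<in> carrier M \<Longrightarrow> x \<in> line x"
  unfolding line_def by (rule range_eqI[of _ _ 1]) simp

lemma line_closed: "x \<in> carrier M \<Longrightarrow> line x \<subseteq> carrier M"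
  unfolding line_def by auto

lemma line_submodule:
  assumes x: "x \<in> carrier M" and gen: "\<And>g. g \<in> gens e n \<Longrightarrow> act (X g) x \<in> line x"
  shows "submodule (line x) (klr_algebra e \<kappa> n) M"
proof (rule submoduleI)
  show "\<zero>\<^bsub>M\<^esub> \<in> line x"
    unfolding line_def by (rule range_eqI[of _ _ 0]) (simp add: x)
  show "y \<oplus>\<^bsub>M\<^esub> z \<in> line x" if "y \<in> line x" "z \<in> line x" for y z
  proof -
    obtain c d where "y = act (scal c) x" "z = act (scal d) x"
      using \<open>y \<in> line x\<close> \<open>z \<in> line x\<close> unfolding line_def by (elim rangeE)
    then show ?thesis
      unfolding line_def by (intro range_eqI[of _ _ "c + d"]) (simp add: x scal_add act_add)
  qed
  show scal: "act (scal c) y \<in> line x" if "y \<in> line x" for c y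
  proof -
    obtain d where "y = act (scal d) x"
      using \<open>y \<in> line x\<close> unfolding line_def by (elim rangeE)
    then show ?thesis
      unfolding line_def by (intro range_eqI[of _ _ "c * d"]) (simp add: x act_scal_scal)
  qed
  show "act (X g) y \<in> line x" if g: "g \<in> gens e n" and y: "y \<in> line x" for g y
  proof -
    obtain d where "y = act (scal d) x"
      using y unfolding line_def by (elim rangeE)
    then show ?thesis
      using scal[OF gen[OF g], of d] g x by (simp add: act_scal_commute words_in_X)
  qed
qed (use line_closed[OF x] in auto)

text \<open>A nonzero element of the line is a nonzero multiple of \<open>x\<close>, and the inverse
  scalar recovers \<open>x\<close>.\<close>

lemma line_irreducible:
  assumes x: "x \<in> carrier M" "x \<noteq> \<zero>\<^bsub>M\<^esub>"
  shows "irreducible_gmodule (klr_algebra e \<kappa> n) (sub_gmodule M (line x))"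
  unfolding irreducible_gmodule_def
proof (intro conjI allI impI)
  show "carrier (sub_gmodule M (line x)) \<noteq> {\<zero>\<^bsub>sub_gmodule M (line x)\<^esub>}"
    using line_self[OF x(1)] x(2) by (auto simp: sub_gmodule_def)
  fix N assume "graded_submodule (klr_algebra e \<kappa> n) (sub_gmodule M (line x)) N"
  then have N: "submodule N (klr_algebra e \<kappa> n) (sub_gmodule M (line x))"
    by (simp add: graded_submodule_def)
  have N_line: "N \<subseteq> line x" and N_zero: "\<zero>\<^bsub>M\<^esub> \<in> N"
    using subgroup.subset[OF submodule.axioms(1)[OF N]] subgroup.one_closed[OF submodule.axioms(1)[OF N]]
    by (auto simp: sub_gmodule_def)
  have N_act: "act (scal c) y \<in> N" if "y \<in> N" for c y
    using submodule.smult_closed[OF N klr_class_closed[OF scal_in_words] that]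
    by (simp add: sub_gmodule_def act_def)
  show "N = {\<zero>\<^bsub>sub_gmodule M (line x)\<^esub>} \<or> N = carrier (sub_gmodule M (line x))"
  proof (cases "N \<subseteq> {\<zero>\<^bsub>M\<^esub>}")
    case True
    then show ?thesis using N_zero by (auto simp: sub_gmodule_def)
  next
    case False
    then obtain y where y: "y \<in> N" "y \<noteq> \<zero>\<^bsub>M\<^esub>" by auto
    then obtain c where c: "y = act (scal c) x"
      using N_line unfolding line_def by blast
    then have "c \<noteq> 0" using y(2) x by auto
    then have "x \<in> N"
      using N_act[OF y(1), of "inverse c"] x unfolding c by (simp add: act_scal_inverse)
    then have "line x \<subseteq> N"
      unfolding line_def using N_act by auto
    then show ?thesis using N_line by (simp add: sub_gmodule_def)
  qed
qed

end

text \<open>This is the part of the graded structure that is verified for restrictions as well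
  (\<open>Res_gmod\<close>). The existence and uniqueness of homogeneous decompositions are added in
  \<open>klr_graded\<close>.\<close>

locale klr_gmod = klr_lmod e \<kappa> n M
  for e :: nat and \<kappa> :: "nat \<Rightarrow> int" and n :: nat and M :: "('f::field, 'b) klr_gmodule" +
  assumes deg_subgroup: "\<And>d. subgroup (deg_part M d) (add_monoid M)"
    and deg_scal: "\<And>c d x. x \<in> deg_part M d \<Longrightarrow> klr_class e \<kappa> n (scal c) \<odot>\<^bsub>M\<^esub> x \<in> deg_part M d"
begin

lemma deg_closed: "x \<in> deg_part M d \<Longrightarrow> x \<in> carrier M"
  using subgroup.subset[OF deg_subgroup] by auto

lemma deg_zero [simp]: "\<zero>\<^bsub>M\<^esub> \<in> deg_part M d"
  using subgroup.one_closed[OF deg_subgroup] by simp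

lemma deg_add: "x \<in> deg_part M d \<Longrightarrow> y \<in> deg_part M d \<Longrightarrow> x \<oplus>\<^bsub>M\<^esub> y \<in> deg_part M d"
  using subgroup.m_closed[OF deg_subgroup] by simp

lemma homog_decomp_single:
  assumes x: "x \<in> deg_part M d"
  shows "homog_decomp M x (\<lambda>d'. if d' = d then x else \<zero>\<^bsub>M\<^esub>)"
proof (cases "x = \<zero>\<^bsub>M\<^esub>")
  case True
  then show ?thesis by (simp add: homog_decomp_def)
next
  case False
  then have "{d'. (if d' = d then x else \<zero>\<^bsub>M\<^esub>) \<noteq> \<zero>\<^bsub>M\<^esub>} = {d}" by auto
  then show ?thesis using x deg_closed[OF x] by (simp add: homog_decomp_def)
qed

text \<open>The support of the sum can be smaller than the union of the supports, so all three sums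
  are first extended by zeros to that union.\<close>

lemma homog_decomp_add:
  assumes f: "homog_decomp M x f" and g: "homog_decomp M y g"
  shows "homog_decomp M (x \<oplus>\<^bsub>M\<^esub> y) (\<lambda>d. f d \<oplus>\<^bsub>M\<^esub> g d)"
proof -
  have fd: "f d \<in> deg_part M d" and gd: "g d \<in> deg_part M d" for d
    using f g by (auto simp: homog_decomp_def)
  have fc [simp]: "f \<in> A \<rightarrow> carrier M" and gc [simp]: "g \<in> A \<rightarrow> carrier M" for A
    using fd gd deg_closed by blast+
  have fgc [simp]: "(\<lambda>d. f d \<oplus>\<^bsub>M\<^esub> g d) \<in> A \<rightarrow> carrier M" for A
    using deg_closed[OF fd] deg_closed[OF gd] by auto
  let ?F = "{d. f d \<noteq> \<zero>\<^bsub>M\<^esub>}" and ?G = "{d. g d \<noteq> \<zero>\<^bsub>M\<^esub>}"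
  have fin: "finite ?F" "finite ?G"
    using f g by (auto simp: homog_decomp_def)
  have sub: "{d. f d \<oplus>\<^bsub>M\<^esub> g d \<noteq> \<zero>\<^bsub>M\<^esub>} \<subseteq> ?F \<union> ?G"
    by auto
  have "finsum M f ?F = finsum M f (?F \<union> ?G)"
    by (rule M.add.finprod_mono_neutral_cong_left) (use fin in auto)
  moreover have "finsum M g ?G = finsum M g (?F \<union> ?G)"
    by (rule M.add.finprod_mono_neutral_cong_left) (use fin in auto)
  moreover have "finsum M (\<lambda>d. f d \<oplus>\<^bsub>M\<^esub> g d) {d. f d \<oplus>\<^bsub>M\<^esub> g d \<noteq> \<zero>\<^bsub>M\<^esub>}
      = finsum M (\<lambda>d. f d \<oplus>\<^bsub>M\<^esub> g d) (?F \<union> ?G)"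
    by (rule M.add.finprod_mono_neutral_cong_left) (use fin sub in auto)
  ultimately show ?thesis
    using f g fin finite_subset[OF sub] fd gd
    by (simp add: homog_decomp_def deg_add M.finsum_addf)
qed

text \<open>The premise \<open>span\<close> is an induction principle: \<open>N\<close> is spanned by its homogeneous elements.\<close>

lemma graded_submoduleI:
  assumes N: "submodule N (klr_algebra e \<kappa> n) M"
    and span: "\<And>P. P \<zero>\<^bsub>M\<^esub> \<Longrightarrow> (\<And>x y. x \<in> N \<Longrightarrow> y \<in> N \<Longrightarrow> P x \<Longrightarrow> P y \<Longrightarrow> P (x \<oplus>\<^bsub>M\<^esub> y)) \<Longrightarrow>
      (\<And>x d. x \<in> N \<Longrightarrow> x \<in> deg_part M d \<Longrightarrow> P x) \<Longrightarrow> \<forall>x\<in>N. P x"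
  shows "graded_submodule (klr_algebra e \<kappa> n) M N"
  unfolding graded_submodule_def
proof (rule conjI[OF N], rule span)
  have zero: "\<zero>\<^bsub>M\<^esub> \<in> N" by (rule submodule_zero[OF N])
  show single: "\<exists>f. homog_decomp M x f \<and> (\<forall>d. f d \<in> N)" if "x \<in> N" "x \<in> deg_part M d" for x d
    by (intro exI conjI allI, rule homog_decomp_single[OF that(2)]) (use that(1) zero in auto)
  show "\<exists>f. homog_decomp M \<zero>\<^bsub>M\<^esub> f \<and> (\<forall>d. f d \<in> N)"
    by (rule single[OF zero deg_zero])
  fix x y assume "\<exists>f. homog_decomp M x f \<and> (\<forall>d. f d \<in> N)" "\<exists>f. homog_decomp M y f \<and> (\<forall>d. f d \<in> N)"
  then obtain f g where fg: "homog_decomp M x f" "\<forall>d. f d \<in> N" "homog_decomp M y g" "\<forall>d. g d \<in> N"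
    by (elim exE conjE)
  show "\<exists>f. homog_decomp M (x \<oplus>\<^bsub>M\<^esub> y) f \<and> (\<forall>d. f d \<in> N)"
    using subgroup.m_closed[OF submodule.axioms(1)[OF N]] fg(2,4)
    by (intro exI[of _ "\<lambda>d. f d \<oplus>\<^bsub>M\<^esub> g d"] conjI homog_decomp_add[OF fg(1,3)]) auto
qed

lemma line_deg: "x \<in> deg_part M d \<Longrightarrow> line x \<subseteq> deg_part M d"
  unfolding line_def act_def using deg_scal by auto

lemma line_graded_submodule:
  assumes x: "x \<in> deg_part M d" and gen: "\<And>g. g \<in> gens e n \<Longrightarrow> act (X g) x \<in> line x"
  shows "graded_submodule (klr_algebra e \<kappa> n) M (line x)"
  by (rule graded_submoduleI[OF line_submodule[OF deg_closed[OF x] gen]])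
     (use line_deg[OF x] in auto)

end

lemma klr_graded_module_gmod:
  assumes "klr_graded_module e \<kappa> n M"
  shows "klr_gmod e \<kappa> n M"
proof (intro klr_gmod.intro klr_lmod.intro klr_gmod_axioms.intro)
  have gm: "left_module (klr_algebra e \<kappa> n) M" "\<And>d. subgroup (deg_part M d) (add_monoid M)"
    "\<And>d d' a x. a \<in> klr_homog e \<kappa> n d \<Longrightarrow> x \<in> deg_part M d' \<Longrightarrow> a \<odot>\<^bsub>M\<^esub> x \<in> deg_part M (d + d')"
    using assms unfolding klr_graded_module_def graded_module_def by simp_all
  show "left_module (klr_algebra e \<kappa> n) M" by (rule gm)
  show "subgroup (deg_part M d) (add_monoid M)" for d by (rule gm)
  show "klr_class e \<kappa> n (scal c) \<odot>\<^bsub>M\<^esub> x \<in> deg_part M d" if "x \<in> deg_part M d" for c d x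
    using gm(3)[of "klr_scalar e \<kappa> n c" 0 x d] that klr_homogp_scalar[of e \<kappa> n c]
    by (simp add: klr_homog_def klr_scalar_def)
qed

section \<open>Restriction and its socle\<close>

lemma push_words_superset:
  assumes "finite A" "Poly_Mapping.keys p \<subseteq> A"
  shows "push_words \<phi> p = (\<Sum>w \<in> A. Poly_Mapping.single (\<phi> w) (Poly_Mapping.lookup p w))"
  unfolding push_words_def
  by (rule sum.mono_neutral_left) (use assms in \<open>auto simp: in_keys_iff\<close>)

lemma push_words_zero [simp]: "push_words \<phi> 0 = 0"
  by (simp add: push_words_def)

lemma push_words_single [simp]:
  "push_words \<phi> (Poly_Mapping.single w c) = Poly_Mapping.single (\<phi> w) c"
  by (simp add: push_words_def)

lemma push_words_add [simp]: "push_words \<phi> (p + q) = push_words \<phi> p + push_words \<phi> q"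
  using Poly_Mapping.keys_add[of p q]
  by (subst (1 2 3) push_words_superset[of "Poly_Mapping.keys p \<union> Poly_Mapping.keys q"])
     (auto simp: lookup_add single_add sum.distrib[symmetric] intro!: sum.cong)

lemma push_words_uminus [simp]: "push_words \<phi> (- p) = - push_words \<phi> p"
  using push_words_add[of \<phi> p "- p"] by (simp add: eq_neg_iff_add_eq_0 add.commute)

lemma push_words_diff [simp]: "push_words \<phi> (p - q) = push_words \<phi> p - push_words \<phi> q"
  using push_words_add[of \<phi> p "- q"] by simp

lemma push_words_sum: "push_words \<phi> (sum f A) = (\<Sum>i\<in>A. push_words \<phi> (f i))"
  by (induction A rule: infinite_finite_induct) auto

lemma push_words_map_mult [simp]:
  "push_words (map f) (p * q) = push_words (map f) p * push_words (map f) q"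
proof (induction p rule: free_induct_UNIV)
  case (single w c)
  show ?case
  proof (induction q rule: free_induct_UNIV)
    case (single w' c')
    show ?case by (simp add: mult_single plus_list_def)
  qed (simp_all add: algebra_simps)
qed (simp_all add: algebra_simps)

lemma push_words_map_one [simp]: "push_words (map f) 1 = 1"
  using push_words_single[of "map f" "[]" 1] by (simp add: scal_one)

lemma push_words_map_X [simp]: "push_words (map f) (X g) = X (f g)"
  by (simp add: X_def)

lemma push_words_map_power: "push_words (map f) (p ^ k) = push_words (map f) p ^ k"
  by (induction k) auto

lemma one_dim_char_push_rev: "one_dim_char is (push_words rev p) = one_dim_char is p"
  by (induction p rule: free_induct_UNIV) auto

lemma klr_ideal_sum: "(\<And>i. i \<in> A \<Longrightarrow> f i \<in> klr_ideal e \<kappa> n) \<Longrightarrow> sum f A \<in> klr_ideal e \<kappa> n"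
  by (induction A rule: infinite_finite_induct) (auto intro: klr_ideal_add)

lemma append_in_res_seqs [simp]:
  "js @ [i] \<in> res_seqs e (Suc n) \<longleftrightarrow> js \<in> res_seqs e n \<and> i \<in> {0..<int e}"
  by (auto simp: res_seqs_def)

lemma swap_res_append: "1 \<le> r \<Longrightarrow> r < length js \<Longrightarrow> swap_res r (js @ [i]) = swap_res r js @ [i]"
  by (simp add: swap_res_def nth_append list_update_append less_imp_diff_less)

lemma swap_res_swap_res: "1 \<le> r \<Longrightarrow> r < length js \<Longrightarrow> swap_res r (swap_res r js) = js"
  by (rule nth_equalityI) (auto simp: swap_res_def nth_list_update)

lemma bij_swap_res: "1 \<le> r \<Longrightarrow> r < n \<Longrightarrow> bij_betw (swap_res r) (res_seqs e n) (res_seqs e n)"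
  using swap_res_in_res_seqs[of r n _ e] swap_res_swap_res[of r]
  by (intro bij_betw_byWitness[of _ "swap_res r"] ballI image_subsetI) (auto simp: res_seqs_def[of e n])

section \<open>The non-unital homomorphism that appends the residue \<open>i\<close>\<close>

locale residue =
  fixes e :: nat and \<kappa> :: "nat \<Rightarrow> int" and n :: nat and i :: int and F :: "'f::field itself"
  assumes i: "i \<in> {0..<int e}"
begin

abbreviation I :: "'f free set" where "I \<equiv> klr_ideal e \<kappa> (Suc n)"
abbreviation push :: "'f free \<Rightarrow> 'f free" where "push \<equiv> push_words (map (append_res i))"
abbreviation tail :: "'f free" where "tail \<equiv> tail_idem e n i"

lemma append_res_gens: "g \<in> gens e n \<Longrightarrow> append_res i g \<in> gens e (Suc n)"
  using i by (cases g) auto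

lemma push_in_words [simp, intro]: "p \<in> words_in e n \<Longrightarrow> push p \<in> words_in e (Suc n)"
proof (induction p rule: free_induct)
  case (single w c)
  then show ?case
    unfolding push_words_single by (intro words_in_single) (use append_res_gens in auto)
qed auto

lemma tail_in_words [simp, intro]: "tail \<in> words_in e (Suc n)"
  unfolding tail_idem_def using i by (auto intro!: words_in_sum words_in_X)

lemma idem_relator:
  "js \<in> res_seqs e (Suc n) \<Longrightarrow> ks \<in> res_seqs e (Suc n) \<Longrightarrow> ee js * ee ks - (if js = ks then ee js else 0) \<in> I"
  by (intro klr_relator_in_ideal klr_relators.idem)

text \<open>\<open>tail\<close> is a sum of orthogonal idempotents, and only the summand with the
  same sequence survives the multiplication.\<close>

lemma ee_tail:
  assumes "js \<in> res_seqs e n"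
  shows "ee (js @ [i]) * tail - ee (js @ [i]) \<in> I" "tail * ee (js @ [i]) - ee (js @ [i]) \<in> I"
proof -
  have "ee (js @ [i]) * tail - ee (js @ [i]) =
      (\<Sum>ks\<in>res_seqs e n. ee (js @ [i]) * ee (ks @ [i]) - (if js @ [i] = ks @ [i] then ee (js @ [i]) else 0))"
    using assms by (simp add: tail_idem_def sum_distrib_left sum_subtractf finite_res_seqs)
  also have "\<dots> \<in> I"
    using assms i by (intro klr_ideal_sum idem_relator) auto
  finally show "ee (js @ [i]) * tail - ee (js @ [i]) \<in> I" .
  have "tail * ee (js @ [i]) - ee (js @ [i]) =
      (\<Sum>ks\<in>res_seqs e n. ee (ks @ [i]) * ee (js @ [i]) - (if ks @ [i] = js @ [i] then ee (ks @ [i]) else 0))"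
    using assms by (simp add: tail_idem_def sum_distrib_right sum_subtractf finite_res_seqs)
  also have "\<dots> \<in> I"
    using assms i by (intro klr_ideal_sum idem_relator) auto
  finally show "tail * ee (js @ [i]) - ee (js @ [i]) \<in> I" .
qed

lemma tail_tail: "tail * tail - tail \<in> I"
proof -
  have "tail * tail - tail = (\<Sum>js\<in>res_seqs e n. ee (js @ [i]) * tail - ee (js @ [i]))"
    by (simp add: tail_idem_def sum_distrib_right sum_subtractf)
  also have "\<dots> \<in> I"
    by (intro klr_ideal_sum ee_tail)
  finally show ?thesis .
qed

text \<open>For \<open>r < n\<close>, \<open>\<psi>\<^sub>r\<close> permutes the first
  \<open>n\<close> entries and leaves the final \<open>i\<close> in place; passing it through
  \<open>tail\<close> merely reindexes the sum by the bijection \<open>swap_res r\<close>.\<close>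

lemma gen_tail:
  assumes "g \<in> gens e n"
  shows "X (append_res i g) * tail - tail * X (append_res i g) \<in> I"
proof (cases g)
  case (E js)
  then have "js \<in> res_seqs e n" using assms by simp
  from klr_ideal_diff[OF ee_tail[OF this]] show ?thesis
    by (simp add: E)
next
  case (Y r)
  have "yy r * tail - tail * yy r = (\<Sum>js\<in>res_seqs e n. yy r * ee (js @ [i]) - ee (js @ [i]) * yy r)"
    by (simp add: tail_idem_def sum_distrib_left sum_distrib_right sum_subtractf)
  also have "\<dots> \<in> I"
    using Y assms i by (intro klr_ideal_sum klr_relator_in_ideal klr_relators.y_idem) auto
  finally show ?thesis by (simp add: Y)
next
  case (Psi r)
  then have r: "1 \<le> r" "r < n" using assms by auto
  have "tail * psi r = (\<Sum>js\<in>res_seqs e n. ee (js @ [i]) * psi r)"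
    by (simp add: tail_idem_def sum_distrib_right)
  also have "\<dots> = (\<Sum>js\<in>res_seqs e n. ee (swap_res r js @ [i]) * psi r)"
    by (rule sum.reindex_bij_betw[OF bij_swap_res[OF r], symmetric])
  also have "\<dots> = (\<Sum>js\<in>res_seqs e n. ee (swap_res r (js @ [i])) * psi r)"
    using r by (intro sum.cong) (auto simp: swap_res_append res_seqs_def)
  finally have "psi r * tail - tail * psi r =
      (\<Sum>js\<in>res_seqs e n. psi r * ee (js @ [i]) - ee (swap_res r (js @ [i])) * psi r)"
    by (simp add: tail_idem_def sum_distrib_left sum_subtractf)
  also have "\<dots> \<in> I"
    using r i by (intro klr_ideal_sum klr_relator_in_ideal klr_relators.psi_idem) auto
  finally show ?thesis by (simp add: Psi)
qed

text \<open>Commuting with \<open>tail\<close> modulo the ideal passes from letters to words by the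
  Leibniz rule for commutators.\<close>

lemma push_tail: "p \<in> words_in e n \<Longrightarrow> push p * tail - tail * push p \<in> I"
proof (induction p rule: free_induct)
  case (single w c)
  then show ?case
  proof (induction w)
    case Nil
    show ?case by (simp add: scal_commute)
  next
    case (Cons g w)
    let ?g = "X (append_res i g) :: 'f free" and ?w = "push (Poly_Mapping.single w c)"
    have w: "?w * tail - tail * ?w \<in> I" using Cons by simp
    have "push (Poly_Mapping.single (g # w) c) = ?g * ?w"
      unfolding single_Cons push_words_map_mult push_words_map_X ..
    moreover have "?g * ?w * tail - tail * (?g * ?w) = ?g * (?w * tail - tail * ?w) + (?g * tail - tail * ?g) * ?w"
      by (simp add: algebra_simps)
    moreover have "\<dots> \<in> I"
      by (intro klr_ideal_add klr_ideal_mult_left klr_ideal_mult_right w gen_tail push_in_words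
          words_in_X append_res_gens words_in_single) (use Cons in auto)
    ultimately show ?case by simp
  qed
next
  case (add p q)
  have "push (p + q) * tail - tail * push (p + q) =
      (push p * tail - tail * push p) + (push q * tail - tail * push q)"
    by (simp add: algebra_simps)
  then show ?case using klr_ideal_add[OF add(3,4)] by simp
qed simp

text \<open>Apart from one, the relators mention only the first \<open>n\<close> positions, and
  appending \<open>i\<close> turns them into relators of the larger algebra. The exception is the
  sum of the idempotents minus 1: its image is \<open>tail - 1\<close>, which is not a
  relator.\<close>

lemma push_relator:
  assumes "p \<in> klr_relators e \<kappa> n"
  shows "push p \<in> klr_relators e \<kappa> (Suc n) \<or> p = (\<Sum>is \<in> res_seqs e n. ee is) - 1"
  using assms
proof cases
  case (idem js ks)
  then show ?thesis
    using klr_relators.idem[of "js @ [i]" e "Suc n" "ks @ [i]" \<kappa>] i by (auto split: if_splits)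
next
  case (y_idem r js)
  then show ?thesis
    using klr_relators.y_idem[of r "Suc n" "js @ [i]" e \<kappa>] i by auto
next
  case (psi_idem r js)
  then show ?thesis
    using klr_relators.psi_idem[of r "Suc n" "js @ [i]" e \<kappa>] i
    by (auto simp: swap_res_append res_seqs_def)
next
  case (y_y r s)
  then show ?thesis using klr_relators.y_y[of r "Suc n" s e \<kappa>] by auto
next
  case (psi_y r s)
  then show ?thesis using klr_relators.psi_y[of r "Suc n" s e \<kappa>] by auto
next
  case (psi_psi r s)
  then show ?thesis using klr_relators.psi_psi[of r "Suc n" s e \<kappa>] by auto
next
  case (psi_y_next r js)
  then show ?thesis
    using klr_relators.psi_y_next[of r "Suc n" "js @ [i]" e \<kappa>] i
    by (auto simp: res_seqs_def delta_def nth_append less_imp_diff_less)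
next
  case (y_next_psi r js)
  then show ?thesis
    using klr_relators.y_next_psi[of r "Suc n" "js @ [i]" e \<kappa>] i
    by (auto simp: res_seqs_def delta_def nth_append less_imp_diff_less)
next
  case (psi_sq r js)
  have "push (psi_square e r js) = psi_square e r (js @ [i])"
    using psi_sq by (auto simp: psi_square_def res_seqs_def nth_append less_imp_diff_less)
  then show ?thesis
    using psi_sq klr_relators.psi_sq[of r "Suc n" "js @ [i]" e \<kappa>] i by auto
next
  case (braid r js)
  have "push (braid_error e r js) = braid_error e r (js @ [i])"
    using braid by (auto simp: braid_error_def res_seqs_def nth_append less_imp_diff_less)
  then show ?thesis
    using braid klr_relators.braid[of r "Suc n" "js @ [i]" e \<kappa>] i by auto
next
  case (cyclotomic js)
  then have "ent (js @ [i]) 1 = ent js 1"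
    by (auto simp: res_seqs_def nth_append less_imp_diff_less)
  then show ?thesis
    using cyclotomic klr_relators.cyclotomic[of "Suc n" "js @ [i]" e \<kappa>] i
    by (auto simp: push_words_map_power)
qed simp

text \<open>The factor \<open>tail\<close> repairs the exceptional relator, since
  \<open>(tail - 1) * tail\<close> lies in the ideal. For right multiples, \<open>tail\<close> is
  first moved past the factor by \<open>push_tail\<close>.\<close>

lemma push_ideal: "p \<in> klr_ideal e \<kappa> n \<Longrightarrow> push p * tail \<in> I"
proof (induction rule: klr_ideal_induct)
  case (relator p)
  from push_relator[OF relator] show ?case
  proof
    assume p: "p = (\<Sum>is \<in> res_seqs e n. ee is) - 1"
    have "push p = tail - 1"
      unfolding p by (simp add: push_words_sum tail_idem_def)
    then have "push p * tail = tail * tail - tail"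
      by (simp only: left_diff_distrib mult_1_left)
    then show ?thesis using tail_tail by simp
  qed (intro klr_ideal_mult_right klr_relator_in_ideal tail_in_words)
next
  case (add p q)
  then show ?case by (simp add: distrib_right klr_ideal_add)
next
  case (uminus p)
  then show ?case using klr_ideal_uminus by fastforce
next
  case (mult_right p q)
  have "push (p * q) * tail = push p * (push q * tail - tail * push q) + push p * tail * push q"
    by (simp add: algebra_simps)
  also have "\<dots> \<in> I"
    using mult_right by (intro klr_ideal_add klr_ideal_mult_left[OF push_tail]
        klr_ideal_mult_right[OF mult_right(3)] push_in_words)
  finally show ?case .
next
  case (mult_left p q)
  then show ?case by (simp add: mult.assoc klr_ideal_mult_left)
qed simp

text \<open>By \<open>push_ideal\<close> all representatives yield the same class, so the union in
  \<open>res_hom\<close> is one over a constant family.\<close>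

lemma res_hom_class:
  "res_hom e \<kappa> n i (klr_class e \<kappa> n p) = klr_class e \<kappa> (Suc n) (push p * tail)"
proof -
  have "klr_class e \<kappa> (Suc n) (push q * tail) = klr_class e \<kappa> (Suc n) (push p * tail)"
    if "q \<in> klr_class e \<kappa> n p" for q
  proof (rule klr_class_eqI)
    have "push (q - p) * tail \<in> I"
      using that by (intro push_ideal) (simp add: klr_class_iff)
    then show "push q * tail - push p * tail \<in> I"
      by (simp add: left_diff_distrib)
  qed
  then have "res_hom e \<kappa> n i (klr_class e \<kappa> n p) =
      (\<Union>q \<in> klr_class e \<kappa> n p. klr_class e \<kappa> (Suc n) (push p * tail))"
    unfolding res_hom_def by simp
  also have "\<dots> = klr_class e \<kappa> (Suc n) (push p * tail)"
    using klr_class_self[of p e \<kappa> n] by (intro UN_constant_eq[of p]) auto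
  finally show ?thesis .
qed

end

context klr_lmod
begin

lemma act_finsum:
  assumes "finite A" "f \<in> A \<rightarrow> carrier M" "p \<in> words_in e n"
  shows "act p (finsum M f A) = finsum M (\<lambda>d. act p (f d)) A"
  using assms
proof (induction A rule: finite_induct)
  case (insert d A)
  have "(\<lambda>d. act p (f d)) \<in> A \<rightarrow> carrier M"
    using insert by auto
  then show ?case
    using insert by (simp add: act_add_right)
qed simp

end

context residue
begin

lemma char_push: "one_dim_char (js @ [i]) (push p) = one_dim_char js p"
proof (induction p rule: free_induct_UNIV)
  case (single w c)
  have "append_res i g = E (js @ [i]) \<longleftrightarrow> g = E js" for g
    by (cases g) auto
  then have "set (map (append_res i) w) \<subseteq> {E (js @ [i])} \<longleftrightarrow> set w \<subseteq> {E js}"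
    by auto
  then show ?case by simp
qed simp_all

lemma char_tail:
  assumes "js \<in> res_seqs e n"
  shows "one_dim_char (js @ [j]) tail = (if i = j then 1 else 0)"
proof -
  have "one_dim_char (js @ [j]) tail = (\<Sum>ks\<in>res_seqs e n. if ks = js \<and> i = j then 1 else 0 :: 'f)"
    by (simp add: tail_idem_def one_dim_char_sum)
  also have "\<dots> = (if i = j then 1 else 0)"
    using assms by (simp add: finite_res_seqs)
  finally show ?thesis .
qed

lemma klr_homogp_tail: "klr_homogp e \<kappa> (Suc n) 0 (klr_class e \<kappa> (Suc n) tail)"
proof -
  have "klr_homogp e \<kappa> (Suc n) 0 (klr_class e \<kappa> (Suc n) (\<Sum>js\<in>A. ee (js @ [i]) :: 'f free))"
    if "finite A" "A \<subseteq> res_seqs e n" for A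
    using that
  proof (induction A rule: finite_induct)
    case empty
    show ?case using klr_homogp.intros(5)[of e \<kappa> "Suc n" 0] by (simp add: klr_zero)
  next
    case (insert js A)
    have "klr_homogp e \<kappa> (Suc n) 0 (klr_class e \<kappa> (Suc n) (ee (js @ [i])) \<oplus>\<^bsub>klr_algebra e \<kappa> (Suc n)\<^esub>
        klr_class e \<kappa> (Suc n) (\<Sum>js\<in>A. ee (js @ [i]) :: 'f free))"
      by (intro klr_homogp.intros(6) klr_homogp.intros(1)) (use insert i in auto)
    then show ?case
      using insert i by (subst (asm) klr_class_add[symmetric]) (auto intro!: words_in_sum words_in_X)
  qed
  from this[of "res_seqs e n"] show ?thesis
    by (simp add: finite_res_seqs tail_idem_def)
qed

end

section \<open>Unique homogeneous components\<close>

locale klr_graded = klr_gmod e \<kappa> n M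
  for e :: nat and \<kappa> :: "nat \<Rightarrow> int" and n :: nat and M :: "('f::field, 'b) klr_gmodule" +
  assumes graded: "klr_graded_module e \<kappa> n M"
begin

lemma act_homog:
  assumes p: "klr_homogp e \<kappa> n d (klr_class e \<kappa> n p)" and x: "x \<in> deg_part M d'"
  shows "act p x \<in> deg_part M (d + d')"
proof -
  have "\<forall>d d' a x. a \<in> klr_homog e \<kappa> n d \<and> x \<in> deg_part M d' \<longrightarrow> a \<odot>\<^bsub>M\<^esub> x \<in> deg_part M (d + d')"
    using graded unfolding klr_graded_module_def graded_module_def by simp
  then show ?thesis
    using p x unfolding act_def by (simp add: klr_homog_def)
qed

lemma homog_decomp_ex1: "x \<in> carrier M \<Longrightarrow> \<exists>!f. homog_decomp M x f"
  using graded unfolding klr_graded_module_def graded_module_def by simp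

lemma homog_decomp_unique:
  assumes "homog_decomp M x f" "homog_decomp M x g" "x \<in> carrier M"
  shows "f = g"
proof -
  obtain h where "\<forall>k. homog_decomp M x k \<longrightarrow> k = h"
    by (rule ex1E[OF homog_decomp_ex1[OF assms(3)]])
  then show ?thesis using assms by metis
qed

text \<open>Otherwise the element would have two decompositions, one concentrated in
  \<open>d\<close> and one in \<open>d'\<close>.\<close>

lemma deg_disjoint:
  assumes "x \<in> deg_part M d" "x \<in> deg_part M d'" "d \<noteq> d'"
  shows "x = \<zero>\<^bsub>M\<^esub>"
proof -
  have "(\<lambda>k. if k = d then x else \<zero>\<^bsub>M\<^esub>) = (\<lambda>k. if k = d' then x else \<zero>\<^bsub>M\<^esub>)"
    by (rule homog_decomp_unique[OF homog_decomp_single homog_decomp_single]) (use assms deg_closed in auto)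
  from fun_cong[OF this, of d] show ?thesis
    using assms(3) by simp
qed

text \<open>An operator of degree 0 acts on each component separately. It is applied to the
  projection \<open>tail\<close>.\<close>

lemma homog_decomp_act:
  assumes f: "homog_decomp M x f" and p: "p \<in> words_in e n" "klr_homogp e \<kappa> n 0 (klr_class e \<kappa> n p)"
  shows "homog_decomp M (act p x) (\<lambda>d. act p (f d))"
proof -
  have fd: "f d \<in> deg_part M d" for d
    using f by (auto simp: homog_decomp_def)
  have fc: "f \<in> A \<rightarrow> carrier M" for A
    using fd deg_closed by blast
  let ?F = "{d. f d \<noteq> \<zero>\<^bsub>M\<^esub>}" and ?G = "{d. act p (f d) \<noteq> \<zero>\<^bsub>M\<^esub>}"
  have fin: "finite ?F" and x: "x = finsum M f ?F"
    using f by (auto simp: homog_decomp_def)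
  have sub: "?G \<subseteq> ?F"
    using p by auto
  have "finsum M (\<lambda>d. act p (f d)) ?G = finsum M (\<lambda>d. act p (f d)) ?F"
    by (rule M.add.finprod_mono_neutral_cong_left) (use fin sub p deg_closed[OF fd] in auto)
  moreover have "act p x = finsum M (\<lambda>d. act p (f d)) ?F"
    unfolding x by (rule act_finsum[OF fin fc p(1)])
  moreover have "act p (f d) \<in> deg_part M d" for d
    using act_homog[OF p(2) fd[of d]] by simp
  ultimately show ?thesis
    using finite_subset[OF sub fin] by (simp add: homog_decomp_def)
qed

end

lemma klr_gradedI: "klr_graded_module e \<kappa> n M \<Longrightarrow> klr_graded e \<kappa> n M"
  by (simp add: klr_graded_def klr_graded_axioms_def klr_graded_module_gmod)

section \<open>The restricted module and its socle\<close>

locale klr_restriction = residue e \<kappa> n i "TYPE('f)" + klr_graded e \<kappa> "Suc n" M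
  for e :: nat and \<kappa> :: "nat \<Rightarrow> int" and n :: nat and i :: int and M :: "('f::field, 'b) klr_gmodule"
begin

definition V :: "'b set" where "V = act tail ` carrier M"

abbreviation Res :: "('f, 'b) klr_gmodule" where "Res \<equiv> i_restriction e \<kappa> n i M"

text \<open>The action of \<open>tail\<close> is idempotent, so its image is the space of vectors
  that it fixes.\<close>

lemma V_iff: "x \<in> V \<longleftrightarrow> x \<in> carrier M \<and> act tail x = x"
proof -
  have "act tail (act tail x) = act tail x" if "x \<in> carrier M" for x
    using that act_eqI[OF tail_tail, of x] by (simp add: act_mult)
  then show ?thesis
    unfolding V_def by (auto intro: rev_image_eqI)
qed

lemma Res_simps [simp]:
  "carrier Res = V" "\<zero>\<^bsub>Res\<^esub> = \<zero>\<^bsub>M\<^esub>" "add Res = add M" "deg_part Res d = deg_part M d \<inter> V"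
  by (simp_all add: i_restriction_def Let_def V_def act_def)

lemma act_tail_commute:
  assumes "p * tail - tail * p \<in> I" "p \<in> words_in e (Suc n)" "x \<in> V"
  shows "act tail (act p x) = act p x"
proof -
  have "act tail (act p x) = act (tail * p) x"
    using assms by (simp add: act_mult V_iff)
  also have "\<dots> = act (p * tail) x"
    by (rule act_eqI[OF assms(1), symmetric])
  also have "\<dots> = act p x"
    using assms by (simp add: act_mult V_iff)
  finally show ?thesis .
qed

lemma act_push_V: "p \<in> words_in e n \<Longrightarrow> x \<in> V \<Longrightarrow> act (push p) x \<in> V"
  using act_tail_commute[OF push_tail, of p x] by (auto simp: V_iff)

lemma Res_smult:
  assumes "p \<in> words_in e n" "x \<in> V"
  shows "klr_class e \<kappa> n p \<odot>\<^bsub>Res\<^esub> x = act (push p) x"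
proof -
  have "klr_class e \<kappa> n p \<odot>\<^bsub>Res\<^esub> x = act (push p * tail) x"
    unfolding act_def res_hom_class[symmetric] by (simp add: i_restriction_def Let_def)
  then show ?thesis
    using assms by (simp add: act_mult V_iff)
qed

lemma V_add: "x \<in> V \<Longrightarrow> y \<in> V \<Longrightarrow> x \<oplus>\<^bsub>M\<^esub> y \<in> V"
  by (simp add: V_iff act_add_right)

lemma V_zero: "\<zero>\<^bsub>M\<^esub> \<in> V"
  by (simp add: V_iff)

lemma V_closed: "x \<in> V \<Longrightarrow> x \<in> carrier M"
  by (simp add: V_iff)

lemma V_uminus: "x \<in> V \<Longrightarrow> \<ominus>\<^bsub>M\<^esub> x \<in> V"
  using act_push_V[of "scal (- 1)" x] by (simp add: act_uminus V_closed)

lemma Res_left_module: "left_module (klr_algebra e \<kappa> n) Res"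
proof -
  have "abelian_group Res"
  proof (rule abelian_groupI)
    fix x assume "x \<in> carrier Res"
    then show "\<exists>y\<in>carrier Res. y \<oplus>\<^bsub>Res\<^esub> x = \<zero>\<^bsub>Res\<^esub>"
      using V_uminus by (intro bexI[of _ "\<ominus>\<^bsub>M\<^esub> x"]) (auto simp: V_closed M.l_neg)
  qed (auto simp: V_add V_zero V_closed M.a_ac)
  moreover have "left_module_axioms (klr_algebra e \<kappa> n) Res"
  proof (rule left_module_axioms.intro)
    fix a b :: "'f free set" and x y
    assume "a \<in> carrier (klr_algebra e \<kappa> n)" and x: "x \<in> carrier Res"
    then obtain p where p: "p \<in> words_in e n" "a = klr_class e \<kappa> n p"
      by (elim klr_algebra_cases)
    have x: "x \<in> V" using x by simp
    show "a \<odot>\<^bsub>Res\<^esub> x \<in> carrier Res"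
      using p x by (simp add: Res_smult act_push_V)
    show "a \<odot>\<^bsub>Res\<^esub> (x \<oplus>\<^bsub>Res\<^esub> y) = a \<odot>\<^bsub>Res\<^esub> x \<oplus>\<^bsub>Res\<^esub> a \<odot>\<^bsub>Res\<^esub> y" if "y \<in> carrier Res"
      using p x that by (simp add: Res_smult V_add V_closed act_add_right)
    assume "b \<in> carrier (klr_algebra e \<kappa> n)"
    then obtain q where q: "q \<in> words_in e n" "b = klr_class e \<kappa> n q"
      by (elim klr_algebra_cases)
    show "(a \<oplus>\<^bsub>klr_algebra e \<kappa> n\<^esub> b) \<odot>\<^bsub>Res\<^esub> x = a \<odot>\<^bsub>Res\<^esub> x \<oplus>\<^bsub>Res\<^esub> b \<odot>\<^bsub>Res\<^esub> x"
      unfolding p(2) q(2) klr_class_add[OF p(1) q(1), symmetric]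
      using p q x by (simp add: Res_smult V_closed act_add)
    show "(a \<otimes>\<^bsub>klr_algebra e \<kappa> n\<^esub> b) \<odot>\<^bsub>Res\<^esub> x = a \<odot>\<^bsub>Res\<^esub> (b \<odot>\<^bsub>Res\<^esub> x)"
      unfolding p(2) q(2) klr_class_mult[OF p(1) q(1), symmetric]
      using p q x by (simp add: Res_smult act_push_V V_closed act_mult)
  next
    fix x assume "x \<in> carrier Res"
    then show "\<one>\<^bsub>klr_algebra e \<kappa> n\<^esub> \<odot>\<^bsub>Res\<^esub> x = x"
      unfolding klr_class_one[symmetric] by (simp add: Res_smult V_closed)
  qed
  ultimately show ?thesis
    unfolding left_module_def by (simp add: klr_algebra_ring)
qed

lemma Res_gmod: "klr_gmod e \<kappa> n Res"
proof (intro klr_gmod.intro klr_lmod.intro klr_gmod_axioms.intro Res_left_module)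
  interpret Res: left_module "klr_algebra e \<kappa> n" Res
    by (rule Res_left_module)
  show "subgroup (deg_part Res d) (add_monoid Res)" for d
  proof (rule group.subgroupI[OF Res.M.a_group])
    show "inv\<^bsub>add_monoid Res\<^esub> x \<in> deg_part Res d" if x: "x \<in> deg_part Res d" for x
    proof -
      have "\<ominus>\<^bsub>Res\<^esub> x = \<ominus>\<^bsub>M\<^esub> x"
        using x V_uminus by (intro Res.M.minus_equality) (auto simp: V_closed M.l_neg)
      moreover have "\<ominus>\<^bsub>M\<^esub> x \<in> deg_part M d"
        using x subgroup.m_inv_closed[OF deg_subgroup] by (simp add: a_inv_def)
      ultimately show ?thesis
        using x V_uminus by (simp add: a_inv_def[of Res])
    qed
    show "deg_part Res d \<noteq> {}"
      using V_zero deg_zero[of d] by (metis IntI Res_simps(4) empty_iff)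
  qed (use V_add deg_add in auto)
  show "klr_class e \<kappa> n (scal c) \<odot>\<^bsub>Res\<^esub> x \<in> deg_part Res d" if "x \<in> deg_part Res d" for c d x
    using that deg_scal[of x d c] act_push_V[of "scal c" x] by (simp add: Res_smult act_def)
qed

sublocale Res: klr_gmod e \<kappa> n Res
  by (rule Res_gmod)

lemma Res_act: "p \<in> words_in e n \<Longrightarrow> x \<in> V \<Longrightarrow> Res.act p x = act (push p) x"
  unfolding Res.act_def by (rule Res_smult)

lemma Res_line: "x \<in> V \<Longrightarrow> Res.line x = line x"
  unfolding Res.line_def line_def by (simp add: Res_act)

lemma finsum_Res:
  assumes "finite A" "f \<in> A \<rightarrow> V"
  shows "finsum Res f A = finsum M f A"
  using assms
proof (induction A rule: finite_induct)
  case (insert d A)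
  have "f \<in> A \<rightarrow> carrier M" "f \<in> A \<rightarrow> carrier Res"
    using insert V_closed by auto
  then show ?case
    using insert V_closed by simp
qed (simp)

text \<open>This places \<open>V\<close> in the family that is intersected in the definition of the
  socle, and hence the socle inside \<open>V\<close>. Homogeneous components of a vector in
  \<open>V\<close> stay in \<open>V\<close>: \<open>tail\<close> has degree 0 and fixes the vector,
  so by uniqueness it fixes the components.\<close>

lemma V_graded_submodule: "graded_submodule (klr_algebra e \<kappa> n) Res V"
  unfolding graded_submodule_def
proof (intro conjI ballI)
  show "submodule V (klr_algebra e \<kappa> n) Res"
    by (rule Res.submoduleI) (auto simp: V_zero V_add Res_act act_push_V words_in_X simp del: push_words_single push_words_map_X)
  fix x assume x: "x \<in> V"
  then obtain f where f: "homog_decomp M x f"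
    using homog_decomp_ex1[of x] V_closed by auto
  have "homog_decomp M (act tail x) (\<lambda>d. act tail (f d))"
    by (rule homog_decomp_act[OF f tail_in_words klr_homogp_tail])
  then have "(\<lambda>d. act tail (f d)) = f"
    using x by (intro homog_decomp_unique[OF _ f]) (auto simp: V_iff)
  then have fV: "f d \<in> V" for d
    using f deg_closed by (auto simp: V_iff homog_decomp_def fun_eq_iff)
  have "homog_decomp Res x f"
    using f fV unfolding homog_decomp_def by (subst finsum_Res) auto
  then show "\<exists>f. homog_decomp Res x f \<and> (\<forall>d. f d \<in> V)"
    using fV by blast
qed

definition S :: "'b set" where "S = carrier (socle (klr_algebra e \<kappa> n) Res)"

lemma socle_simps:
  "carrier (socle (klr_algebra e \<kappa> n) Res) = S"
  "a \<odot>\<^bsub>socle (klr_algebra e \<kappa> n) Res\<^esub> x = a \<odot>\<^bsub>Res\<^esub> x"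
  "x \<oplus>\<^bsub>socle (klr_algebra e \<kappa> n) Res\<^esub> y = x \<oplus>\<^bsub>M\<^esub> y"
  "\<zero>\<^bsub>socle (klr_algebra e \<kappa> n) Res\<^esub> = \<zero>\<^bsub>M\<^esub>"
  "deg_part (socle (klr_algebra e \<kappa> n) Res) d = deg_part M d \<inter> V \<inter> S"
  by (simp_all add: S_def) (simp_all add: socle_def sub_gmodule_def)

lemma S_eq: "S = \<Inter>{N. graded_submodule (klr_algebra e \<kappa> n) Res N \<and>
    (\<forall>L. graded_submodule (klr_algebra e \<kappa> n) Res L \<and>
      irreducible_gmodule (klr_algebra e \<kappa> n) (sub_gmodule Res L) \<longrightarrow> L \<subseteq> N)}"
  by (simp add: S_def socle_def sub_gmodule_def)

lemma S_subset: "S \<subseteq> V"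
  unfolding S_eq
  by (rule Inter_lower)
     (use V_graded_submodule subgroup.subset[OF submodule.axioms(1)] in \<open>fastforce simp: graded_submodule_def\<close>)

lemma S_irreducible:
  assumes "graded_submodule (klr_algebra e \<kappa> n) Res L"
    and "irreducible_gmodule (klr_algebra e \<kappa> n) (sub_gmodule Res L)"
  shows "L \<subseteq> S"
  unfolding S_eq using assms by blast

lemma S_act: "p \<in> words_in e n \<Longrightarrow> x \<in> S \<Longrightarrow> Res.act p x \<in> S"
  unfolding S_eq by (auto simp: graded_submodule_def intro: Res.submodule_act)

lemma S_add: "x \<in> S \<Longrightarrow> y \<in> S \<Longrightarrow> x \<oplus>\<^bsub>M\<^esub> y \<in> S"
  unfolding S_eq using subgroup.m_closed[OF submodule.axioms(1), of _ "klr_algebra e \<kappa> n" Res x y]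
  by (auto simp: graded_submodule_def)

lemma S_zero: "\<zero>\<^bsub>M\<^esub> \<in> S"
  unfolding S_eq using Res.submodule_zero by (auto simp: graded_submodule_def)

end

section \<open>Restricting a one-dimensional module, and a generator of a one-dimensional
  socle\<close>

context klr_restriction
begin

context
  fixes js :: "int list" and j :: int and d :: int
  assumes char_n: "klr_char TYPE('f) e \<kappa> n js"
    and char_Suc: "klr_char TYPE('f) e \<kappa> (Suc n) (js @ [j])"
    and iso: "gmodule_iso (klr_algebra e \<kappa> (Suc n)) M (one_dim_module (js @ [j]) d :: ('f, 'f) klr_gmodule)"
begin

lemma iso_obtain:
  obtains \<phi> where "bij_betw \<phi> (carrier M) UNIV"
    "\<And>x y. x \<in> carrier M \<Longrightarrow> y \<in> carrier M \<Longrightarrow> \<phi> (x \<oplus>\<^bsub>M\<^esub> y) = \<phi> x + \<phi> y"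
    "\<And>p x. p \<in> words_in e (Suc n) \<Longrightarrow> x \<in> carrier M \<Longrightarrow> \<phi> (act p x) = one_dim_char (js @ [j]) p * \<phi> x"
    "\<And>d'. \<phi> ` deg_part M d' = (if d' = d then UNIV else {0})"
  by (rule klr_char.gmodule_iso_one_dimE[OF char_Suc iso, folded act_def]) (rule that)

text \<open>On a module of weight \<open>js @ [j]\<close> the idempotent \<open>tail\<close> acts by
  zero, so already \<open>V\<close> is zero.\<close>

lemma socle_other_residue:
  assumes "i \<noteq> j"
  shows "S = {\<zero>\<^bsub>M\<^esub>}"
proof (rule iso_obtain)
  fix \<phi> assume \<phi>: "bij_betw \<phi> (carrier M) (UNIV :: 'f set)"
    "\<And>p x. p \<in> words_in e (Suc n) \<Longrightarrow> x \<in> carrier M \<Longrightarrow> \<phi> (act p x) = one_dim_char (js @ [j]) p * \<phi> x"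
  have zero: "x = \<zero>\<^bsub>M\<^esub>" if x: "x \<in> S" for x
  proof -
    have xV: "x \<in> carrier M" "act tail x = x"
      using x S_subset by (auto simp: V_iff)
    have "\<phi> x = 0"
      using \<phi>(2)[OF tail_in_words xV(1)] assms klr_char.seq[OF char_n] by (simp add: xV(2) char_tail)
    moreover have "\<phi> \<zero>\<^bsub>M\<^esub> = 0"
      using \<phi>(2)[of 0 x] xV(1) by simp
    ultimately have "\<phi> x = \<phi> \<zero>\<^bsub>M\<^esub>" by simp
    then show ?thesis
      by (rule inj_onD[OF bij_betw_imp_inj_on[OF \<phi>(1)] _ xV(1) M.zero_closed])
  qed
  have "S \<subseteq> {\<zero>\<^bsub>M\<^esub>}"
    by (intro subsetI, rule singleton_iff[THEN iffD2], erule zero)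
  then show ?thesis using S_zero by (intro equalityI) simp_all
qed

text \<open>Here \<open>tail\<close> acts as the identity, so \<open>V\<close> is the whole module.
  It is a line, hence irreducible over the smaller algebra, hence its own socle;
  \<open>char_push\<close> shows that its character is that of the shortened sequence.\<close>

lemma socle_same_residue:
  assumes "i = j"
  shows "gmodule_iso (klr_algebra e \<kappa> n) (socle (klr_algebra e \<kappa> n) Res)
    (one_dim_module js d :: ('f, 'f) klr_gmodule)"
    and "S = carrier M" "V = carrier M"
proof -
  obtain \<phi> where \<phi>: "bij_betw \<phi> (carrier M) (UNIV :: 'f set)"
    "\<And>x y. x \<in> carrier M \<Longrightarrow> y \<in> carrier M \<Longrightarrow> \<phi> (x \<oplus>\<^bsub>M\<^esub> y) = \<phi> x + \<phi> y"
    "\<And>p x. p \<in> words_in e (Suc n) \<Longrightarrow> x \<in> carrier M \<Longrightarrow> \<phi> (act p x) = one_dim_char (js @ [j]) p * \<phi> x"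
    "\<And>d'. \<phi> ` deg_part M d' = (if d' = d then UNIV else {0})"
    by (rule iso_obtain) (rule that)
  have inj: "x = y" if "\<phi> x = \<phi> y" "x \<in> carrier M" "y \<in> carrier M" for x y
    by (rule inj_onD[OF bij_betw_imp_inj_on[OF \<phi>(1)] that])
  have "one_dim_char (js @ [j]) tail = (1 :: 'f)"
    using char_tail[OF klr_char.seq[OF char_n], of j] assms by simp
  then have "act tail x = x" if "x \<in> carrier M" for x
    using that \<phi>(3)[OF tail_in_words that] by (intro inj) simp_all
  then show V: "V = carrier M"
    by (auto simp: V_iff)
  have "1 \<in> \<phi> ` deg_part M d" using \<phi>(4)[of d] by simp
  then obtain x where x: "x \<in> deg_part M d" "\<phi> x = 1" by auto
  have xM: "x \<in> carrier M" by (rule deg_closed[OF x(1)])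
  have zero: "\<phi> \<zero>\<^bsub>M\<^esub> = 0"
    using \<phi>(3)[of 0 x] xM by simp
  have act_x: "y = act (scal (\<phi> y)) x" if "y \<in> carrier M" for y
    using that xM x(2) \<phi>(3)[of "scal (\<phi> y)" x] by (intro inj) auto
  have line: "line x = carrier M"
    using act_x line_closed[OF xM] unfolding line_def by blast
  have Rline: "Res.line x = carrier M"
    using Res_line[of x] xM V line by simp
  have "Res.act (X g) x \<in> Res.line x" if "g \<in> gens e n" for g
    using Res.act_closed[of "X g" x] that xM unfolding Rline by (simp add: V words_in_X)
  then have "graded_submodule (klr_algebra e \<kappa> n) Res (Res.line x)"
    using x(1) xM by (intro Res.line_graded_submodule[of x d]) (auto simp: V)
  moreover have "irreducible_gmodule (klr_algebra e \<kappa> n) (sub_gmodule Res (Res.line x))"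
    using xM x(2) zero by (intro Res.line_irreducible) (auto simp: V)
  ultimately have "Res.line x \<subseteq> S" by (rule S_irreducible)
  then show S: "S = carrier M"
    using S_subset V Rline by auto
  have "\<phi> (klr_class e \<kappa> n p \<odot>\<^bsub>Res\<^esub> x) = one_dim_char js p * \<phi> x"
    if "p \<in> words_in e n" "x \<in> carrier M" for p x
    using that Res_smult[of p x] \<phi>(3)[of "push p" x] V assms char_push[of js p] push_in_words[OF that(1)]
    by simp
  moreover have "deg_part M d' \<inter> carrier M \<inter> carrier M = deg_part M d'" for d'
    using deg_closed by auto
  ultimately show "gmodule_iso (klr_algebra e \<kappa> n) (socle (klr_algebra e \<kappa> n) Res)
    (one_dim_module js d :: ('f, 'f) klr_gmodule)"
    unfolding klr_char.gmodule_iso_one_dim[OF char_n] socle_simps V S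
    using \<phi>(1,2,4) by (intro exI[of _ \<phi>]) simp
qed

end

text \<open>Let \<open>w\<close> be the image of \<open>x\<close> under
  \<open>y\<^sub>n\<^sub>+\<^sub>1\<close>. This operator commutes with \<open>tail\<close> and with
  the generators of the smaller algebra, so a nonzero \<open>w\<close> would span an irreducible
  graded submodule of the restriction and would lie in the socle. But the socle is concentrated in
  degree \<open>k\<close>, while \<open>w\<close> has degree \<open>k + 2\<close>.\<close>

lemma socle_one_dim_generator:
  fixes k :: int
  assumes char_n: "klr_char TYPE('f) e \<kappa> n js"
    and iso: "gmodule_iso (klr_algebra e \<kappa> n) (socle (klr_algebra e \<kappa> n) Res)
      (one_dim_module js k :: ('f, 'f) klr_gmodule)"
  obtains x where "x \<in> deg_part M k" "x \<noteq> \<zero>\<^bsub>M\<^esub>" "act (yy (Suc n)) x = \<zero>\<^bsub>M\<^esub>"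
    "\<And>g. g \<in> gens e n \<Longrightarrow> act (X (append_res i g)) x = act (scal (one_dim_char js (X g))) x"
proof -
  obtain \<phi> where \<phi>: "bij_betw \<phi> S (UNIV :: 'f set)"
    "\<And>p x. p \<in> words_in e n \<Longrightarrow> x \<in> S \<Longrightarrow> \<phi> (Res.act p x) = one_dim_char js p * \<phi> x"
    "\<And>d. \<phi> ` (deg_part M d \<inter> V \<inter> S) = (if d = k then UNIV else {0})"
    by (rule klr_char.gmodule_iso_one_dimE[OF char_n iso, unfolded socle_simps, folded Res.act_def])
      (rule that)
  have inj: "x = y" if "\<phi> x = \<phi> y" "x \<in> S" "y \<in> S" for x y
    by (rule inj_onD[OF bij_betw_imp_inj_on[OF \<phi>(1)] that])
  have "1 \<in> \<phi> ` (deg_part M k \<inter> V \<inter> S)" using \<phi>(3)[of k] by simp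
  then obtain x where x: "x \<in> deg_part M k" "x \<in> V" "x \<in> S" "\<phi> x = 1" by auto
  have xM: "x \<in> carrier M" by (rule V_closed[OF x(2)])
  have phi_zero: "\<phi> \<zero>\<^bsub>M\<^esub> = 0"
    using \<phi>(2)[of 0 x] x by simp
  have act_x: "act (push p) x = act (scal (one_dim_char js p)) x" if p: "p \<in> words_in e n" for p
  proof -
    have "Res.act p x = Res.act (scal (one_dim_char js p)) x"
      using x p by (intro inj S_act) (simp_all add: \<phi>(2))
    then show ?thesis
      using x p by (simp add: Res_act)
  qed
  have gen_x: "act (X (append_res i g)) x = act (scal (one_dim_char js (X g))) x" if "g \<in> gens e n" for g
    using act_x[of "X g"] that by (simp add: words_in_X)
  let ?y = "yy (Suc n) :: 'f free" and ?w = "act (yy (Suc n)) x"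
  have y_words: "?y \<in> words_in e (Suc n)" by (rule words_in_X) simp
  have y_commute: "act (X (append_res i g)) (act ?y z) = act ?y (act (X (append_res i g)) z)"
    if g: "g \<in> gens e n" and z: "z \<in> carrier M" for g z
  proof -
    have "X (append_res i g) * ?y - ?y * X (append_res i g) \<in> I"
    proof (cases g)
      case (E ks)
      then have "?y * X (append_res i g) - X (append_res i g) * ?y \<in> I"
        using g i by (auto intro!: klr_relator_in_ideal klr_relators.y_idem)
      from klr_ideal_uminus[OF this] show ?thesis by simp
    qed (use g in \<open>auto intro!: klr_relator_in_ideal klr_relators.y_y klr_relators.psi_y\<close>)
    from act_eqI[OF this, of z] show ?thesis
      using g z y_words by (simp add: act_mult words_in_X append_res_gens)
  qed
  have "?y * tail - tail * ?y = (\<Sum>ks\<in>res_seqs e n. ?y * ee (ks @ [i]) - ee (ks @ [i]) * ?y)"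
    by (simp add: tail_idem_def sum_distrib_left sum_distrib_right sum_subtractf)
  also have "\<dots> \<in> I"
    using i by (intro klr_ideal_sum klr_relator_in_ideal klr_relators.y_idem) auto
  finally have w: "?w \<in> V"
    using act_tail_commute[OF _ y_words x(2)] y_words xM by (auto simp: V_iff)
  have w_deg: "?w \<in> deg_part M (2 + k)"
    by (intro act_homog x(1) klr_homogp.intros(2)) auto
  have "?w = \<zero>\<^bsub>M\<^esub>"
  proof (rule ccontr)
    assume nz: "?w \<noteq> \<zero>\<^bsub>M\<^esub>"
    have "Res.act (X g) ?w \<in> Res.line ?w" if g: "g \<in> gens e n" for g
    proof -
      have "Res.act (X g) ?w = act ?y (act (scal (one_dim_char js (X g))) x)"
        using g w xM y_commute[OF g xM] gen_x[OF g] by (simp add: Res_act words_in_X)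
      then have "Res.act (X g) ?w = act (scal (one_dim_char js (X g))) ?w"
        using xM y_words by (simp add: act_scal_commute)
      then show ?thesis
        unfolding Res_line[OF w] line_def by blast
    qed
    then have "graded_submodule (klr_algebra e \<kappa> n) Res (Res.line ?w)"
      using w_deg w by (intro Res.line_graded_submodule[of _ "2 + k"]) auto
    moreover have "irreducible_gmodule (klr_algebra e \<kappa> n) (sub_gmodule Res (Res.line ?w))"
      using nz w by (intro Res.line_irreducible) auto
    ultimately have "Res.line ?w \<subseteq> S" by (rule S_irreducible)
    then have "?w \<in> S"
      using Res.line_self[of ?w] w by auto
    then have "\<phi> ?w \<in> \<phi> ` (deg_part M (2 + k) \<inter> V \<inter> S)"
      using w w_deg by blast
    then have "\<phi> ?w = 0"
      unfolding \<phi>(3) by simp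
    then have "?w = \<zero>\<^bsub>M\<^esub>"
      using phi_zero \<open>?w \<in> S\<close> S_zero by (intro inj) auto
    then show False using nz by simp
  qed
  moreover have "x \<noteq> \<zero>\<^bsub>M\<^esub>"
    using x(4) phi_zero by auto
  ultimately show ?thesis
    using that x(1) gen_x by blast
qed

end

section \<open>Irreducible modules with a one-dimensional socle of the restriction\<close>

context klr_lmod
begin

text \<open>Adding one scaled vector at a time turns closure properties of the linear span into
  inductions, without any sums.\<close>

inductive_set lspan :: "'b set \<Rightarrow> 'b set" for A :: "'b set" where
  lspan_zero: "\<zero>\<^bsub>M\<^esub> \<in> lspan A"
| lspan_step: "a \<in> A \<Longrightarrow> v \<in> lspan A \<Longrightarrow> act (scal c) a \<oplus>\<^bsub>M\<^esub> v \<in> lspan A"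

lemma lspan_closed:
  assumes "A \<subseteq> carrier M" "v \<in> lspan A"
  shows "v \<in> carrier M"
  using assms(2) by (induction rule: lspan.induct) (use assms(1) in auto)

lemma lspan_add:
  assumes A: "A \<subseteq> carrier M" and "v \<in> lspan A" "w \<in> lspan A"
  shows "v \<oplus>\<^bsub>M\<^esub> w \<in> lspan A"
  using assms(2)
proof (induction rule: lspan.induct)
  case (lspan_step a v c)
  have "act (scal c) a \<oplus>\<^bsub>M\<^esub> (v \<oplus>\<^bsub>M\<^esub> w) \<in> lspan A"
    using lspan_step by (intro lspan.lspan_step)
  then show ?case
    using lspan_step A lspan_closed[OF A] assms(3) by (subst M.a_assoc) auto
qed (use lspan_closed[OF A] assms(3) in auto)

lemma lspan_scal_gen: "A \<subseteq> carrier M \<Longrightarrow> a \<in> A \<Longrightarrow> act (scal c) a \<in> lspan A"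
  using lspan_step[OF _ lspan_zero, of a A c] by auto

lemma lspan_gen: "A \<subseteq> carrier M \<Longrightarrow> a \<in> A \<Longrightarrow> a \<in> lspan A"
  using lspan_scal_gen[of A a 1] by auto

lemma lspan_scal:
  assumes A: "A \<subseteq> carrier M" and "v \<in> lspan A"
  shows "act (scal c) v \<in> lspan A"
  using assms(2)
proof (induction rule: lspan.induct)
  case (lspan_step a v d)
  have a: "a \<in> carrier M" "v \<in> carrier M" using lspan_step A lspan_closed[OF A] by auto
  have "act (scal (c * d)) a \<oplus>\<^bsub>M\<^esub> act (scal c) v \<in> lspan A"
    using lspan_step by (intro lspan.lspan_step)
  then show ?case
    using a by (simp add: act_add_right act_scal_scal)
qed (simp add: lspan_zero)

text \<open>Source and target may differ: the span can grow under an operator, and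
  \<open>B = {}\<close> expresses that the operator kills the span of \<open>A\<close>.\<close>

lemma lspan_act:
  assumes A: "A \<subseteq> carrier M" and B: "B \<subseteq> carrier M" and p: "p \<in> words_in e n"
    and gen: "\<And>a. a \<in> A \<Longrightarrow> act p a \<in> lspan B" and "v \<in> lspan A"
  shows "act p v \<in> lspan B"
  using assms(5)
proof (induction rule: lspan.induct)
  case (lspan_step a v d)
  have a: "a \<in> carrier M" "v \<in> carrier M" using lspan_step A lspan_closed[OF A] by auto
  have "act (scal d) (act p a) \<oplus>\<^bsub>M\<^esub> act p v \<in> lspan B"
    using lspan_step by (intro lspan_add[OF B lspan_scal[OF B gen]])
  then show ?case
    using a p by (simp add: act_add_right act_scal_commute)
qed (use p in \<open>simp add: lspan_zero\<close>)

lemma lspan_mono: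
  assumes "A \<subseteq> B" "v \<in> lspan A"
  shows "v \<in> lspan B"
  using assms(2) by (induction rule: lspan.induct) (use assms(1) in \<open>auto intro: lspan.intros\<close>)

text \<open>Many relators hold only after multiplication with an idempotent; a vector of that weight
  absorbs it.\<close>

lemma act_weight_relator:
  assumes "p * ee w - q * ee w \<in> klr_relators e \<kappa> n" "act (ee w) v = v" "v \<in> carrier M"
    "p \<in> words_in e n" "q \<in> words_in e n" "w \<in> res_seqs e n"
  shows "act p v = act q v"
proof -
  have "act p v = act (p * ee w) v"
    using assms by (simp add: act_mult words_in_X)
  also have "\<dots> = act (q * ee w) v"
    by (rule act_relator[OF assms(1)])
  also have "\<dots> = act q v"
    using assms by (simp add: act_mult words_in_X)
  finally show ?thesis .
qed

lemma act_delta: "v \<in> carrier M \<Longrightarrow> act (delta a b) v = (if a = b then v else \<zero>\<^bsub>M\<^esub>)"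
  by (simp add: delta_def)

end

lemma braid_error_scal: "\<exists>c. braid_error e r is = scal c"
proof -
  have "(0 :: 'a free) = scal 0" "(1 :: 'a free) = scal 1" "(- 1 :: 'a free) = scal (- 1)"
    by (simp_all only: single_zero scal_one single_uminus)
  then show ?thesis unfolding braid_error_def by metis
qed

lemma pred_res_neq: "e \<ge> 2 \<Longrightarrow> a \<in> {0..<int e} \<Longrightarrow> pred_res e a \<noteq> a"
proof
  assume e: "e \<ge> 2" and a: "a \<in> {0..<int e}" and eq: "pred_res e a = a"
  then have "(a - 1) mod int e = a mod int e" by (simp add: pred_res_def)
  then have "int e dvd (a - 1) - a" by (simp only: mod_eq_dvd_iff)
  then show False using e by simp
qed

text \<open>The hypotheses on \<open>x\<close> are what the socle argument provides; the action of
  \<open>\<psi>\<^sub>n\<close> is missing. \<open>i_pred\<close> and \<open>i_neq\<close> control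
  the corrections in which \<open>x\<close> itself could appear: \<open>i_pred\<close> for the
  relations of \<open>y\<close> and for the square of \<open>\<psi>\<^sub>n\<close>,
  \<open>i_neq\<close> for the braid relation.\<close>

locale klr_insertion = klr_graded e \<kappa> "Suc n" M
  for e :: nat and \<kappa> :: "nat \<Rightarrow> int" and n :: nat and M :: "('f::field, 'b) klr_gmodule" +
  fixes js :: "int list" and i :: int and x :: 'b and k :: int
  assumes e: "e \<ge> 2" and i: "i \<in> {0..<int e}" and js: "js \<in> res_seqs e n"
    and i_pred: "n \<ge> 1 \<Longrightarrow> i = pred_res e (ent js n)"
    and i_neq: "n \<ge> 2 \<Longrightarrow> i \<noteq> ent js (n - 1)"
    and irr: "irreducible_gmodule (klr_algebra e \<kappa> (Suc n)) M"
    and x_deg: "x \<in> deg_part M k" and x_nz: "x \<noteq> \<zero>\<^bsub>M\<^esub>"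
    and x_idem: "act (ee (js @ [i])) x = x"
    and x_y: "\<And>r. 1 \<le> r \<Longrightarrow> r \<le> Suc n \<Longrightarrow> act (yy r) x = \<zero>\<^bsub>M\<^esub>"
    and x_psi: "\<And>r. 1 \<le> r \<Longrightarrow> r < n \<Longrightarrow> act (psi r) x = \<zero>\<^bsub>M\<^esub>"
begin

text \<open>The vectors \<open>\<psi>\<^sub>k \<dots> \<psi>\<^sub>n x\<close> for \<open>k \<le> n\<close> span a graded submodule.  Their weights \<open>w k\<close>
  differ from the weight of \<open>x\<close>, so that \<open>x\<close> is not contained in it.\<close>

definition xs :: "nat \<Rightarrow> 'b" where
  "xs r = rec_nat x (\<lambda>m v. act (psi (n - m)) v) (Suc n - r)"

definition w :: "nat \<Rightarrow> int list" where "w r = take (r - 1) js @ i # drop (r - 1) js"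

text \<open>The sets grow as \<open>r\<close> decreases, and \<open>\<psi>\<^sub>r\<close> carries
  the span of \<open>A (Suc r)\<close> into that of \<open>A r\<close>; this drives the downward
  inductions. \<open>A (Suc n)\<close> is empty, so they start from vectors that vanish.\<close>

definition A :: "nat \<Rightarrow> 'b set" where "A r = xs ` {r..n}"

lemma xs_Suc_n: "xs (Suc n) = x"
  by (simp add: xs_def)

lemma xs_step: "1 \<le> r \<Longrightarrow> r \<le> n \<Longrightarrow> xs r = act (psi r) (xs (Suc r))"
  by (simp add: xs_def Suc_diff_le)

lemma length_js: "length js = n"
  using js by (simp add: res_seqs_def)

lemma ent_js: "1 \<le> r \<Longrightarrow> r \<le> n \<Longrightarrow> ent js r \<in> {0..<int e}"
  using js nth_mem[of "r - 1" js] by (auto simp: res_seqs_def subset_iff)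

lemma ent_js_neq: "1 \<le> n \<Longrightarrow> ent js n \<noteq> i"
  using pred_res_neq[OF e ent_js[of n]] i_pred by simp

lemma w_in: "1 \<le> r \<Longrightarrow> r \<le> Suc n \<Longrightarrow> w r \<in> res_seqs e (Suc n)"
  using js i by (auto simp: w_def res_seqs_def dest: in_set_takeD in_set_dropD)

lemma w_Suc_n: "w (Suc n) = js @ [i]"
  by (simp add: w_def length_js)

lemma w_ent:
  assumes "1 \<le> r" "r \<le> n"
  shows "ent (w (Suc r)) r = ent js r" "ent (w (Suc r)) (r + 1) = i"
  using assms by (simp_all add: w_def nth_append length_js less_imp_diff_less)

lemma w_swap:
  assumes "1 \<le> r" "r \<le> n"
  shows "swap_res r (w (Suc r)) = w r"
proof (rule nth_equalityI)
  show "length (swap_res r (w (Suc r))) = length (w r)"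
    using assms by (simp add: w_def length_js)
  fix j assume "j < length (swap_res r (w (Suc r)))"
  then have "j < Suc n" using assms by (simp add: w_def length_js)
  then show "swap_res r (w (Suc r)) ! j = w r ! j"
    using assms unfolding swap_res_def
    by (auto simp: w_def nth_list_update nth_append length_js nth_Cons' min_def)
qed

text \<open>Inserted before the end, \<open>i\<close> leaves the last entry of \<open>js\<close> in
  the last place, and that entry differs from \<open>i\<close>.\<close>

lemma w_neq:
  assumes "1 \<le> r" "r \<le> n"
  shows "w r \<noteq> js @ [i]"
proof
  assume "w r = js @ [i]"
  then have "last (w r) = i" by simp
  moreover have "js \<noteq> []" "drop (r - 1) js \<noteq> []"
    using assms length_js by auto
  then have "last (w r) = last js" "last js = ent js n"
    by (simp add: w_def, simp add: last_conv_nth length_js)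
  ultimately show False
    using ent_js_neq assms by simp
qed

lemma x_closed: "x \<in> carrier M"
  by (rule deg_closed[OF x_deg])

lemma psi_words: "1 \<le> r \<Longrightarrow> r \<le> n \<Longrightarrow> (psi r :: 'f free) \<in> words_in e (Suc n)"
  and y_words: "1 \<le> r \<Longrightarrow> r \<le> Suc n \<Longrightarrow> (yy r :: 'f free) \<in> words_in e (Suc n)"
  and ee_words: "ks \<in> res_seqs e (Suc n) \<Longrightarrow> (ee ks :: 'f free) \<in> words_in e (Suc n)"
  by (auto intro: words_in_X)

lemma xs_weight:
  assumes "1 \<le> r" "r \<le> Suc n"
  shows "xs r \<in> carrier M \<and> act (ee (w r)) (xs r) = xs r \<and> (\<exists>d. xs r \<in> deg_part M d)"
  using assms(2,1)
proof (induction r rule: inc_induct)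
  case base
  then show ?case using x_closed x_idem x_deg by (auto simp: xs_Suc_n w_Suc_n)
next
  case (step r)
  then have r: "1 \<le> r" "r \<le> n" and IH: "xs (Suc r) \<in> carrier M"
    "act (ee (w (Suc r))) (xs (Suc r)) = xs (Suc r)" "\<exists>d. xs (Suc r) \<in> deg_part M d"
    by auto
  obtain d where d: "xs (Suc r) \<in> deg_part M d" using IH(3) by blast
  have w: "w (Suc r) \<in> res_seqs e (Suc n)" "w r \<in> res_seqs e (Suc n)" using r by (auto intro: w_in)
  have *: "xs r = act (psi r * ee (w (Suc r))) (xs (Suc r))"
    using xs_step[OF r] IH psi_words[OF r] ee_words[OF w(1)] by (simp add: act_mult)
  also have "\<dots> = act (ee (w r) * psi r) (xs (Suc r))"
    using klr_relators.psi_idem[of r "Suc n" "w (Suc r)" e \<kappa>] r w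
    by (intro act_relator) (simp add: w_swap)
  also have "\<dots> = act (ee (w r)) (xs r)"
    using xs_step[OF r] IH psi_words[OF r] ee_words[OF w(2)] by (simp add: act_mult)
  finally have "act (ee (w r)) (xs r) = xs r" by simp
  moreover have "xs r \<in> deg_part M (psi_deg e r (w (Suc r)) + d)"
    unfolding * using r w by (intro act_homog[OF _ d] klr_homogp.intros(3)) auto
  moreover have "xs r \<in> carrier M"
    using xs_step[OF r] IH psi_words[OF r] by simp
  ultimately show ?case by blast
qed

lemmas xs_closed = xs_weight[THEN conjunct1]
lemmas xs_idem = xs_weight[THEN conjunct2, THEN conjunct1]

lemma A_closed: "1 \<le> r \<Longrightarrow> A r \<subseteq> carrier M"
  unfolding A_def using xs_closed by auto

lemma xs_in: "1 \<le> r \<Longrightarrow> r \<le> m \<Longrightarrow> m \<le> n \<Longrightarrow> xs m \<in> lspan (A r)"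
  by (rule lspan_gen[OF A_closed]) (auto simp: A_def)

text \<open>\<open>\<psi>\<^sub>j\<close> commutes with all of \<open>\<psi>\<^sub>r\<close>, ...,
  \<open>\<psi>\<^sub>n\<close> and then kills \<open>x\<close>.\<close>

lemma psi_xs_small:
  assumes "1 \<le> j" "Suc j < r" "r \<le> Suc n"
  shows "act (psi j) (xs r) = \<zero>\<^bsub>M\<^esub>"
  using assms(3,1,2)
proof (induction r rule: inc_induct)
  case base
  then show ?case using x_psi by (simp add: xs_Suc_n)
next
  case (step r)
  then have r: "1 \<le> r" "r \<le> n" "j \<le> n" by auto
  have "act (psi j) (xs r) = act (psi j * psi r) (xs (Suc r))"
    using r step xs_closed[of "Suc r"] by (simp add: xs_step act_mult psi_words)
  also have "\<dots> = act (psi r * psi j) (xs (Suc r))"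
    using r step by (intro act_relator klr_relators.psi_psi) auto
  also have "\<dots> = act (psi r) (act (psi j) (xs (Suc r)))"
    using r step xs_closed[of "Suc r"] by (simp add: act_mult psi_words)
  also have "\<dots> = \<zero>\<^bsub>M\<^esub>"
    using step r by (simp add: psi_words)
  finally show ?case .
qed

lemma psi_lspan:
  assumes "1 \<le> r" "r \<le> n" "v \<in> lspan (A (Suc r))"
  shows "act (psi r) v \<in> lspan (A r)"
proof (rule lspan_act[OF A_closed A_closed _ _ assms(3)])
  fix a assume "a \<in> A (Suc r)"
  then obtain m where m: "a = xs m" "Suc r \<le> m" "m \<le> n" by (auto simp: A_def)
  show "act (psi r) a \<in> lspan (A r)"
  proof (cases "m = Suc r")
    case True
    then show ?thesis using m assms xs_step[of r] xs_in[of r r] by simp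
  next
    case False
    then show ?thesis using m assms psi_xs_small[of r m] by (simp add: lspan_zero)
  qed
qed (use assms psi_words in auto)

lemma lspan_A_mono: "r \<le> s \<Longrightarrow> v \<in> lspan (A s) \<Longrightarrow> v \<in> lspan (A r)"
  by (rule lspan_mono) (auto simp: A_def)

text \<open>Moving \<open>y\<^sub>s\<close> past \<open>\<psi>\<^sub>r\<close> either commutes or
  exchanges the indices \<open>r\<close> and \<open>r + 1\<close> at the price of a multiple of
  \<open>xs (Suc r)\<close>. The first part is handled by the induction hypothesis and
  \<open>psi_lspan\<close>, the second by \<open>delta\<close>.\<close>

lemma y_xs:
  assumes "1 \<le> r" "r \<le> Suc n" "1 \<le> s" "s \<le> Suc n"
  shows "act (yy s) (xs r) \<in> lspan (A r) \<and> (s < r \<longrightarrow> act (yy s) (xs r) = \<zero>\<^bsub>M\<^esub>)"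
  using assms(2,1,3,4)
proof (induction r arbitrary: s rule: inc_induct)
  case base
  then show ?case by (simp add: xs_Suc_n x_y lspan_zero)
next
  case (step r)
  then have r: "1 \<le> r" "r \<le> n" and s: "1 \<le> s" "s \<le> Suc n" by auto
  let ?v = "xs (Suc r)"
  have v: "?v \<in> carrier M" "act (ee (w (Suc r))) ?v = ?v" "w (Suc r) \<in> res_seqs e (Suc n)"
    using r xs_closed xs_idem w_in by auto
  have IH: "act (yy t) ?v \<in> lspan (A (Suc r))" "t < Suc r \<Longrightarrow> act (yy t) ?v = \<zero>\<^bsub>M\<^esub>"
    if "1 \<le> t" "t \<le> Suc n" for t
    using step.IH[of t] that by auto
  note closed = A_closed[OF r(1)]
  have ys: "(yy s :: 'f free) \<in> words_in e (Suc n)" "(psi r :: 'f free) \<in> words_in e (Suc n)"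
    "(yy r :: 'f free) \<in> words_in e (Suc n)" "(yy (Suc r) :: 'f free) \<in> words_in e (Suc n)"
    using r s by (auto intro!: y_words psi_words)
  have xr: "act (yy t) (xs r) = act (yy t * psi r) ?v" if "1 \<le> t" "t \<le> Suc n" for t
    using r v that ys y_words[of t] by (simp add: xs_step act_mult)
  have psi_y: "act (psi r) (act (yy t) ?v) \<in> lspan (A r)" if "1 \<le> t" "t \<le> Suc n" for t
    by (rule psi_lspan[OF r IH(1)[OF that]])
  \<comment> \<open>The correction lies in the span as \<open>xs (Suc r)\<close> for
    \<open>r < n\<close>. For \<open>r = n\<close> it would be \<open>x\<close>, but its coefficient
    is zero because the last entry of \<open>js\<close> is not \<open>i\<close>.\<close>
  have delta: "act (delta (ent js r) i) ?v \<in> lspan (A r)"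
  proof (cases "r = n")
    case True
    then have "ent js r \<noteq> i"
      using ent_js_neq r by simp
    then show ?thesis using v by (simp add: act_delta lspan_zero)
  next
    case False
    then show ?thesis using v r xs_in[of r "Suc r"] by (simp add: act_delta lspan_zero)
  qed
  consider "s \<noteq> r" "s \<noteq> Suc r" | "s = r" | "s = Suc r" by blast
  then show ?case
  proof cases
    case 1
    have "act (yy s) (xs r) = act (yy s * psi r) ?v"
      using s by (rule xr)
    also have "\<dots> = act (psi r * yy s) ?v"
      by (rule act_relator[symmetric], rule klr_relators.psi_y) (use 1 r s in auto)
    also have "\<dots> = act (psi r) (act (yy s) ?v)"
      using ys v by (simp add: act_mult)
    finally show ?thesis
      using psi_y[OF s] IH(2)[OF s] ys by auto
  next
    case 2
    have "act (psi r * yy (r + 1)) ?v = act (yy r * psi r + delta (ent (w (Suc r)) r) (ent (w (Suc r)) (r + 1))) ?v"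
      using r v ys by (intro act_weight_relator[OF klr_relators.psi_y_next]) auto
    then have "act (psi r) (act (yy (Suc r)) ?v) = act (yy r) (xs r) \<oplus>\<^bsub>M\<^esub> act (delta (ent js r) i) ?v"
      unfolding w_ent[OF r] using r v ys xr[of r] by (simp add: act_mult act_add)
    then have "act (yy r) (xs r) =
        act (psi r) (act (yy (Suc r)) ?v) \<oplus>\<^bsub>M\<^esub> act (scal (- 1)) (act (delta (ent js r) i) ?v)"
      using v ys r xs_closed[of r] by (simp add: act_uminus M.a_assoc M.r_neg)
    also have "\<dots> \<in> lspan (A r)"
      using psi_y[of "Suc r"] r delta by (intro lspan_add[OF closed] lspan_scal[OF closed]) auto
    finally show ?thesis using 2 by simp
  next
    case 3
    have "act (yy (r + 1) * psi r) ?v = act (psi r * yy r + delta (ent (w (Suc r)) r) (ent (w (Suc r)) (r + 1))) ?v"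
      using r v ys by (intro act_weight_relator[OF klr_relators.y_next_psi]) auto
    then have "act (yy s) (xs r) = act (psi r) (act (yy r) ?v) \<oplus>\<^bsub>M\<^esub> act (delta (ent js r) i) ?v"
      unfolding w_ent[OF r] using r v ys xr[of s] s 3 by (simp add: act_mult act_add)
    also have "\<dots> \<in> lspan (A r)"
      using psi_y[of r] r delta by (intro lspan_add[OF closed]) auto
    finally show ?thesis using 3 by simp
  qed
qed

text \<open>For \<open>j > r + 1\<close> the operators commute. For \<open>j = r + 1\<close> the
  braid relation is applied to \<open>xs (r + 2)\<close>: the side that begins with
  \<open>\<psi>\<^sub>r\<close> acting on this vector vanishes by \<open>psi_xs_small\<close>, and
  only the error term remains.\<close>

lemma psi_xs_large:
  assumes "1 \<le> r" "r < j" "j \<le> n"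
  shows "act (psi j) (xs r) \<in> lspan (A r)"
  using assms(2,1,3)
proof (induction r rule: strict_inc_induct)
  case (base r)
  then have j: "j = Suc r" and r: "1 \<le> r" "Suc r \<le> n" by auto
  let ?v = "xs (Suc (Suc r))"
  have v: "?v \<in> carrier M" "act (ee (w (Suc (Suc r)))) ?v = ?v" "w (Suc (Suc r)) \<in> res_seqs e (Suc n)"
    using r xs_closed xs_idem w_in by auto
  have psis: "(psi r :: 'f free) \<in> words_in e (Suc n)" "(psi (Suc r) :: 'f free) \<in> words_in e (Suc n)"
    using r by (auto intro!: psi_words)
  let ?err = "braid_error e r (w (Suc (Suc r))) :: 'f free"
  have err_words: "?err \<in> words_in e (Suc n)"
    by (simp add: braid_error_def)
  \<comment> \<open>The error is a multiple of \<open>xs (r + 2)\<close>. This is \<open>x\<close>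
    if \<open>r + 1 = n\<close>, and there \<open>i_neq\<close> makes the braid error zero.\<close>
  have err: "act ?err ?v \<in> lspan (A r)"
  proof (cases "Suc r = n")
    case True
    have "ent (w (Suc (Suc r))) r = ent js r" "ent (w (Suc (Suc r))) (r + 2) = i"
      using True r w_Suc_n length_js by (auto simp: nth_append)
    moreover have "i \<noteq> ent js r"
      using i_neq r unfolding True[symmetric] by simp
    ultimately have "ent (w (Suc (Suc r))) (r + 2) \<noteq> ent (w (Suc (Suc r))) r"
      by simp
    then have "?err = 0"
      unfolding braid_error_def by (simp only: simp_thms if_False)
    then show ?thesis using v by (simp add: lspan_zero)
  next
    case False
    then have "?v \<in> lspan (A r)" using r by (intro xs_in) auto
    moreover obtain c where "?err = scal c"
      using braid_error_scal by blast
    ultimately show ?thesis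
      using r lspan_scal[OF A_closed[OF r(1)], of ?v c] by simp
  qed
  have "act (psi r * psi (r + 1) * psi r) ?v = act (psi (r + 1) * psi r * psi (r + 1) + ?err) ?v"
    using r v psis err_words by (intro act_weight_relator[OF klr_relators.braid]) auto
  then have "act (psi r) (act (psi (Suc r)) (act (psi r) ?v)) = act (psi j) (xs r) \<oplus>\<^bsub>M\<^esub> act ?err ?v"
    using r v psis err_words j by (simp add: act_mult act_add xs_step)
  moreover have "act (psi r) ?v = \<zero>\<^bsub>M\<^esub>"
    using r by (intro psi_xs_small) auto
  ultimately have "act (psi j) (xs r) \<oplus>\<^bsub>M\<^esub> act ?err ?v = \<zero>\<^bsub>M\<^esub>"
    using psis by simp
  then have "act (psi j) (xs r) = act (scal (- 1)) (act ?err ?v)"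
    using v psis err_words j xs_closed[of r] r by (simp add: act_uminus M.minus_equality)
  then show ?case
    using lspan_scal[OF A_closed[OF r(1)] err] by simp
next
  case (step r)
  then have r: "1 \<le> r" "r \<le> n" and j: "Suc r < j" "j \<le> n" by auto
  have v: "xs (Suc r) \<in> carrier M" "(psi r :: 'f free) \<in> words_in e (Suc n)" "(psi j :: 'f free) \<in> words_in e (Suc n)"
    using r j by (auto intro!: xs_closed psi_words)
  have "act (psi j) (xs r) = act (psi j * psi r) (xs (Suc r))"
    using r v by (simp add: xs_step act_mult)
  also have "\<dots> = act (psi r * psi j) (xs (Suc r))"
    using r j by (intro act_relator klr_relators.psi_psi) auto
  also have "\<dots> = act (psi r) (act (psi j) (xs (Suc r)))"
    using v by (simp add: act_mult)
  also have "\<dots> \<in> lspan (A r)"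
    using step by (intro psi_lspan r) auto
  finally show ?case .
qed

text \<open>The critical case is \<open>j = r\<close>, where \<open>\<psi>\<^sub>r\<close> is
  squared. For \<open>r < n\<close> even the value 1 is harmless, since \<open>xs (Suc r)\<close>
  lies in the span. For \<open>r = n\<close> the two residues are neighbours, so the square is a
  difference of two \<open>y\<close> up to sign and produces no multiple of
  \<open>x\<close>.\<close>

lemma psi_xs:
  assumes r: "1 \<le> r" "r \<le> n" and j: "1 \<le> j" "j \<le> n"
  shows "act (psi j) (xs r) \<in> lspan (A 1)"
proof -
  consider "Suc j < r" | "r = Suc j" | "j = r" | "r < j" by linarith
  then show ?thesis
  proof cases
    case 1
    then show ?thesis using r j by (simp add: psi_xs_small lspan_zero)
  next
    case 2
    then show ?thesis using r j xs_step[of j] xs_in[of 1 j] by simp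
  next
    case 3
    let ?v = "xs (Suc r)" and ?sq = "psi_square e r (w (Suc r)) :: 'f free"
    have v: "?v \<in> carrier M" "act (ee (w (Suc r))) ?v = ?v" "w (Suc r) \<in> res_seqs e (Suc n)"
      using r xs_closed xs_idem w_in by auto
    have ys: "(psi r :: 'f free) \<in> words_in e (Suc n)" "(yy r :: 'f free) \<in> words_in e (Suc n)"
      "(yy (Suc r) :: 'f free) \<in> words_in e (Suc n)"
      using r by (auto intro!: y_words psi_words)
    have sq_words: "?sq \<in> words_in e (Suc n)"
      using ys by (simp add: psi_square_def)
    have y: "act (yy t) ?v \<in> lspan (A 1)" if "1 \<le> t" "t \<le> Suc n" for t
      using y_xs[of "Suc r" t] that r by (intro lspan_A_mono[of 1 "Suc r"]) auto
    have y_diff: "act (yy t - yy u) ?v \<in> lspan (A 1)" if "1 \<le> t" "t \<le> Suc n" "1 \<le> u" "u \<le> Suc n" for t u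
    proof -
      have "(yy t - yy u :: 'f free) = yy t + scal (- 1) * yy u"
        by (simp add: scal_one single_uminus)
      moreover have "act (yy t + scal (- 1) * yy u) ?v =
          act (yy t) ?v \<oplus>\<^bsub>M\<^esub> act (scal (- 1)) (act (yy u) ?v)"
        using that v y_words by (simp add: act_add act_mult)
      ultimately have "act (yy t - yy u) ?v = act (yy t) ?v \<oplus>\<^bsub>M\<^esub> act (scal (- 1)) (act (yy u) ?v)"
        by (simp only:)
      then show ?thesis
        using lspan_add[OF A_closed y lspan_scal[OF A_closed y]] that by simp
    qed
    have "act (psi j) (xs r) = act (psi r * psi r) ?v"
      using r ys v 3 by (simp add: xs_step act_mult)
    also have "\<dots> = act ?sq ?v"
      using r v ys sq_words by (intro act_weight_relator[OF klr_relators.psi_sq]) auto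
    also have "\<dots> \<in> lspan (A 1)"
    proof (cases "r = n")
      case True
      then show ?thesis
        using r v y_diff[of n "Suc n"] y_diff[of "Suc n" n] i_pred w_ent[OF r]
        by (auto simp: psi_square_def lspan_zero)
    next
      case False
      then show ?thesis
        using r v y_diff[of r "Suc r"] y_diff[of "Suc r" r] xs_in[of 1 "Suc r"]
        by (simp add: psi_square_def lspan_zero)
    qed
    finally show ?thesis .
  next
    case 4
    then show ?thesis using r j psi_xs_large[of r j] by (intro lspan_A_mono[of 1 r]) auto
  qed
qed

lemma idem_weight:
  assumes "1 \<le> r" "r \<le> Suc n" "ks \<in> res_seqs e (Suc n)"
  shows "act (ee ks) (xs r) = (if ks = w r then xs r else \<zero>\<^bsub>M\<^esub>)"
proof -
  have v: "xs r \<in> carrier M" "act (ee (w r)) (xs r) = xs r" "w r \<in> res_seqs e (Suc n)"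
    using assms xs_closed xs_idem w_in by auto
  have "act (ee ks) (xs r) = act (ee ks * ee (w r)) (xs r)"
    using v assms ee_words by (simp add: act_mult)
  also have "\<dots> = act (if ks = w r then ee ks else 0) (xs r)"
    using v assms by (intro act_relator klr_relators.idem)
  finally show ?thesis
    using v by simp
qed

lemma lspan_A_1_graded: "graded_submodule (klr_algebra e \<kappa> (Suc n)) M (lspan (A 1))"
proof (rule graded_submoduleI)
  show "submodule (lspan (A 1)) (klr_algebra e \<kappa> (Suc n)) M"
  proof (rule submoduleI)
    show "lspan (A 1) \<subseteq> carrier M"
      using lspan_closed[OF A_closed] by auto
    show "act (X g) v \<in> lspan (A 1)" if g: "g \<in> gens e (Suc n)" and v: "v \<in> lspan (A 1)" for g v
    proof (rule lspan_act[OF A_closed A_closed _ _ v])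
      fix a assume "a \<in> A 1"
      then obtain r where r: "1 \<le> r" "r \<le> n" "a = xs r" by (auto simp: A_def)
      show "act (X g) a \<in> lspan (A 1)"
      proof (cases g)
        case (E ks)
        then show ?thesis using r g idem_weight[of r ks] xs_in[of 1 r] by (simp add: lspan_zero)
      next
        case (Y s)
        then show ?thesis
          using r g y_xs[of r s] by (intro lspan_A_mono[of 1 r]) auto
      next
        case (Psi j)
        then show ?thesis using r g psi_xs[of r j] by simp
      qed
    qed (use g in \<open>auto intro: words_in_X\<close>)
  qed (auto intro: lspan_zero lspan_add[OF A_closed] lspan_scal[OF A_closed])
  fix P :: "'b \<Rightarrow> bool"
  assume P: "P \<zero>\<^bsub>M\<^esub>" "\<And>x y. x \<in> lspan (A 1) \<Longrightarrow> y \<in> lspan (A 1) \<Longrightarrow> P x \<Longrightarrow> P y \<Longrightarrow> P (x \<oplus>\<^bsub>M\<^esub> y)"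
    "\<And>x d. x \<in> lspan (A 1) \<Longrightarrow> x \<in> deg_part M d \<Longrightarrow> P x"
  show "\<forall>x\<in>lspan (A 1). P x"
  proof
    fix v assume "v \<in> lspan (A 1)"
    then show "P v"
    proof (induction rule: lspan.induct)
      case (lspan_step a v c)
      then obtain r where r: "1 \<le> r" "r \<le> n" "a = xs r" by (auto simp: A_def)
      then obtain d where "a \<in> deg_part M d" using xs_weight[of r] by auto
      then have "act (scal c) a \<in> deg_part M d" unfolding act_def by (rule deg_scal)
      moreover have "act (scal c) a \<in> lspan (A 1)"
        using lspan_step by (intro lspan_scal_gen[OF A_closed]) auto
      ultimately show ?case
        using P(2,3) lspan_step by blast
    qed (rule P(1))
  qed
qed

text \<open>By irreducibility the span is zero or everything. The idempotent of
  \<open>js @ [i]\<close> fixes \<open>x\<close> but kills each \<open>xs r\<close> with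
  \<open>r \<le> n\<close>, so \<open>x\<close> is not in the span; the span is zero, and it
  contains \<open>xs n\<close>.\<close>

lemma psi_n_x: "1 \<le> n \<Longrightarrow> act (psi n) x = \<zero>\<^bsub>M\<^esub>"
proof -
  assume n: "1 \<le> n"
  have "lspan (A 1) = {\<zero>\<^bsub>M\<^esub>} \<or> lspan (A 1) = carrier M"
    using irr lspan_A_1_graded unfolding irreducible_gmodule_def by blast
  moreover have "lspan (A 1) \<noteq> carrier M"
  proof
    assume "lspan (A 1) = carrier M"
    then have x: "x \<in> lspan (A 1)" using x_closed by simp
    have w: "js @ [i] \<in> res_seqs e (Suc n)" using w_in[of "Suc n"] by (simp add: w_Suc_n)
    \<comment> \<open>The span of the empty set is zero, so this says that the idempotent kills
      \<open>x\<close>, although it fixes \<open>x\<close>.\<close>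
    have "act (ee (js @ [i])) x \<in> lspan {}"
    proof (rule lspan_act[OF A_closed _ _ _ x])
      fix a assume "a \<in> A 1"
      then obtain r where r: "1 \<le> r" "r \<le> n" "a = xs r" by (auto simp: A_def)
      then show "act (ee (js @ [i])) a \<in> lspan {}"
        using idem_weight[of r "js @ [i]"] w w_neq[of r] lspan_zero by auto
    qed (use w ee_words in auto)
    then have "x \<in> lspan {}" using x_idem by simp
    then have "x = \<zero>\<^bsub>M\<^esub>" by (induction rule: lspan.induct) auto
    then show False using x_nz by simp
  qed
  ultimately have "xs n = \<zero>\<^bsub>M\<^esub>"
    using xs_in[of 1 n] n by auto
  then show ?thesis
    using xs_step[of n] n by (simp add: xs_Suc_n)
qed

lemma gen_x:
  assumes "g \<in> gens e (Suc n)"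
  shows "act (X g) x = act (scal (one_dim_char (js @ [i]) (X g))) x"
proof (cases g)
  case (E ks)
  then show ?thesis
    using idem_weight[of "Suc n" ks] assms x_closed by (auto simp: xs_Suc_n w_Suc_n)
next
  case (Y r)
  then show ?thesis using assms x_y[of r] x_closed by simp
next
  case (Psi r)
  then show ?thesis
    using assms x_psi[of r] psi_n_x x_closed by (cases "r = n") auto
qed

lemma act_x: "p \<in> words_in e (Suc n) \<Longrightarrow> act p x = act (scal (one_dim_char (js @ [i]) p)) x"
proof (induction p rule: free_induct)
  case (single u c)
  then show ?case
  proof (induction u)
    case (Cons g u)
    let ?u = "Poly_Mapping.single u c"
    have g: "g \<in> gens e (Suc n)" "(X g :: 'f free) \<in> words_in e (Suc n)" "?u \<in> words_in e (Suc n)"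
      using Cons.prems by (auto intro: words_in_X)
    have "act (Poly_Mapping.single (g # u) c) x = act (X g) (act (scal (one_dim_char (js @ [i]) ?u)) x)"
      unfolding single_Cons using Cons g x_closed by (simp add: act_mult)
    also have "\<dots> = act (scal (one_dim_char (js @ [i]) ?u)) (act (X g) x)"
      using g x_closed by (simp add: act_scal_commute)
    also have "\<dots> = act (scal (one_dim_char (js @ [i]) (X g * ?u))) x"
      unfolding gen_x[OF g(1)] one_dim_char_mult using x_closed by (simp only: act_scal_scal mult.commute)
    finally show ?case unfolding single_Cons .
  qed simp
next
  case (add p q)
  then show ?case using x_closed by (simp add: act_add scal_add)
qed (use x_closed in simp)

lemma carrier_line: "carrier M = line x"
proof -
  have "act (X g) x \<in> line x" if "g \<in> gens e (Suc n)" for g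
    unfolding gen_x[OF that] line_def by (rule rangeI)
  then have "graded_submodule (klr_algebra e \<kappa> (Suc n)) M (line x)"
    by (rule line_graded_submodule[OF x_deg])
  then have "line x = {\<zero>\<^bsub>M\<^esub>} \<or> line x = carrier M"
    using irr unfolding irreducible_gmodule_def by blast
  then show ?thesis
    using line_self[OF x_closed] x_nz by auto
qed

text \<open>Since \<open>carrier M\<close> is the line through \<open>x\<close>, the map that sends
  a scalar \<open>c\<close> to \<open>c\<close> times \<open>x\<close> is explicit; the isomorphism
  is built in this direction and then inverted.\<close>

lemma iso_one_dim:
  assumes char: "klr_char TYPE('f) e \<kappa> (Suc n) (js @ [i])"
  shows "gmodule_iso (klr_algebra e \<kappa> (Suc n)) M (one_dim_module (js @ [i]) k :: ('f, 'f) klr_gmodule)"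
proof (rule gmodule_iso_sym)
  let ?N = "one_dim_module (js @ [i]) k :: ('f, 'f) klr_gmodule"
  have N: "carrier ?N = UNIV" "c \<oplus>\<^bsub>?N\<^esub> c' = c + c'"
    "deg_part ?N d = (if d = k then UNIV else {0})" for c c' d
    by (simp_all add: one_dim_module_def)
  show "c \<oplus>\<^bsub>?N\<^esub> c' \<in> carrier ?N" "a \<odot>\<^bsub>?N\<^esub> c \<in> carrier ?N" "deg_part ?N d \<subseteq> carrier ?N" for a c c' d
    by (simp_all add: N)
  have inj: "c = c'" if "act (scal c) x = act (scal c') x" for c c'
  proof (rule ccontr)
    assume "c \<noteq> c'"
    have "act (scal (c - c')) x = act (scal c) x \<oplus>\<^bsub>M\<^esub> act (scal (- 1)) (act (scal c') x)"
      using x_closed scal_add[of c "- c'"] by (simp add: act_add[symmetric] act_scal_scal)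
    also have "\<dots> = \<zero>\<^bsub>M\<^esub>"
      using that x_closed by (simp add: act_uminus M.r_neg)
    finally have "act (scal (inverse (c - c'))) (act (scal (c - c')) x) = \<zero>\<^bsub>M\<^esub>" by simp
    then show False
      using act_scal_inverse[of "c - c'" x] \<open>c \<noteq> c'\<close> x_closed x_nz by simp
  qed
  show "gmodule_iso (klr_algebra e \<kappa> (Suc n)) ?N M"
    unfolding gmodule_iso_def
  proof (intro exI[of _ "\<lambda>c. act (scal c) x"] conjI ballI allI)
    show "bij_betw (\<lambda>c. act (scal c) x) (carrier ?N) (carrier M)"
      unfolding bij_betw_def N carrier_line line_def using inj by (auto intro: injI)
    show "act (scal (c \<oplus>\<^bsub>?N\<^esub> c')) x = act (scal c) x \<oplus>\<^bsub>M\<^esub> act (scal c') x" for c c'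
      unfolding N scal_add using x_closed by (simp add: act_add)
    show "act (scal (a \<odot>\<^bsub>?N\<^esub> c)) x = a \<odot>\<^bsub>M\<^esub> act (scal c) x"
      if "a \<in> carrier (klr_algebra e \<kappa> (Suc n))" for a c
    proof (rule klr_algebra_cases[OF that])
      fix p :: "'f free" assume p: "p \<in> words_in e (Suc n)" "a = klr_class e \<kappa> (Suc n) p"
      have "act p (act (scal c) x) = act (scal (one_dim_char (js @ [i]) p * c)) x"
        using p x_closed act_x[OF p(1)]
        by (simp only: act_scal_commute act_scal_scal mult.commute)
      then show ?thesis
        unfolding p(2) klr_char.one_dim_smult[OF char] act_def by simp
    qed
    show "(\<lambda>c. act (scal c) x) ` deg_part ?N d = deg_part M d" for d
    proof (cases "d = k")
      case True
      then show ?thesis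
        using line_deg[OF x_deg] deg_closed carrier_line unfolding N line_def by auto
    next
      case False
      have "y = \<zero>\<^bsub>M\<^esub>" if "y \<in> deg_part M d" for y
        using deg_disjoint[of y d k] that False line_deg[OF x_deg] deg_closed carrier_line by auto
      then have "deg_part M d = {\<zero>\<^bsub>M\<^esub>}"
        using deg_zero[of d] by blast
      then show ?thesis
        using False x_closed by (simp add: N)
    qed
  qed
qed

end

section \<open>Bipartitions and signatures\<close>

text \<open>Rows are counted from 1, as in nodes, and have length 0 beyond the end, so that the
  conditions for addable nodes compare neighbouring rows without regard to the number of
  rows.\<close>

definition row_len :: "nat list \<Rightarrow> nat \<Rightarrow> nat" where
  "row_len p i = (if 1 \<le> i \<and> i \<le> length p then p ! (i - 1) else 0)"

lemma mem_nodes: "(i, j, c) \<in> nodes \<mu> \<longleftrightarrow> c \<in> {1, 2} \<and> 1 \<le> i \<and> 1 \<le> j \<and> j \<le> row_len (component \<mu> c) i"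
  by (auto simp: nodes_def row_len_def)

lemma component_simps [simp]: "component (p, q) 1 = p" "component (p, q) (Suc 0) = p" "component (p, q) 2 = q"
  by (simp_all add: component_def)

lemma is_bipartition_component: "is_bipartition \<mu> \<Longrightarrow> is_partition (component \<mu> c)"
  by (simp add: is_bipartition_def component_def)

lemma row_len_Nil [simp]: "row_len [] i = 0"
  by (simp add: row_len_def)

lemma row_len_replicate: "row_len (replicate l 1) i = (if 1 \<le> i \<and> i \<le> l then 1 else 0)"
  by (cases i) (auto simp: row_len_def)

lemma row_len_pos:
  assumes "is_partition p" "1 \<le> i" "i \<le> length p"
  shows "1 \<le> row_len p i"
proof -
  have "p ! (i - 1) \<in> set p" using assms by (intro nth_mem) linarith
  then have "p ! (i - 1) \<noteq> 0" using assms(1) unfolding is_partition_def by metis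
  then show ?thesis using assms by (simp add: row_len_def)
qed

lemma row_len_antimono:
  assumes "is_partition p" "1 \<le> i" "i \<le> j"
  shows "row_len p j \<le> row_len p i"
proof (cases "i = j \<or> length p < j")
  case False
  then have "p ! (i - 1) \<ge> p ! (j - 1)"
    using assms by (intro sorted_wrt_nth_less[of "(\<ge>)"]) (auto simp: is_partition_def)
  then show ?thesis using assms False by (simp add: row_len_def)
qed (auto simp: row_len_def)

lemma partition_eqI:
  assumes p: "is_partition p" and q: "is_partition q" and eq: "\<And>i. 1 \<le> i \<Longrightarrow> row_len p i = row_len q i"
  shows "p = q"
proof (rule nth_equalityI)
  have "\<not> length p < length q"
    using eq[of "length q"] row_len_pos[OF q, of "length q"] by (auto simp: row_len_def split: if_splits)
  moreover have "\<not> length q < length p"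
    using eq[of "length p"] row_len_pos[OF p, of "length p"] by (auto simp: row_len_def split: if_splits)
  ultimately show len: "length p = length q" by simp
  fix i assume "i < length p"
  then show "p ! i = q ! i"
    using eq[of "Suc i"] len by (simp add: row_len_def)
qed

lemma ex_partition:
  assumes "\<And>i. 1 \<le> i \<Longrightarrow> f (Suc i) \<le> (f i :: nat)" and N: "f (Suc N) = 0"
  shows "\<exists>p. is_partition p \<and> (\<forall>i\<ge>1. row_len p i = f i)"
proof -
  \<comment> \<open>\<open>Suc L\<close> is the first row of length zero, so \<open>L\<close> is the
    number of parts.\<close>
  define L where "L = (LEAST L. f (Suc L) = 0)"
  have L: "f (Suc L) = 0" unfolding L_def by (rule LeastI[where P = "\<lambda>L. f (Suc L) = 0" and k = N, OF N])
  have less: "f (Suc i) \<noteq> 0" if "i < L" for i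
    using not_less_Least[of i] that unfolding L_def by auto
  have mono: "f j \<le> f i" if "1 \<le> i" "i \<le> j" for i j
    using that(2)
  proof (induction rule: dec_induct)
    case (step k)
    then show ?case using assms(1)[of k] that(1) by linarith
  qed simp
  let ?p = "map (\<lambda>i. f (Suc i)) [0..<L]"
  have "is_partition ?p"
    unfolding is_partition_def
  proof
    show "sorted_wrt (\<ge>) ?p" using mono by (auto simp: sorted_wrt_iff_nth_less)
    show "0 \<notin> set ?p"
    proof
      assume "0 \<in> set ?p"
      then obtain i where "i < L" "f (Suc i) = 0" by auto
      then show False using less by blast
    qed
  qed
  moreover have "row_len ?p i = f i" if "1 \<le> i" for i
  proof (cases "i \<le> L")
    case False
    then have "f i \<le> f (Suc L)" using mono[of "Suc L" i] by auto
    then show ?thesis using L False by (simp add: row_len_def)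
  next
    case True
    then have "i - 1 < L" using that by linarith
    then show ?thesis using that True by (simp add: row_len_def nth_upt)
  qed
  ultimately show ?thesis by blast
qed

lemma nodes_inj:
  assumes "is_bipartition \<mu>" "is_bipartition \<nu>" "nodes \<mu> = nodes \<nu>"
  shows "\<mu> = \<nu>"
proof -
  have "row_len (component \<mu> c) i = row_len (component \<nu> c) i" if "c \<in> {1, 2}" "1 \<le> i" for c i
  proof -
    have "j \<le> row_len (component \<mu> c) i \<longleftrightarrow> j \<le> row_len (component \<nu> c) i" if "1 \<le> j" for j
      using assms(3) mem_nodes[of i j c \<mu>] mem_nodes[of i j c \<nu>] that \<open>c \<in> {1, 2}\<close> \<open>1 \<le> i\<close> by auto
    then show ?thesis
      by (metis le_antisym le_refl less_one nle_le not_less)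
  qed
  then have "component \<mu> c = component \<nu> c" if "c \<in> {1, 2}" for c
    using that assms by (intro partition_eqI) (auto dest: is_bipartition_component)
  from this[of 1] this[of 2] show ?thesis
    by (simp add: component_def prod_eq_iff)
qed

text \<open>\<open>addable\<close> merely asserts that the enlarged set of nodes belongs to some
  bipartition. For the converse this bipartition is made from its row lengths by
  \<open>ex_partition\<close>.\<close>

lemma addable_iff:
  assumes \<mu>: "is_bipartition \<mu>"
  shows "addable \<mu> (i, j, c) \<longleftrightarrow> c \<in> {1, 2} \<and> 1 \<le> i \<and> j = Suc (row_len (component \<mu> c) i) \<and>
    (i = 1 \<or> row_len (component \<mu> c) i < row_len (component \<mu> c) (i - 1))"
proof
  assume "addable \<mu> (i, j, c)"
  then obtain \<nu> where \<nu>: "is_bipartition \<nu>" "(i, j, c) \<notin> nodes \<mu>" "nodes \<nu> = insert (i, j, c) (nodes \<mu>)"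
    by (auto simp: addable_def adds_to_def)
  have ij: "c \<in> {1, 2}" "1 \<le> i" "1 \<le> j" "j \<le> row_len (component \<nu> c) i"
    using \<nu>(3) mem_nodes[of i j c \<nu>] by auto
  have gt: "row_len (component \<mu> c) i < j"
    using \<nu>(2) ij mem_nodes[of i j c \<mu>] by auto
  have "j = Suc (row_len (component \<mu> c) i)"
  proof (rule ccontr)
    let ?j = "Suc (row_len (component \<mu> c) i)"
    assume "j \<noteq> ?j"
    then have "(i, ?j, c) \<in> nodes \<mu>"
      using \<nu>(3) mem_nodes[of i ?j c \<nu>] ij gt by auto
    then show False by (simp add: mem_nodes)
  qed
  moreover have "j \<le> row_len (component \<mu> c) (i - 1)" if "i \<noteq> 1"
  proof -
    have "j \<le> row_len (component \<nu> c) (i - 1)"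
      using row_len_antimono[OF is_bipartition_component[OF \<nu>(1)], of "i - 1" i c] ij that
      by (metis One_nat_def Suc_leI diff_le_self le_neq_implies_less le_trans zero_less_diff)
    then have "(i - 1, j, c) \<in> nodes \<nu>"
      using ij that by (auto simp: mem_nodes)
    then have "(i - 1, j, c) \<in> nodes \<mu>"
      using \<nu>(3) ij that by auto
    then show ?thesis by (simp add: mem_nodes)
  qed
  ultimately show "c \<in> {1, 2} \<and> 1 \<le> i \<and> j = Suc (row_len (component \<mu> c) i) \<and>
    (i = 1 \<or> row_len (component \<mu> c) i < row_len (component \<mu> c) (i - 1))"
    using ij gt by (cases "i = 1") auto
next
  assume r: "c \<in> {1, 2} \<and> 1 \<le> i \<and> j = Suc (row_len (component \<mu> c) i) \<and>
    (i = 1 \<or> row_len (component \<mu> c) i < row_len (component \<mu> c) (i - 1))"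
  let ?p = "component \<mu> c"
  have p: "is_partition ?p" by (rule is_bipartition_component[OF \<mu>])
  let ?f = "(row_len ?p)(i := j)"
  have "\<exists>p. is_partition p \<and> (\<forall>k\<ge>1. row_len p k = ?f k)"
  proof (rule ex_partition)
    show "?f (Suc k) \<le> ?f k" if "1 \<le> k" for k
      using that r row_len_antimono[OF p, of k "Suc k"] by auto
    \<comment> \<open>This row lies beyond the last row of the partition and beyond the changed row
      \<open>i\<close>.\<close>
    show "?f (Suc (length ?p + i)) = 0"
      by (simp add: row_len_def)
  qed
  then obtain q where q: "is_partition q" "\<And>k. 1 \<le> k \<Longrightarrow> row_len q k = ?f k" by blast
  define \<nu> where "\<nu> = (if c = 1 then (q, snd \<mu>) else (fst \<mu>, q))"
  have "is_bipartition \<nu>"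
    using q(1) \<mu> by (auto simp: \<nu>_def is_bipartition_def)
  moreover have "nodes \<nu> = insert (i, j, c) (nodes \<mu>)"
  proof (intro Set.set_eqI)
    fix x :: node
    obtain i' j' c' where x: "x = (i', j', c')" by (cases x)
    show "x \<in> nodes \<nu> \<longleftrightarrow> x \<in> insert (i, j, c) (nodes \<mu>)"
    proof (cases "c' = c")
      case True
      have "component \<nu> c = q" using r by (auto simp: \<nu>_def component_def)
      then show ?thesis
        using True r q(2)[of i'] by (cases "i' = i") (auto simp: x mem_nodes)
    next
      case False
      have "c' \<in> {1, 2} \<Longrightarrow> component \<nu> c' = component \<mu> c'"
        using False r by (auto simp: \<nu>_def component_def)
      then show ?thesis using False by (auto simp: x mem_nodes)
    qed
  qed
  moreover have "(i, j, c) \<notin> nodes \<mu>"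
    using r by (simp add: mem_nodes)
  ultimately show "addable \<mu> (i, j, c)"
    unfolding addable_def adds_to_def by blast
qed

lemma removableD:
  assumes "is_bipartition \<mu>" "removable \<mu> (i, j, c)"
  shows "c \<in> {1, 2}" "1 \<le> i" "1 \<le> j" "j = row_len (component \<mu> c) i"
    "row_len (component \<mu> c) (Suc i) < row_len (component \<mu> c) i"
proof -
  obtain \<nu> where \<nu>: "is_bipartition \<nu>" "(i, j, c) \<in> nodes \<mu>" "nodes \<nu> = nodes \<mu> - {(i, j, c)}"
    using assms(2) by (auto simp: removable_def)
  show ij: "c \<in> {1, 2}" "1 \<le> i" "1 \<le> j"
    using \<nu>(2) by (auto simp: mem_nodes)
  have le: "j \<le> row_len (component \<mu> c) i"
    using \<nu>(2) by (auto simp: mem_nodes)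
  have notin: "\<not> j \<le> row_len (component \<nu> c) i"
    using \<nu>(3) ij mem_nodes[of i j c \<nu>] by auto
  show j: "j = row_len (component \<mu> c) i"
  proof (rule ccontr)
    assume "j \<noteq> row_len (component \<mu> c) i"
    then have "(i, Suc j, c) \<in> nodes \<nu>"
      using \<nu>(3) le ij by (auto simp: mem_nodes)
    then show False using notin by (simp add: mem_nodes)
  qed
  show "row_len (component \<mu> c) (Suc i) < row_len (component \<mu> c) i"
  proof (rule ccontr)
    assume "\<not> row_len (component \<mu> c) (Suc i) < row_len (component \<mu> c) i"
    then have "(Suc i, j, c) \<in> nodes \<nu>"
      using \<nu>(3) ij j by (auto simp: mem_nodes)
    then have "j \<le> row_len (component \<nu> c) (Suc i)" by (simp add: mem_nodes)
    also have "\<dots> \<le> row_len (component \<nu> c) i"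
      using ij by (intro row_len_antimono is_bipartition_component \<nu>(1)) auto
    finally show False using notin by simp
  qed
qed

lemma adds_to_unique: "adds_to \<mu> A \<nu> \<Longrightarrow> adds_to \<mu> A \<nu>' \<Longrightarrow> \<nu> = \<nu>'"
  unfolding adds_to_def by (auto intro: nodes_inj)

lemma adds_to_unique_left:
  assumes "adds_to \<mu> A \<nu>" "adds_to \<mu>' A \<nu>" "is_bipartition \<mu>" "is_bipartition \<mu>'"
  shows "\<mu> = \<mu>'"
proof (rule nodes_inj[OF assms(3,4)])
  have "nodes \<mu> = nodes \<nu> - {A}"
    using assms(1) unfolding adds_to_def by (metis Diff_insert_absorb)
  moreover have "nodes \<mu>' = nodes \<nu> - {A}"
    using assms(2) unfolding adds_to_def by (metis Diff_insert_absorb)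
  ultimately show "nodes \<mu> = nodes \<mu>'" by simp
qed

section \<open>Existence and uniqueness of the signature\<close>

lemma above_asym: "above A B \<Longrightarrow> \<not> above B A"
  by (auto simp: above_def split: prod.splits)

lemma above_irrefl: "\<not> above A A"
  using above_asym[of A A] by blast

lemma sorted_wrt_unique:
  assumes "sorted_wrt P xs" "sorted_wrt P ys" "set xs = set ys" "\<And>x y. P x y \<Longrightarrow> \<not> P y x"
  shows "xs = ys"
  using assms(1-3)
proof (induction xs arbitrary: ys)
  case (Cons x xs)
  then obtain y zs where ys: "ys = y # zs" by (cases ys) auto
  have xy: "x = y"
  proof (rule ccontr)
    assume "x \<noteq> y"
    then have "x \<in> set zs" "y \<in> set xs"
      using Cons.prems(3) ys by auto
    then show False using Cons.prems ys assms(4)[of x y] by auto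
  qed
  have "x \<notin> set xs" "y \<notin> set zs"
    using Cons.prems(1,2) ys assms(4)[of x x] assms(4)[of y y] by auto
  then have "set xs = set zs"
    using Cons.prems(3) ys xy by (auto simp: insert_eq_iff)
  then show ?case
    using Cons.IH[of zs] Cons.prems ys xy by auto
qed simp

lemma ex_sorted_list:
  assumes "finite S" "inj_on k S"
  shows "\<exists>xs. set xs = S \<and> sorted_wrt (\<lambda>x y. k x < (k y :: nat)) xs"
proof (intro exI conjI)
  let ?xs = "map (inv_into S k) (sorted_list_of_set (k ` S))"
  show "set ?xs = S"
    using assms by (force simp: image_image)
  have "sorted_wrt (\<lambda>x y. k (inv_into S k x) < k (inv_into S k y)) (sorted_list_of_set (k ` S))"
    by (rule sorted_wrt_mono_rel[OF _ strict_sorted_list_of_set]) (use assms in \<open>auto simp: f_inv_into_f\<close>)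
  then show "sorted_wrt (\<lambda>x y. k x < k y) ?xs"
    by (simp add: sorted_wrt_map)
qed

definition sig_set :: "nat \<Rightarrow> (nat \<Rightarrow> int) \<Rightarrow> int \<Rightarrow> bipartition \<Rightarrow> (bool \<times> node) set" where
  "sig_set e \<kappa> i \<mu> = {(True, A) | A. addable \<mu> A \<and> res e \<kappa> A = i} \<union>
    {(False, A) | A. removable \<mu> A \<and> res e \<kappa> A = i}"

lemma sig_set_iff [simp]:
  "(True, A) \<in> sig_set e \<kappa> i \<mu> \<longleftrightarrow> addable \<mu> A \<and> res e \<kappa> A = i"
  "(False, A) \<in> sig_set e \<kappa> i \<mu> \<longleftrightarrow> removable \<mu> A \<and> res e \<kappa> A = i"
  unfolding sig_set_def by blast+

lemma res_eq_iff: "res e \<kappa> (i, j, c) = res e \<kappa> (i', j', c') \<longleftrightarrow>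
    int e dvd (\<kappa> c + int j - int i) - (\<kappa> c' + int j' - int i')"
  by (simp add: res_def mod_eq_dvd_iff)

text \<open>The signed nodes are sorted by the key \<open>c * N + r\<close>, which orders them as
  \<open>above\<close> does because all row indices are below \<open>N\<close>. The key is
  injective: candidates in one row lie in columns that differ by at most 1, so equal residues and
  \<open>e \<ge> 2\<close> force equal columns, and the column determines the sign. Uniqueness is
  \<open>sorted_wrt_unique\<close>.\<close>

lemma signature_props:
  assumes \<mu>: "is_bipartition \<mu>" and e: "e \<ge> 2"
  shows "sorted_wrt (\<lambda>x y. above (snd x) (snd y)) (signature e \<kappa> i \<mu>)"
    and "set (signature e \<kappa> i \<mu>) = sig_set e \<kappa> i \<mu>"
proof -
  \<comment> \<open>An addable node lies at most one row below the last, so every row index that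
    occurs is smaller than \<open>N\<close>.\<close>
  define N where "N = length (fst \<mu>) + length (snd \<mu>) + 2"
  let ?S = "sig_set e \<kappa> i \<mu>"
  have bounds: "c \<in> {1, 2} \<and> 1 \<le> r \<and> r < N \<and> j \<in> {row_len (component \<mu> c) r, Suc (row_len (component \<mu> c) r)}
      \<and> (j = Suc (row_len (component \<mu> c) r) \<longleftrightarrow> b)"
    if "(b, (r, j, c)) \<in> ?S" for b r j c
  proof (cases b)
    case True
    then have a: "c \<in> {1, 2}" "1 \<le> r" "j = Suc (row_len (component \<mu> c) r)"
      "r = 1 \<or> row_len (component \<mu> c) r < row_len (component \<mu> c) (r - 1)"
      using that addable_iff[OF \<mu>] by auto
    then have "r = 1 \<or> r - 1 \<le> length (component \<mu> c)"
      by (auto simp: row_len_def split: if_splits)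
    then have "r < N" by (auto simp: N_def component_def split: if_splits)
    then show ?thesis using a True by auto
  next
    case False
    then have a: "c \<in> {1, 2}" "1 \<le> r" "1 \<le> j" "j = row_len (component \<mu> c) r"
      using that removableD[OF \<mu>, of r j c] by auto
    then have "r \<le> length (component \<mu> c)"
      by (auto simp: row_len_def split: if_splits)
    then have "r < N" by (auto simp: N_def component_def split: if_splits)
    then show ?thesis using a False by auto
  qed
  define k :: "bool \<times> node \<Rightarrow> nat" where "k = (\<lambda>(b, (r, j, c)). c * N + r)"
  have k_less: "above (snd x) (snd y)" if x: "x \<in> ?S" and y: "y \<in> ?S" and less: "k x < k y" for x y
  proof -
    obtain b r j c b' r' j' c' where xy: "x = (b, (r, j, c))" "y = (b', (r', j', c'))"
      by (metis prod.exhaust)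
    have "r < N" "r' < N" "c \<in> {1, 2}" "c' \<in> {1, 2}"
      using bounds x y xy by blast+
    then show ?thesis using less by (auto simp: k_def xy above_def)
  qed
  have "inj_on k ?S"
  proof (rule inj_onI)
    fix x y assume x: "x \<in> ?S" and y: "y \<in> ?S" and eq: "k x = k y"
    obtain b r j c b' r' j' c' where xy: "x = (b, (r, j, c))" "y = (b', (r', j', c'))"
      by (metis prod.exhaust)
    have bx: "r < N" "r' < N" "c \<in> {1, 2}" "c' \<in> {1, 2}"
      using bounds x y xy by blast+
    then have cr: "c = c'" "r = r'" using eq by (auto simp: k_def xy)
    have "res e \<kappa> (r, j, c) = res e \<kappa> (r', j', c')"
      using x y unfolding xy by (cases b; cases b') auto
    then have dvd: "int e dvd int j - int j'"
      unfolding res_eq_iff cr by (simp add: algebra_simps)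
    have jj: "j \<in> {row_len (component \<mu> c) r, Suc (row_len (component \<mu> c) r)}"
      "j' \<in> {row_len (component \<mu> c) r, Suc (row_len (component \<mu> c) r)}"
      using bounds x y xy cr by blast+
    have "j = j'"
    proof (rule ccontr)
      assume "j \<noteq> j'"
      then have "int j - int j' = 1 \<or> int j - int j' = - 1" using jj by auto
      then show False using dvd e by auto
    qed
    moreover have "b = b'" using bounds[of b r j c] bounds[of b' r' j' c'] x y xy cr \<open>j = j'\<close> by auto
    ultimately show "x = y" using xy cr by simp
  qed
  moreover have "finite ?S"
  proof (rule finite_imageD[OF _ \<open>inj_on k ?S\<close>])
    have "k x \<le> 3 * N" if "x \<in> ?S" for x
    proof -
      obtain b r j c where x: "x = (b, (r, j, c))" by (metis prod.exhaust)
      then have "r < N" "c \<in> {1, 2}" using bounds that by blast+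
      then show ?thesis by (auto simp: k_def x)
    qed
    then have "k ` ?S \<subseteq> {..3 * N}" by auto
    then show "finite (k ` ?S)" by (rule finite_subset) simp
  qed
  ultimately obtain xs where xs: "set xs = ?S" "sorted_wrt (\<lambda>x y. k x < k y) xs"
    using ex_sorted_list by blast
  have sorted: "sorted_wrt (\<lambda>x y. above (snd x) (snd y)) xs"
    by (rule sorted_wrt_mono_rel[OF _ xs(2)]) (use k_less xs(1) in auto)
  have "signature e \<kappa> i \<mu> = xs"
    unfolding signature_def sig_set_def[symmetric]
    by (rule the_equality) (use sorted xs(1) above_asym in \<open>auto intro: sorted_wrt_unique\<close>)
  then show "sorted_wrt (\<lambda>x y. above (snd x) (snd y)) (signature e \<kappa> i \<mu>)"
    and "set (signature e \<kappa> i \<mu>) = sig_set e \<kappa> i \<mu>"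
    using sorted xs(1) by auto
qed

section \<open>Cancellation and the arrow\<close>

lemma distinct_sorted: "sorted_wrt (\<lambda>x y. above (snd x) (snd y)) xs \<Longrightarrow> distinct xs"
  by (induction xs) (use above_irrefl in auto)

lemma cancel_set: "cancel\<^sup>*\<^sup>* xs ys \<Longrightarrow> set ys \<subseteq> set xs \<and> (distinct xs \<longrightarrow> distinct ys)"
  by (induction rule: rtranclp_induct) (auto elim!: cancel.cases)

text \<open>This locates a marked entry \<open>x\<close> relative to the cancelled pair: to its
  right, its second element, its first element, or to its left.\<close>

lemma append_pair_eq_cases:
  assumes "p @ [a, b] @ q = us @ [x] @ zs"
  obtains us' where "us = p @ [a, b] @ us'" "q = us' @ [x] @ zs"
    | "us = p @ [a]" "b = x" "q = zs"
    | "us = p" "a = x" "zs = b # q"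
    | p' where "p = us @ [x] @ p'" "zs = p' @ [a, b] @ q"
  using assms by (auto simp: append_eq_append_conv2 Cons_eq_append_conv append_eq_Cons_conv)

text \<open>A minus sign cancels only against the plus directly before it. If nothing but plus signs
  stand between \<open>B\<close> and \<open>A\<close>, then \<open>B\<close> cannot be cancelled
  while \<open>A\<close> is present. The invariant \<open>Q\<close> says that \<open>A\<close> is
  gone or that this configuration persists.\<close>

lemma cancel_keeps:
  assumes "cancel\<^sup>*\<^sup>* xs zs" "distinct xs" "xs = us @ [(True, B)] @ vs @ [(True, A)] @ ws"
    "\<forall>x \<in> set vs. fst x" "(True, A) \<in> set zs"
  shows "(True, B) \<in> set zs"
proof -
  define Q where "Q zs \<longleftrightarrow> (True, A) \<notin> set zs \<or> (\<exists>us vs ws. zs = us @ [(True, B)] @ vs @ [(True, A)] @ ws \<and>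
    (\<forall>x \<in> set vs. fst x))" for zs
  have "Q zs \<and> distinct zs"
    using assms(1)
  proof (induction rule: rtranclp_induct)
    case base
    then show ?case using assms unfolding Q_def by blast
  next
    case (step y z)
    then have y: "Q y" "distinct y" by auto
    obtain p C D q where yz: "y = p @ [(True, C), (False, D)] @ q" "z = p @ q"
      using step(2) by (auto elim: cancel.cases)
    have dz: "distinct z" using y(2) yz by auto
    have "Q z"
    proof (cases "(True, A) \<in> set z")
      case False
      then show ?thesis by (simp add: Q_def)
    next
      case True
      then have "(True, A) \<in> set y" using yz by auto
      then obtain us vs ws where uvw: "y = us @ [(True, B)] @ vs @ [(True, A)] @ ws" "\<forall>x \<in> set vs. fst x"
        using y(1) unfolding Q_def by blast
      then have "p @ [(True, C), (False, D)] @ q = us @ [(True, B)] @ (vs @ [(True, A)] @ ws)"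
        using yz by simp
      then show ?thesis
      proof (cases rule: append_pair_eq_cases)
        case (1 us')
        then have "z = (p @ us') @ [(True, B)] @ vs @ [(True, A)] @ ws" using yz by simp
        then show ?thesis using uvw(2) unfolding Q_def by blast
      next
        case 3
        then show ?thesis using uvw(2) by (cases vs) auto
      next
        case (4 p')
        from 4(2)[symmetric] show ?thesis
        proof (cases rule: append_pair_eq_cases)
          case (1 us')
          then show ?thesis using uvw(2) by auto
        next
          case 3
          then show ?thesis using True y(2) yz by auto
        next
          case (4 p'')
          then have "z = us @ [(True, B)] @ vs @ [(True, A)] @ (p'' @ q)"
            using yz \<open>p = us @ [(True, B)] @ p'\<close> by simp
          then show ?thesis using uvw(2) unfolding Q_def by blast
        qed auto
      qed auto
    qed
    then show ?case using dz by simp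
  qed
  then show ?thesis using assms(5) unfolding Q_def by auto
qed

text \<open>An addable \<open>i\<close>-node \<open>B\<close> above the added node \<open>A\<close>
  must be separated from it by a removable \<open>i\<close>-node: otherwise \<open>B\<close> would
  survive the cancellation together with \<open>A\<close> and be a higher conormal node. This is the
  obstruction by which wrong predecessors are excluded.\<close>

lemma up_arrow_highest:
  assumes up: "up_arrow e \<kappa> i \<mu> \<nu>" and \<mu>: "is_bipartition \<mu>" and e: "e \<ge> 2"
  obtains A where "adds_to \<mu> A \<nu>" "res e \<kappa> A = i"
    "\<And>B. addable \<mu> B \<Longrightarrow> res e \<kappa> B = i \<Longrightarrow> above B A \<Longrightarrow>
      \<exists>D. removable \<mu> D \<and> res e \<kappa> D = i \<and> above B D \<and> above D A"
proof -
  obtain A where A: "conormal e \<kappa> i \<mu> A" "\<And>B. conormal e \<kappa> i \<mu> B \<Longrightarrow> B = A \<or> above A B" "adds_to \<mu> A \<nu>"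
    using up unfolding up_arrow_def by blast
  let ?xs = "signature e \<kappa> i \<mu>"
  note sig = signature_props[OF \<mu> e, of \<kappa> i]
  obtain zs where zs: "cancel\<^sup>*\<^sup>* ?xs zs" "\<nexists>ys. cancel zs ys" "(True, A) \<in> set zs"
    using A(1) unfolding conormal_def by blast
  have A_in: "(True, A) \<in> set ?xs" using cancel_set[OF zs(1)] zs(3) by auto
  then have res: "res e \<kappa> A = i" unfolding sig(2) by simp
  have "\<exists>D. removable \<mu> D \<and> res e \<kappa> D = i \<and> above B D \<and> above D A"
    if B: "addable \<mu> B" "res e \<kappa> B = i" "above B A" for B
  proof (rule ccontr)
    assume none: "\<not> ?thesis"
    have "(True, B) \<in> set ?xs" unfolding sig(2) using B by simp
    then obtain us ts where us: "?xs = us @ (True, B) # ts" by (meson split_list)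
    have "(True, A) \<in> set ts"
      using A_in sig(1) above_asym[OF B(3)] above_irrefl[of A] B(3) unfolding us
      by (auto simp: sorted_wrt_append)
    then obtain vs ws where ts: "ts = vs @ (True, A) # ws" by (meson split_list)
    have "fst x" if "x \<in> set vs" for x
    proof (rule ccontr)
      assume "\<not> fst x"
      then obtain D where x: "x = (False, D)" by (cases x) auto
      have "x \<in> set ?xs" using that us ts by auto
      then have "removable \<mu> D \<and> res e \<kappa> D = i" unfolding sig(2) x by simp
      moreover have "above B (snd x)" "above (snd x) A"
        using sig(1) that unfolding us ts by (auto simp: sorted_wrt_append)
      then have "above B D" "above D A" by (simp_all add: x)
      ultimately show False using none by blast
    qed
    then have "(True, B) \<in> set zs"
      using us ts zs distinct_sorted[OF sig(1)] by (intro cancel_keeps[of ?xs zs us B vs A ws]) auto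
    then have "conormal e \<kappa> i \<mu> B"
      using zs unfolding conormal_def by blast
    then show False using A(2) B(3) above_asym[of B A] above_asym[of A A] by blast
  qed
  then show ?thesis using that A(3) res by blast
qed

lemma up_arrow_unique:
  assumes "up_arrow e \<kappa> i \<mu> \<nu>" "up_arrow e \<kappa> i \<mu> \<nu>'"
  shows "\<nu> = \<nu>'"
proof -
  obtain A where A: "conormal e \<kappa> i \<mu> A" "\<And>B. conormal e \<kappa> i \<mu> B \<Longrightarrow> B = A \<or> above A B" "adds_to \<mu> A \<nu>"
    using assms(1) unfolding up_arrow_def by blast
  obtain A' where A': "conormal e \<kappa> i \<mu> A'" "\<And>B. conormal e \<kappa> i \<mu> B \<Longrightarrow> B = A' \<or> above A' B" "adds_to \<mu> A' \<nu>'"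
    using assms(2) unfolding up_arrow_def by blast
  have "A = A'" using A(1,2) A'(1,2) above_asym by blast
  then show ?thesis using A(3) A'(3) adds_to_unique by blast
qed

text \<open>The topmost sign is the plus of \<open>C\<close>, and there is at most one minus, that
  of \<open>D0\<close>. Another plus stands between \<open>C\<close> and this minus, so the
  cancellation uses up a plus other than \<open>C\<close>, and \<open>C\<close> remains as the
  highest conormal node.\<close>

lemma up_arrowI:
  assumes \<mu>: "is_bipartition \<mu>" and e: "e \<ge> 2" and C: "adds_to \<mu> C \<nu>" "res e \<kappa> C = i"
    and top: "\<And>B. addable \<mu> B \<Longrightarrow> res e \<kappa> B = i \<Longrightarrow> B = C \<or> above C B"
    and rem: "\<And>D. removable \<mu> D \<Longrightarrow> res e \<kappa> D = i \<Longrightarrow>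
      D = D0 \<and> above C D \<and> (\<exists>B. addable \<mu> B \<and> res e \<kappa> B = i \<and> B \<noteq> C \<and> above B D)"
  shows "up_arrow e \<kappa> i \<mu> \<nu>"
proof -
  let ?xs = "signature e \<kappa> i \<mu>"
  note sig = signature_props[OF \<mu> e, of \<kappa> i]
  have C_in: "(True, C) \<in> set ?xs"
    unfolding sig(2) sig_set_iff addable_def using C by blast
  have top': "x = (True, C) \<or> above C (snd x)" if "x \<in> set ?xs" for x
    using that top rem unfolding sig(2) by (cases x; cases "fst x") auto
  obtain ys where ys: "?xs = (True, C) # ys"
  proof (cases ?xs)
    case (Cons h t)
    have "h = (True, C)"
    proof (rule ccontr)
      assume h: "h \<noteq> (True, C)"
      then have "(True, C) \<in> set t" using C_in Cons by auto
      then have "above (snd h) C" using sig(1) Cons by auto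
      then show False using top'[of h] h Cons above_asym by auto
    qed
    then show ?thesis using that Cons by simp
  qed (use C_in in simp)
  have distinct: "distinct ?xs" by (rule distinct_sorted[OF sig(1)])
  have normal: "\<nexists>ws. cancel zs ws" if "\<And>x. x \<in> set zs \<Longrightarrow> fst x" for zs
  proof
    assume "\<exists>ws. cancel zs ws"
    then obtain ws where "cancel zs ws" by blast
    then show False
    proof cases
      case (1 us A B vs)
      then show ?thesis using that[of "(False, B)"] by simp
    qed
  qed
  have "\<exists>zs. cancel\<^sup>*\<^sup>* ?xs zs \<and> (\<nexists>ws. cancel zs ws) \<and> (True, C) \<in> set zs"
  proof (cases "\<exists>D. (False, D) \<in> set ys")
    case False
    then have "fst x" if "x \<in> set ?xs" for x
      using that ys by (cases x; cases "fst x") auto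
    then show ?thesis using normal[of ?xs] C_in by blast
  next
    case True
    then obtain D where D: "(False, D) \<in> set ys" by blast
    then have "(False, D) \<in> set ?xs" using ys by simp
    then have D_rem: "removable \<mu> D" "res e \<kappa> D = i" unfolding sig(2) by auto
    obtain us vs where uv: "ys = us @ (False, D) # vs" using D by (meson split_list)
    have plus: "fst x" if "x \<in> set us \<union> set vs" for x
    proof (rule ccontr)
      assume "\<not> fst x"
      then obtain D' where x: "x = (False, D')" by (cases x) auto
      then have "(False, D') \<in> set ?xs" using that ys uv by auto
      then have "removable \<mu> D'" "res e \<kappa> D' = i" unfolding sig(2) by auto
      then have "D' = D" using rem D_rem by blast
      then show False using distinct ys uv x that by auto
    qed
    obtain B where B: "addable \<mu> B" "res e \<kappa> B = i" "B \<noteq> C" "above B D" using rem[OF D_rem] by blast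
    then have "(True, B) \<in> set ?xs" unfolding sig(2) by simp
    then have "(True, B) \<in> set us \<union> set vs" using ys uv B(3) by auto
    moreover have "(True, B) \<notin> set vs"
    proof
      assume "(True, B) \<in> set vs"
      then have "above D B"
        using sig(1) unfolding ys uv by (auto simp: sorted_wrt_append)
      then show False using above_asym[OF B(4)] by blast
    qed
    \<comment> \<open>The plus of \<open>B\<close> lies before the minus of \<open>D\<close>; hence
      the entry directly before that minus comes after \<open>C\<close>.\<close>
    ultimately have "us \<noteq> []" by auto
    then obtain us' a where us: "us = us' @ [a]" by (metis rev_exhaust)
    have "fst a" using plus us by auto
    then have a: "a = (True, snd a)" by (metis prod.collapse)
    have "?xs = ((True, C) # us') @ [(True, snd a), (False, D)] @ vs"
      using ys uv us a by simp
    then have "cancel ?xs (((True, C) # us') @ vs)"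
      using cancel.intros[of "(True, C) # us'" "snd a" D vs] by simp
    moreover have "\<nexists>ws. cancel (((True, C) # us') @ vs) ws"
      by (rule normal) (use plus us in auto)
    ultimately show ?thesis
      by (intro exI[of _ "((True, C) # us') @ vs"] conjI) auto
  qed
  then have "conormal e \<kappa> i \<mu> C" unfolding conormal_def by blast
  moreover have "B = C \<or> above C B" if "conormal e \<kappa> i \<mu> B" for B
  proof -
    have "(True, B) \<in> set ?xs"
      using that cancel_set unfolding conormal_def by blast
    then show ?thesis using top' by fastforce
  qed
  ultimately show ?thesis using C(1) unfolding up_arrow_def by blast
qed

section \<open>The bipartitions \<open>(\<emptyset>, (1\<^sup>n))\<^sup>R\<close>\<close>

text \<open>In a decreasing list the zeros stand at the end, so deleting them shifts no row.\<close>

lemma row_len_filter: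
  "sorted_wrt (\<ge>) xs \<Longrightarrow> row_len (filter (\<lambda>x. x \<noteq> 0) xs) i = row_len xs i"
proof (induction xs arbitrary: i)
  case (Cons x xs)
  have Cons_row: "row_len (y # ys) i = (if i = 1 then y else row_len ys (i - 1))" for y ys i
    by (cases i; cases "i - 1") (auto simp: row_len_def)
  show ?case
  proof (cases "x = 0")
    case True
    then have all_zero: "\<forall>y \<in> set (x # xs). y = 0" using Cons.prems by auto
    have "row_len (x # xs) i = 0"
    proof (cases "1 \<le> i \<and> i \<le> length (x # xs)")
      case True
      then have "(x # xs) ! (i - 1) \<in> set (x # xs)" by (intro nth_mem) linarith
      then have "(x # xs) ! (i - 1) = 0" using all_zero by blast
      then show ?thesis by (simp only: row_len_def if_cancel)
    qed (simp only: row_len_def if_False)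
    moreover have "filter (\<lambda>x. x \<noteq> 0) (x # xs) = []"
      unfolding filter_empty_conv not_not by (rule all_zero)
    ultimately show ?thesis by (simp only: row_len_Nil)
  next
    case False
    then show ?thesis using Cons by (simp add: Cons_row)
  qed
qed simp

lemma braces_list_sorted: "sorted_wrt (\<ge>) (map (\<lambda>t. (a + t) div m) (rev [0..<k]))" for m :: nat
proof -
  have "sorted_wrt (\<lambda>x y. (a + x) div m \<ge> (a + y) div m) (rev [0..<k])"
    by (auto simp: sorted_wrt_iff_nth_less rev_nth intro!: div_le_mono)
  then show ?thesis by (simp add: sorted_wrt_map)
qed

lemma braces_partition: "is_partition (braces e a)"
  unfolding braces_def is_partition_def by (auto intro!: sorted_wrt_filter braces_list_sorted)

lemma row_len_braces:
  assumes "a = q * (e - 1) + s" "s \<le> e - 1"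
  shows "row_len (braces e a) r = (if 1 \<le> r \<and> r \<le> e - 1 then q + (if r \<le> s then 1 else 0) else 0)"
proof -
  define m where "m = e - 1"
  note a = assms[folded m_def]
  have "row_len (braces e a) r = row_len (map (\<lambda>t. (a + t) div m) (rev [0..<m])) r"
    unfolding braces_def m_def by (rule row_len_filter[OF braces_list_sorted])
  also have "\<dots> = (if 1 \<le> r \<and> r \<le> m then (a + (m - r)) div m else 0)"
    by (auto simp: row_len_def rev_nth)
  also have "\<dots> = (if 1 \<le> r \<and> r \<le> m then q + (if r \<le> s then 1 else 0) else 0)"
  proof (cases "1 \<le> r \<and> r \<le> m")
    case r: True
    show ?thesis
    proof (cases "r \<le> s")
      case True
      then have "a + (m - r) = (s - r) + (q + 1) * m" "s - r < m"
        using a r by (auto simp: algebra_simps)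
      then have "(a + (m - r)) div m = (q + 1) + (s - r) div m"
        by (simp only: div_mult_self1[of m "s - r" "q + 1"])
      then have "(a + (m - r)) div m = q + 1" using \<open>s - r < m\<close> by simp
      then show ?thesis using True r by simp
    next
      case False
      then have "a + (m - r) = (m - (r - s)) + q * m" "m - (r - s) < m"
        using a r by (auto simp: algebra_simps)
      then have "(a + (m - r)) div m = q" by simp
      then show ?thesis using False r by simp
    qed
  qed auto
  finally show ?thesis unfolding m_def .
qed

lemma sum_list_filter_nonzero: "sum_list (filter (\<lambda>x. x \<noteq> 0) xs) = sum_list (xs :: nat list)"
  by (induction xs) auto

text \<open>This is Hermite's identity. Raising \<open>a\<close> by one shifts the range of
  summation, which trades \<open>a div (e - 1)\<close> for \<open>(a + (e - 1)) div (e - 1)\<close>,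
  larger by exactly 1.\<close>

lemma sum_list_braces:
  assumes "e \<ge> 2"
  shows "sum_list (braces e a) = a"
proof -
  let ?m = "e - 1"
  have "sum_list (braces e a) = sum_list (map (\<lambda>t. (a + t) div ?m) (rev [0..<?m]))"
    by (simp only: braces_def sum_list_filter_nonzero)
  also have "\<dots> = (\<Sum>t<?m. (a + t) div ?m)"
    by (simp add: rev_map[symmetric] sum_list_rev interv_sum_list_conv_sum_set_nat atLeast0LessThan)
  also have "\<dots> = a"
  proof (induction a)
    case (Suc a)
    have "(\<Sum>t<?m. (Suc a + t) div ?m) + a div ?m = (\<Sum>t<Suc ?m. (a + t) div ?m)"
      by (subst sum.lessThan_Suc_shift) simp
    also have "\<dots> = a + (a + ?m) div ?m"
      using Suc by simp
    also have "(a + ?m) div ?m = Suc (a div ?m)"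
    proof -
      have "?m \<noteq> 0" using assms by simp
      then have "(a + ?m) div ?m = a div ?m + 1" by (rule div_add_self2)
      then show ?thesis by simp
    qed
    finally show ?case by simp
  qed simp
  finally show ?thesis .
qed

lemma adds_to_row_len:
  assumes \<mu>: "is_bipartition \<mu>" and adds: "adds_to \<mu> (r, j, c) \<nu>" and c': "c' \<in> {1, 2}" "1 \<le> r'"
  shows "row_len (component \<nu> c') r' = row_len (component \<mu> c') r' + (if c' = c \<and> r' = r then 1 else 0)"
proof -
  have "addable \<mu> (r, j, c)" using adds unfolding addable_def by blast
  then have j: "j = Suc (row_len (component \<mu> c) r)" using addable_iff[OF \<mu>] by blast
  have "nodes \<nu> = insert (r, j, c) (nodes \<mu>)" using adds by (simp add: adds_to_def)
  then have iff: "j' \<le> row_len (component \<nu> c') r' \<longleftrightarrow>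
      (r', j', c') = (r, j, c) \<or> j' \<le> row_len (component \<mu> c') r'" if "1 \<le> j'" for j'
    using mem_nodes[of r' j' c' \<nu>] mem_nodes[of r' j' c' \<mu>] c' that by auto
  have le_iff: "x = y" if "\<And>j. 1 \<le> j \<Longrightarrow> j \<le> x \<longleftrightarrow> j \<le> y" for x y :: nat
    using that[of x] that[of y] by (cases x; cases y) auto
  show ?thesis
  proof (cases "c' = c \<and> r' = r")
    case True
    have "j' \<le> row_len (component \<nu> c') r' \<longleftrightarrow> j' \<le> Suc (row_len (component \<mu> c') r')" if "1 \<le> j'" for j'
      unfolding iff[OF that] using True j by auto
    then have "row_len (component \<nu> c') r' = Suc (row_len (component \<mu> c') r')"
      by (rule le_iff)
    then show ?thesis using True by simp
  next
    case False
    then show ?thesis by (intro le_iff) (auto simp: iff)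
  qed
qed

definition reg_col :: "nat \<Rightarrow> nat \<Rightarrow> nat \<Rightarrow> bipartition" where
  "reg_col e l n = (if n < l then ([], replicate n 1) else (braces e (n - l), replicate l 1))"

lemma replicate_partition: "is_partition (replicate n 1)"
  by (auto simp: is_partition_def sorted_wrt_iff_nth_less)

lemma reg_col_bipartition: "is_bipartition (reg_col e l n)"
  using braces_partition[of e "n - l"] replicate_partition
  by (simp add: reg_col_def is_bipartition_def) (simp add: is_partition_def)

lemma reg_col_size: "e \<ge> 2 \<Longrightarrow> bip_size (reg_col e l n) = n"
  by (simp add: reg_col_def bip_size_def sum_list_braces sum_list_replicate)

lemma braces_0: "braces e 0 = []"
  by (auto simp: braces_def filter_empty_conv)

text \<open>Equality of residues is divisibility by \<open>e\<close>. The comparisons of residues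
  below are settled by removing a multiple of \<open>e\<close> with \<open>dvd_shift\<close> and
  observing that what remains is too small to be divisible.\<close>

lemma not_dvd_small: "0 < x \<Longrightarrow> x < int e \<Longrightarrow> \<not> int e dvd x"
  by (rule zdvd_not_zless)

lemma dvd_shift: "x = y + int e * z \<Longrightarrow> int e dvd x \<longleftrightarrow> int e dvd y"
  by (simp add: dvd_add_left_iff)

section \<open>The path of shapes along the residues of the column\<close>

locale col_data =
  fixes e :: nat and \<kappa> :: "nat \<Rightarrow> int" and l :: nat
  assumes e: "e \<ge> 3" and \<kappa>1: "\<kappa> 1 \<in> {0..<int e}" and \<kappa>2: "\<kappa> 2 \<in> {0..<int e}"
    and l: "int l = (\<kappa> 2 - \<kappa> 1) mod int e"
begin

lemma l_less: "l < e"
  using l e pos_mod_bound[of "int e" "\<kappa> 2 - \<kappa> 1"] by linarith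

lemma \<kappa>2_eq: "\<exists>t. \<kappa> 2 = \<kappa> 1 + int l + int e * t"
proof -
  have "\<kappa> 2 - \<kappa> 1 = int e * ((\<kappa> 2 - \<kappa> 1) div int e) + int l"
    unfolding l by simp
  then show ?thesis by (metis add.assoc add.commute diff_add_cancel)
qed

text \<open>\<open>col n\<close> is the last residue of the tableau of shape \<open>(\<emptyset>, (1\<^sup>n\<^sup>+\<^sup>1))\<close>.\<close>

abbreviation lam :: "nat \<Rightarrow> bipartition" where "lam \<equiv> reg_col e l"
abbreviation col :: "nat \<Rightarrow> int" where "col n \<equiv> res e \<kappa> (Suc n, 1, 2)"

section \<open>Shapes with \<open>n < l\<close>: the column in component 2 grows\<close>

context
  fixes n :: nat
  assumes n: "n < l"
begin

lemma lam_small: "lam n = ([], replicate n 1)" "lam (Suc n) = ([], replicate (Suc n) 1)"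
proof -
  show "lam n = ([], replicate n 1)" using n by (simp add: reg_col_def)
  show "lam (Suc n) = ([], replicate (Suc n) 1)"
  proof (cases "Suc n < l")
    case False
    then have "l = Suc n" using n by simp
    then show ?thesis by (simp add: reg_col_def braces_0)
  qed (simp add: reg_col_def)
qed

lemma rows_small:
  "row_len (component (lam n) 1) k = 0" "row_len (component (lam (Suc n)) 1) k = 0"
  "row_len (component (lam n) 2) k = (if 1 \<le> k \<and> k \<le> n then 1 else 0)"
  "row_len (component (lam (Suc n)) 2) k = (if 1 \<le> k \<and> k \<le> Suc n then 1 else 0)"
  by (simp_all only: lam_small component_simps row_len_replicate row_len_Nil)

lemma lam_small_adds: "adds_to (lam n) (Suc n, 1, 2) (lam (Suc n))"
proof -
  have "nodes (lam (Suc n)) = insert (Suc n, 1, 2) (nodes (lam n))"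
  proof (intro Set.set_eqI)
    fix x :: node
    obtain r j c where x: "x = (r, j, c)" by (metis prod.exhaust)
    show "x \<in> nodes (lam (Suc n)) \<longleftrightarrow> x \<in> insert (Suc n, 1, 2) (nodes (lam n))"
      unfolding x mem_nodes insert_iff using rows_small[of r] by (auto split: if_splits)
  qed
  moreover have "(Suc n, 1, 2) \<notin> nodes (lam n)"
    unfolding mem_nodes rows_small by simp
  ultimately show ?thesis
    using reg_col_bipartition by (simp add: adds_to_def)
qed

text \<open>Modulo \<open>e\<close>, the node \<open>(1, 1, 1)\<close> differs in residue from the
  new node by \<open>n - l\<close>, the node \<open>(1, 2, 2)\<close> by \<open>n + 1\<close>, and
  the removable node by 1. Since \<open>n < l < e\<close>, none of these is zero, and the signature
  is a single plus.\<close>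

lemma lam_small_up: "up_arrow e \<kappa> (col n) (lam n) (lam (Suc n))"
proof (rule up_arrowI[OF reg_col_bipartition _ lam_small_adds refl])
  obtain t where t: "\<kappa> 2 = \<kappa> 1 + int l + int e * t" using \<kappa>2_eq by blast
  show "e \<ge> 2" using e by simp
  show "B = (Suc n, 1, 2) \<or> above (Suc n, 1, 2) B" if B: "addable (lam n) B" "res e \<kappa> B = col n" for B
  proof -
    obtain r j c where B': "B = (r, j, c)" by (metis prod.exhaust)
    have a: "c \<in> {1, 2}" "1 \<le> r" "j = Suc (row_len (component (lam n) c) r)"
      "r = 1 \<or> row_len (component (lam n) c) r < row_len (component (lam n) c) (r - 1)"
      using B(1) unfolding B' addable_iff[OF reg_col_bipartition] by blast+
    have dvd: "int e dvd (\<kappa> c + int j - int r) - (\<kappa> 2 + int 1 - int (Suc n))"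
      using B(2) unfolding B' res_eq_iff .
    show ?thesis
    proof (cases "c = 1")
      case True
      then have "r = 1" "j = 1" using a rows_small by auto
      then have "int e dvd - (int l - int n)"
        using dvd dvd_shift[of "(\<kappa> c + int j - int r) - (\<kappa> 2 + int 1 - int (Suc n))" "- (int l - int n)" e "- t"] t True
        by (simp add: algebra_simps)
      then have False
        using not_dvd_small[of "int l - int n" e] n l_less unfolding dvd_minus_iff by simp
      then show ?thesis ..
    next
      case False
      then have c: "c = 2" using a by auto
      have "r = Suc n"
      proof (rule ccontr)
        assume "r \<noteq> Suc n"
        then have "r = 1" "r \<le> n" using a(2,4) unfolding c rows_small by (auto split: if_splits)
        then have "int e dvd int n + 1" using dvd a(3) unfolding c rows_small by (simp add: add.commute)
        then show False using not_dvd_small[of "int n + 1" e] n l_less by simp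
      qed
      then show ?thesis using a(3) unfolding B' c rows_small by simp
    qed
  qed
  \<comment> \<open>There is no removable node of this residue, so the candidate for the single
    minus is arbitrary.\<close>
  show "D = undefined \<and> above (Suc n, 1, 2) D \<and>
      (\<exists>B. addable (lam n) B \<and> res e \<kappa> B = col n \<and> B \<noteq> (Suc n, 1, 2) \<and> above B D)"
    if D: "removable (lam n) D" "res e \<kappa> D = col n" for D
  proof -
    obtain r j c where D': "D = (r, j, c)" by (metis prod.exhaust)
    note a = removableD[OF reg_col_bipartition D(1)[unfolded D']]
    have dvd: "int e dvd (\<kappa> c + int j - int r) - (\<kappa> 2 + int 1 - int (Suc n))"
      using D(2) unfolding D' res_eq_iff .
    have c: "c = 2" using a(1,3,4) rows_small by auto
    then have "r = n" "j = 1" using a(2-5) unfolding c rows_small by (auto split: if_splits)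
    then have "int e dvd 1" using dvd unfolding c by simp
    then have False using e by simp
    then show ?thesis ..
  qed
qed

end

section \<open>Shapes with \<open>n \<ge> l\<close>: columns of height \<open>e - 1\<close> in
  component 1\<close>

context
  fixes n q s :: nat
  assumes n: "n = l + (q * (e - 1) + s)" and s: "s < e - 1"
begin

lemma lam_big: "lam n = (braces e (q * (e - 1) + s), replicate l 1)"
  "lam (Suc n) = (braces e (q * (e - 1) + Suc s), replicate l 1)"
  using n by (auto simp: reg_col_def)

lemma rows:
  "row_len (component (lam n) 1) k = (if 1 \<le> k \<and> k \<le> e - 1 then q + (if k \<le> s then 1 else 0) else 0)"
  "row_len (component (lam (Suc n)) 1) k = (if 1 \<le> k \<and> k \<le> e - 1 then q + (if k \<le> Suc s then 1 else 0) else 0)"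
  "row_len (component (lam n) 2) k = (if 1 \<le> k \<and> k \<le> l then 1 else 0)"
  "row_len (component (lam (Suc n)) 2) k = (if 1 \<le> k \<and> k \<le> l then 1 else 0)"
  using row_len_braces[OF refl, of s e q] row_len_braces[OF refl, of "Suc s" e q] s
  by (simp_all only: lam_big component_simps row_len_replicate)

lemma lam_big_adds: "adds_to (lam n) (Suc s, Suc q, 1) (lam (Suc n))"
proof -
  have "nodes (lam (Suc n)) = insert (Suc s, Suc q, 1) (nodes (lam n))"
  proof (intro Set.set_eqI)
    fix x :: node
    obtain r j c where x: "x = (r, j, c)" by (metis prod.exhaust)
    show "x \<in> nodes (lam (Suc n)) \<longleftrightarrow> x \<in> insert (Suc s, Suc q, 1) (nodes (lam n))"
    proof (cases "c = 1")
      case True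
      then show ?thesis using s unfolding x mem_nodes insert_iff True rows by auto
    next
      case False
      then show ?thesis unfolding x mem_nodes insert_iff using rows(3,4)[of r] by auto
    qed
  qed
  moreover have "(Suc s, Suc q, 1) \<notin> nodes (lam n)"
    unfolding mem_nodes rows by auto
  ultimately show ?thesis
    using reg_col_bipartition by (simp add: adds_to_def)
qed

text \<open>Modulo \<open>e\<close>, \<kappa> 2 - n equals \<kappa> 1 + q - s, because \<kappa> 2 is
  \<kappa> 1 + l and n - l is q (e - 1) + s. This is the residue of the node
  \<open>(Suc s, Suc q, 1)\<close>.\<close>

lemma res_1_iff:
  "res e \<kappa> (r, j, 1) = col n \<longleftrightarrow> int e dvd int j - int r - (int q - int s)"
proof -
  obtain t where t: "\<kappa> 2 = \<kappa> 1 + int l + int e * t" using \<kappa>2_eq by blast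
  have "int n = int l + int q * (int e - 1) + int s" using e by (simp add: n of_nat_diff)
  then show ?thesis
    unfolding res_eq_iff t
    by (intro dvd_shift[of _ _ _ "int q - t"]) (simp add: algebra_simps)
qed

lemma res_2_iff:
  "res e \<kappa> (r, j, 2) = col n \<longleftrightarrow> int e dvd int l + int j - int r - (int q - int s)"
proof -
  have "int n = int l + int q * (int e - 1) + int s" using e by (simp add: n of_nat_diff)
  then show ?thesis
    unfolding res_eq_iff
    by (intro dvd_shift[of _ _ _ "int q"]) (simp add: algebra_simps)
qed

lemma res_C: "res e \<kappa> (Suc s, Suc q, 1) = col n"
  unfolding res_1_iff by simp

text \<open>The only addable node above \<open>(Suc s, Suc q, 1)\<close> can be in row 1, and its
  residue differs by \<open>s + 1\<close>, which is less than \<open>e\<close>. The corners of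
  component 1 have other residues. The foot \<open>(l, 1, 2)\<close> of the column may give a minus,
  but then \<open>(e, 1, 1)\<close> gives a plus above it.\<close>

lemma lam_big_up: "up_arrow e \<kappa> (col n) (lam n) (lam (Suc n))"
proof (rule up_arrowI[OF reg_col_bipartition _ lam_big_adds res_C])
  show "e \<ge> 2" using e by simp
  have small: "\<not> int e dvd int s + 1" using not_dvd_small[of "int s + 1" e] s by simp
  show "B = (Suc s, Suc q, 1) \<or> above (Suc s, Suc q, 1) B" if B: "addable (lam n) B" "res e \<kappa> B = col n" for B
  proof -
    obtain r j c where B': "B = (r, j, c)" by (metis prod.exhaust)
    have a: "c \<in> {1, 2}" "1 \<le> r" "j = Suc (row_len (component (lam n) c) r)"
      "r = 1 \<or> row_len (component (lam n) c) r < row_len (component (lam n) c) (r - 1)"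
      using B(1) unfolding B' addable_iff[OF reg_col_bipartition] by blast+
    show ?thesis
    proof (cases "c = 1")
      case c: True
      consider "r \<le> s" | "r = Suc s" | "Suc s < r" by linarith
      then show ?thesis
      proof cases
        case 1
        then have "r = 1" "j = Suc (Suc q)" using a(2-4) s unfolding c rows by (auto split: if_splits)
        then have "int e dvd int s + 1" using B(2) unfolding B' c res_1_iff by (simp add: algebra_simps)
        then show ?thesis using small by blast
      next
        case 2
        then show ?thesis using a(3) s unfolding B' c rows by simp
      next
        case 3
        then show ?thesis unfolding B' c by (simp add: above_def)
      qed
    next
      case False
      then show ?thesis using a(1) unfolding B' by (simp add: above_def)
    qed
  qed
  show "D = (l, 1, 2) \<and> above (Suc s, Suc q, 1) D \<and>
      (\<exists>B. addable (lam n) B \<and> res e \<kappa> B = col n \<and> B \<noteq> (Suc s, Suc q, 1) \<and> above B D)"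
    if D: "removable (lam n) D" "res e \<kappa> D = col n" for D
  proof -
    obtain r j c where D': "D = (r, j, c)" by (metis prod.exhaust)
    note a = removableD[OF reg_col_bipartition D(1)[unfolded D']]
    have "c \<noteq> 1"
    proof
      assume c: "c = 1"
      consider "r \<le> s" | "s < r" by linarith
      then show False
      proof cases
        case 1
        then have "r = s" "j = Suc q" using a(2-5) s unfolding c rows by (auto split: if_splits)
        then show False using D(2) e unfolding D' c res_1_iff by simp
      next
        case 2
        then have "r = e - 1" "j = q" using a(2-5) s unfolding c rows by (auto split: if_splits)
        then have "int e dvd int s + 1 - int e" using D(2) e unfolding D' c res_1_iff by (simp add: algebra_simps of_nat_diff)
        then show False using small dvd_shift[of "int s + 1 - int e" "int s + 1" e "- 1"] by simp
      qed
    qed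
    then have c: "c = 2" using a(1) by auto
    then have r: "r = l" "j = 1" using a(2-5) unfolding c rows by (auto split: if_splits)
    have "int e dvd 1 - (int q - int s)"
      using D(2) unfolding D' c r res_2_iff by simp
    then have "q \<noteq> 0" using small by (intro notI) (simp add: add.commute)
    \<comment> \<open>Its residue is \<kappa> 1 + 1, the same as that of \<open>(l, 1, 2)\<close>.
      It is addable because \<open>q \<noteq> 0\<close> makes the row \<open>e - 1\<close>
      nonempty.\<close>
    have "addable (lam n) (e, 1, 1)"
      unfolding addable_iff[OF reg_col_bipartition] rows using e \<open>q \<noteq> 0\<close> by auto
    moreover have "res e \<kappa> (e, 1, 1) = col n"
      unfolding res_1_iff using \<open>int e dvd 1 - (int q - int s)\<close>
        dvd_shift[of "int 1 - int e - (int q - int s)" "1 - (int q - int s)" e "- 1"] by simp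
    ultimately show ?thesis
      unfolding D' c r using s by (intro conjI exI[of _ "(e, 1, 1)"]) (auto simp: above_def)
  qed
qed

text \<open>The shape has at most three corners. For each wrong one, the smaller shape has an
  addable node of the same residue above it, and no removable node of that residue lies in between,
  against \<open>up_arrow_highest\<close>.\<close>

lemma lam_big_pred:
  assumes up: "up_arrow e \<kappa> i \<mu> (lam (Suc n))" and \<mu>: "is_bipartition \<mu>"
  shows "\<mu> = lam n \<and> i = col n"
proof (rule up_arrow_highest[OF up \<mu>])
  show "e \<ge> 2" using e by simp
  fix A assume adds: "adds_to \<mu> A (lam (Suc n))" and res: "res e \<kappa> A = i"
    and high: "\<And>B. addable \<mu> B \<Longrightarrow> res e \<kappa> B = i \<Longrightarrow> above B A \<Longrightarrow>
      \<exists>D. removable \<mu> D \<and> res e \<kappa> D = i \<and> above B D \<and> above D A"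
  have small: "\<not> int e dvd int s + 1" using not_dvd_small[of "int s + 1" e] s by simp
  obtain r j c where A: "A = (r, j, c)" by (metis prod.exhaust)
  have "nodes \<mu> = nodes (lam (Suc n)) - {A}" "A \<in> nodes (lam (Suc n))"
    using adds unfolding adds_to_def by (metis Diff_insert_absorb, blast)
  then have "removable (lam (Suc n)) (r, j, c)"
    unfolding removable_def A using \<mu> by blast
  note a = removableD[OF reg_col_bipartition this]
  have \<mu>_rows: "row_len (component \<mu> c') k = row_len (component (lam (Suc n)) c') k - (if c' = c \<and> k = r then 1 else 0)"
    if "c' \<in> {1, 2}" "1 \<le> k" for c' k
    using adds_to_row_len[OF \<mu> adds[unfolded A] that] by simp
  have "A = (Suc s, Suc q, 1)"
  proof (cases "c = 1")
    case c: True
    show ?thesis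
    proof (rule ccontr)
      assume neq: "A \<noteq> (Suc s, Suc q, 1)"
      then have r: "r = e - 1" "j = q" "Suc s < e - 1" "1 \<le> q"
        using a(2-5) s unfolding A c rows by (auto split: if_splits)
      \<comment> \<open>The end of row 1 and the corner \<open>(e - 1, q, 1)\<close> have contents
        \<open>q + 1\<close> and \<open>q - e + 1\<close>, which agree modulo
        \<open>e\<close>.\<close>
      let ?B = "(1, Suc (Suc q), 1) :: node"
      have "addable \<mu> ?B"
        unfolding addable_iff[OF \<mu>] using \<mu>_rows[of 1 1] r s e rows(2)[of 1] by (auto simp: c)
      moreover have "res e \<kappa> ?B = i"
        unfolding res[symmetric] A c res_eq_iff using r e by (auto simp: of_nat_diff)
      moreover have "above ?B A" unfolding A c using r by (simp add: above_def)
      ultimately obtain D where D: "removable \<mu> D" "res e \<kappa> D = i" "above ?B D" "above D A"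
        using high by blast
      obtain r' j' c' where D': "D = (r', j', c')" by (metis prod.exhaust)
      note d = removableD[OF \<mu> D(1)[unfolded D']]
      have c': "c' = 1" and r': "1 < r'" "r' < r"
        using D(3,4) d(1) unfolding D' A c by (auto simp: above_def)
      have dvd: "int e dvd (\<kappa> 1 + int j' - int r') - (\<kappa> 1 + int j - int r)"
        using D(2) unfolding D' res[symmetric] A c c' res_eq_iff .
      have j': "j' = q + (if r' \<le> Suc s then 1 else 0)"
        using d(4) \<mu>_rows[of 1 r'] r' r unfolding c' rows by auto
      \<comment> \<open>Strictly between rows 1 and \<open>e - 1\<close>, the smaller shape can have
        corners only at the step in row \<open>s + 1\<close> and in row \<open>e - 2\<close>, the
        latter because \<open>A\<close> has been taken off the row below it.\<close>
      consider "r' = Suc s" "j' = Suc q" | "r' = r - 1" "j' = q"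
      proof (cases "Suc r' = r")
        case True
        then have "r' = Suc s \<or> \<not> r' \<le> Suc s" using r(1,3) by linarith
        then show thesis using True j' that by auto
      next
        case False
        then have "row_len (component \<mu> 1) (Suc r') = q + (if Suc r' \<le> Suc s then 1 else 0)"
          using \<mu>_rows[of 1 "Suc r'"] r' r(1) unfolding rows by auto
        then have "r' = Suc s"
          using d(4,5) unfolding c' j' by (auto split: if_splits)
        then show thesis using j' that(1) by simp
      qed
      then show False
      proof cases
        case 1
        have "(\<kappa> 1 + int j' - int r') - (\<kappa> 1 + int j - int r) = - (int s + 1) + int e * 1"
          using 1 r(1,2) e by linarith
        then have "int e dvd - (int s + 1)" using dvd dvd_shift by blast
        then show False using small unfolding dvd_minus_iff by blast
      next
        case 2
        have "(\<kappa> 1 + int j' - int r') - (\<kappa> 1 + int j - int r) = 1"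
          using 2 r(1,2) r' e by linarith
        then show False using dvd e by simp
      qed
    qed
  next
    case False
    then have c: "c = 2" using a(1) by auto
    then have r: "r = l" "j = 1" "1 \<le> l" using a(2-5) unfolding c rows by (auto split: if_splits)
    have \<mu>1: "row_len (component \<mu> 1) k = row_len (component (lam (Suc n)) 1) k" if "1 \<le> k" for k
      using \<mu>_rows[of 1 k] that c by simp
    have resA: "res e \<kappa> (r', j', 1) = i \<longleftrightarrow> int e dvd int j' - int r' - 1" for r' j'
    proof -
      obtain t where t: "\<kappa> 2 = \<kappa> 1 + int l + int e * t" using \<kappa>2_eq by blast
      show ?thesis unfolding res[symmetric] A c r res_eq_iff t
        by (intro dvd_shift[of _ _ _ "- t"]) simp
    qed
    \<comment> \<open>The foot of the column has residue \<kappa> 1 + 1. In component 1 this residue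
      occurs at the end of row 1 if there is just one column, and directly below a full first column
      otherwise.\<close>
    define B where "B = (if q = 0 then (1, 2, 1) else (e, 1, 1) :: node)"
    have B: "addable \<mu> B"
    proof (cases "q = 0")
      case True
      then show ?thesis
        unfolding B_def using addable_iff[OF \<mu>, of 1 2 1] \<mu>1[of 1] rows(2)[of 1] e by simp
    next
      case False
      then show ?thesis
        unfolding B_def using addable_iff[OF \<mu>, of e 1 1] \<mu>1[of e] \<mu>1[of "e - 1"] rows(2)[of e] rows(2)[of "e - 1"] e
        by auto
    qed
    have "res e \<kappa> B = i"
      unfolding B_def using resA[of 1 2] resA[of e 1] by simp
    moreover have "above B A" unfolding A c B_def by (simp add: above_def)
    ultimately obtain D where D: "removable \<mu> D" "res e \<kappa> D = i" "above B D" "above D A"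
      using high B by blast
    obtain r' j' c' where D': "D = (r', j', c')" by (metis prod.exhaust)
    note d = removableD[OF \<mu> D(1)[unfolded D']]
    have False
    proof (cases "c' = 1")
      case c': True
      show False
      proof (cases "q = 0")
        case True
        then have "r' = Suc s" "j' = 1"
          using d(2-5) \<mu>1[of r'] \<mu>1[of "Suc r'"] s unfolding c' rows by (auto split: if_splits)
        then have "int e dvd - (int s + 1)" using D(2) unfolding D' c' resA by simp
        then show False using small unfolding dvd_minus_iff by blast
      next
        case False
        then have "e < r'" using D(3) unfolding B_def D' c' by (simp add: above_def)
        then show False using d(2-4) \<mu>1[of r'] unfolding c' rows by (auto split: if_splits)
      qed
    next
      case False
      then have c': "c' = 2" using d(1) by auto
      have "r' < l" using D(4) unfolding D' A c r c' by (simp add: above_def)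
      then have "r' = l - 1" "j' = 1"
        using d(2-5) \<mu>_rows[of 2 r'] \<mu>_rows[of 2 "Suc r'"] r unfolding c' c rows by (auto split: if_splits)
      then have "int e dvd 1"
        using D(2) d(2) \<open>r' < l\<close> unfolding D' res[symmetric] A c r c' res_eq_iff by (simp add: of_nat_diff)
      then show False using e by simp
    qed
    then show ?thesis ..
  qed
  then show ?thesis
    using adds_to_unique_left[OF adds _ \<mu> reg_col_bipartition] lam_big_adds res res_C by auto
qed

end

lemma lam_cases:
  assumes "\<not> n < l"
  obtains q s where "n = l + (q * (e - 1) + s)" "s < e - 1"
proof
  show "n = l + ((n - l) div (e - 1) * (e - 1) + (n - l) mod (e - 1))"
    using assms by (simp only: div_mult_mod_eq)
  show "(n - l) mod (e - 1) < e - 1"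
    using e by simp
qed

lemma lam_up: "up_arrow e \<kappa> (col n) (lam n) (lam (Suc n))"
proof (cases "n < l")
  case False
  then obtain q s where "n = l + (q * (e - 1) + s)" "s < e - 1" by (rule lam_cases)
  then show ?thesis by (rule lam_big_up)
qed (rule lam_small_up)

text \<open>For \<open>n < l\<close> the shape is a single column with a single corner, so its
  predecessor is unique at once; signatures enter only from \<open>n = l\<close> on.\<close>

lemma lam_pred:
  assumes up: "up_arrow e \<kappa> i \<mu> (lam (Suc n))" and \<mu>: "is_bipartition \<mu>"
  shows "\<mu> = lam n \<and> i = col n"
proof (cases "n < l")
  case False
  then obtain q s where "n = l + (q * (e - 1) + s)" "s < e - 1" by (rule lam_cases)
  then show ?thesis using lam_big_pred up \<mu> by blast
next
  case n: True
  have "e \<ge> 2" using e by simp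
  then obtain A where A: "adds_to \<mu> A (lam (Suc n))" "res e \<kappa> A = i"
    using up_arrow_highest[OF up \<mu>] by blast
  obtain r j c where A': "A = (r, j, c)" by (metis prod.exhaust)
  have "nodes \<mu> = nodes (lam (Suc n)) - {A}" "A \<in> nodes (lam (Suc n))"
    using A(1) unfolding adds_to_def by (metis Diff_insert_absorb, blast)
  then have "removable (lam (Suc n)) (r, j, c)"
    unfolding removable_def A' using \<mu> by blast
  note a = removableD[OF reg_col_bipartition this]
  note rl = rows_small[OF n]
  have c: "c = 2" using a(1,3,4) rl by auto
  then have "A = (Suc n, 1, 2)" using a(2-5) unfolding A' c rl by (auto split: if_splits)
  then show ?thesis
    using A adds_to_unique_left[OF A(1) _ \<mu> reg_col_bipartition] lam_small_adds[OF n] by auto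
qed

lemma lam_regular: "regular e \<kappa> (lam n)"
proof (induction n)
  case 0
  then show ?case by (cases "l = 0") (auto simp: reg_col_def braces_0 intro: regular.intros(1))
next
  case (Suc n)
  have "col n \<in> {0..<int e}" using e by (simp add: res_def)
  then show ?case using regular.intros(2)[OF Suc _ lam_up] by blast
qed

end

section \<open>Self-duality and composition series in dimension one\<close>

lemma gmodule_iso_refl: "gmodule_iso R M M"
  unfolding gmodule_iso_def by (intro exI[of _ "\<lambda>x. x"]) (simp add: bij_betw_def)

context klr_char
begin

lemma one_dim_simps:
  "carrier (one_dim_module is d :: ('f, 'f) klr_gmodule) = UNIV"
  "x \<oplus>\<^bsub>(one_dim_module is d :: ('f, 'f) klr_gmodule)\<^esub> y = x + y"
  "\<zero>\<^bsub>(one_dim_module is d :: ('f, 'f) klr_gmodule)\<^esub> = 0"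
  "deg_part (one_dim_module is d :: ('f, 'f) klr_gmodule) d' = (if d' = d then UNIV else {0})"
  by (simp_all add: one_dim_module_def)

text \<open>Only a few closure properties of \<open>M\<close> are assumed, so that the lemma also
  applies to composition factors, which are bare quotient records.\<close>

lemma irreducible_one_dim:
  fixes M :: "('f, 'b) klr_gmodule"
  assumes iso: "gmodule_iso (klr_algebra e \<kappa> n) M (one_dim_module is d :: ('f, 'f) klr_gmodule)"
    and zero: "\<zero>\<^bsub>M\<^esub> \<in> carrier M" "\<zero>\<^bsub>M\<^esub> \<oplus>\<^bsub>M\<^esub> \<zero>\<^bsub>M\<^esub> = \<zero>\<^bsub>M\<^esub>"
    and smult: "\<And>a x. a \<in> carrier (klr_algebra e \<kappa> n) \<Longrightarrow> x \<in> carrier M \<Longrightarrow> a \<odot>\<^bsub>M\<^esub> x \<in> carrier M"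
  shows "irreducible_gmodule (klr_algebra e \<kappa> n) M"
proof (rule gmodule_iso_one_dimE[OF iso])
  fix \<phi> assume \<phi>: "bij_betw \<phi> (carrier M) (UNIV :: 'f set)"
    "\<And>x y. x \<in> carrier M \<Longrightarrow> y \<in> carrier M \<Longrightarrow> \<phi> (x \<oplus>\<^bsub>M\<^esub> y) = \<phi> x + \<phi> y"
    "\<And>p x. p \<in> words_in e n \<Longrightarrow> x \<in> carrier M \<Longrightarrow>
      \<phi> (klr_class e \<kappa> n p \<odot>\<^bsub>M\<^esub> x) = one_dim_char is p * \<phi> x"
  have inj: "x = y" if "\<phi> x = \<phi> y" "x \<in> carrier M" "y \<in> carrier M" for x y
    by (rule inj_onD[OF bij_betw_imp_inj_on[OF \<phi>(1)] that])
  have phi_zero: "\<phi> \<zero>\<^bsub>M\<^esub> = 0"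
    using \<phi>(2)[OF zero(1) zero(1)] unfolding zero(2) by (simp only: add_cancel_right_right)
  show ?thesis
    unfolding irreducible_gmodule_def
  proof (intro conjI allI impI)
    have "1 \<in> \<phi> ` carrier M" using \<phi>(1) by (simp add: bij_betw_def)
    then obtain x where "x \<in> carrier M" "\<phi> x = 1" by auto
    then show "carrier M \<noteq> {\<zero>\<^bsub>M\<^esub>}" using phi_zero by auto
    fix N assume "graded_submodule (klr_algebra e \<kappa> n) M N"
    then have N: "submodule N (klr_algebra e \<kappa> n) M" by (simp add: graded_submodule_def)
    have sub: "N \<subseteq> carrier M" "\<zero>\<^bsub>M\<^esub> \<in> N"
      using subgroup.subset[OF submodule.axioms(1)[OF N]] subgroup.one_closed[OF submodule.axioms(1)[OF N]]
      by auto
    show "N = {\<zero>\<^bsub>M\<^esub>} \<or> N = carrier M"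
    proof (cases "N \<subseteq> {\<zero>\<^bsub>M\<^esub>}")
      case True
      then show ?thesis using sub(2) by blast
    next
      case False
      then obtain y where y: "y \<in> N" "y \<noteq> \<zero>\<^bsub>M\<^esub>" by blast
      have yM: "y \<in> carrier M" using y(1) sub(1) by blast
      have "\<phi> y \<noteq> 0" using inj[of y "\<zero>\<^bsub>M\<^esub>"] y(2) yM zero(1) phi_zero by auto
      have "z \<in> N" if z: "z \<in> carrier M" for z
      proof -
        let ?a = "klr_class e \<kappa> n (scal (\<phi> z / \<phi> y))"
        have "\<phi> (?a \<odot>\<^bsub>M\<^esub> y) = \<phi> z"
          using \<open>\<phi> y \<noteq> 0\<close> yM by (simp add: \<phi>(3))
        then have "?a \<odot>\<^bsub>M\<^esub> y = z"
          using yM z by (intro inj smult) auto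
        moreover have "?a \<odot>\<^bsub>M\<^esub> y \<in> N"
          by (rule submodule.smult_closed[OF N _ y(1)]) auto
        ultimately show ?thesis by simp
      qed
      then show ?thesis using sub(1) by blast
    qed
  qed
qed

lemma one_dim_irreducible:
  "irreducible_gmodule (klr_algebra e \<kappa> n) (one_dim_module is d :: ('f, 'f) klr_gmodule)"
  by (rule irreducible_one_dim[OF gmodule_iso_refl]) (simp_all add: one_dim_simps)

text \<open>If the degrees differed, the second isomorphism would collapse to zero a component that
  the first one maps onto the field.\<close>

lemma one_dim_shift_unique:
  assumes "gmodule_iso (klr_algebra e \<kappa> n) M (one_dim_module is d :: ('f, 'f) klr_gmodule)"
    and "gmodule_iso (klr_algebra e \<kappa> n) M (one_dim_module is d' :: ('f, 'f) klr_gmodule)"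
    and deg: "\<And>k. deg_part M k \<subseteq> carrier M"
  shows "d = d'"
proof (rule ccontr)
  assume "d \<noteq> d'"
  obtain \<phi> where \<phi>: "\<And>k. \<phi> ` deg_part M k = (if k = d then UNIV else {0 :: 'f})"
    by (rule gmodule_iso_one_dimE[OF assms(1)]) (rule that)
  obtain \<psi> where \<psi>: "bij_betw \<psi> (carrier M) UNIV"
    "\<And>k. \<psi> ` deg_part M k = (if k = d' then UNIV else {0 :: 'f})"
    by (rule gmodule_iso_one_dimE[OF assms(2)]) (rule that)
  have inj: "inj_on \<psi> (deg_part M d)"
    using inj_on_subset[OF bij_betw_imp_inj_on[OF \<psi>(1)] deg] .
  have "{0, 1} \<subseteq> \<phi> ` deg_part M d" using \<phi>[of d] by simp
  then obtain x y where xy: "x \<in> deg_part M d" "y \<in> deg_part M d" "\<phi> x = 0" "\<phi> y = 1" by auto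
  have "\<psi> x \<in> \<psi> ` deg_part M d" "\<psi> y \<in> \<psi> ` deg_part M d" using xy(1,2) by blast+
  then have "\<psi> x = \<psi> y" using \<psi>(2)[of d] \<open>d \<noteq> d'\<close> by simp
  then have "x = y" using inj xy(1,2) by (auto dest: inj_onD)
  then show False using xy(3,4) by simp
qed

text \<open>A functional of degree \<open>d\<close> on a module concentrated in degree \<open>d\<close> is supported on the
  component of degree \<open>- d\<close>.\<close>

lemma self_dual_degree:
  fixes M :: "('f, 'b) klr_gmodule"
  assumes iso: "gmodule_iso (klr_algebra e \<kappa> n) M (one_dim_module is d :: ('f, 'f) klr_gmodule)"
    and dual: "gmodule_iso (klr_algebra e \<kappa> n) M (graded_dual e \<kappa> n M)"
    and deg: "\<And>k. deg_part M k \<subseteq> carrier M"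
  shows "d = 0"
proof (rule ccontr)
  assume "d \<noteq> 0"
  obtain \<phi> where \<phi>: "bij_betw \<phi> (carrier M) UNIV"
    "\<And>k. \<phi> ` deg_part M k = (if k = d then UNIV else {0 :: 'f})"
    by (rule gmodule_iso_one_dimE[OF iso]) (rule that)
  obtain \<psi> where \<psi>: "bij_betw \<psi> (carrier M) (carrier (graded_dual e \<kappa> n M))"
    "\<And>k. \<psi> ` deg_part M k = deg_part (graded_dual e \<kappa> n M) k"
    by (rule gmodule_isoE[OF dual]) (rule that)
  have all: "deg_part M d = carrier M"
  proof (rule inj_on_image_eq_iff[THEN iffD1, OF bij_betw_imp_inj_on[OF \<phi>(1)] deg order_refl])
    show "\<phi> ` deg_part M d = \<phi> ` carrier M"
      using \<phi>(2)[of d] bij_betw_imp_surj_on[OF \<phi>(1)] by simp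
  qed
  have trivial: "f = (\<lambda>x \<in> carrier M. 0)" if "f \<in> deg_part (graded_dual e \<kappa> n M) d" for f
  proof (rule extensionalityI[of _ "carrier M"])
    show "f \<in> extensional (carrier M)"
      using that by (simp add: graded_dual_def Let_def)
    fix x assume "x \<in> carrier M"
    then have "x \<in> deg_part M d" using all by simp
    moreover have "\<forall>d'. d' \<noteq> - d \<longrightarrow> (\<forall>x \<in> deg_part M d'. f x = 0)"
      using that by (simp add: graded_dual_def Let_def)
    moreover have "d \<noteq> - d" using \<open>d \<noteq> 0\<close> by simp
    ultimately have "f x = 0" by blast
    then show "f x = (\<lambda>x \<in> carrier M. 0) x" using \<open>x \<in> carrier M\<close> by simp
  qed simp
  have "{0, 1} \<subseteq> \<phi> ` carrier M" using bij_betw_imp_surj_on[OF \<phi>(1)] by simp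
  then obtain x y where xy: "x \<in> carrier M" "y \<in> carrier M" "\<phi> x = 0" "\<phi> y = 1" by auto
  have "\<psi> z \<in> deg_part (graded_dual e \<kappa> n M) d" if "z \<in> carrier M" for z
    using \<psi>(2)[of d] that all by blast
  then have "\<psi> x = \<psi> y" using trivial[of "\<psi> x"] trivial[of "\<psi> y"] xy(1,2) by simp
  then have "x = y" using bij_betw_imp_inj_on[OF \<psi>(1)] xy(1,2) by (auto dest: inj_onD)
  then show False using xy(3,4) by simp
qed

text \<open>The isomorphism sends \<open>x\<close> to multiplication by \<open>x\<close>. It
  respects the twisted action because a word and its reversal have the same letters, hence the same
  character value, and it respects degrees because 0 is its own negative.\<close>

lemma one_dim_self_dual:
  "gmodule_iso (klr_algebra e \<kappa> n) (one_dim_module is 0 :: ('f, 'f) klr_gmodule)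
    (graded_dual e \<kappa> n (one_dim_module is 0))"
proof -
  let ?M = "one_dim_module is 0 :: ('f, 'f) klr_gmodule"
  let ?D = "graded_dual e \<kappa> n ?M"
  have scalar: "klr_scalar e \<kappa> n c \<odot>\<^bsub>?M\<^esub> x = c * x" for c x
    by (simp add: klr_scalar_def one_dim_smult)
  have star: "klr_star a \<odot>\<^bsub>?M\<^esub> x = a \<odot>\<^bsub>?M\<^esub> x" for a x
    by (simp add: one_dim_module_def klr_star_def image_image one_dim_char_push_rev)
  \<comment> \<open>\<open>V\<close> is the space of linear functionals on the field;
    \<open>fin\<close> shows that each is supported in degree 0, so \<open>V\<close> is the carrier
    of the dual.\<close>
  define V where "V = {f :: 'f \<Rightarrow> 'f. (\<forall>x y. f (x + y) = f x + f y) \<and> (\<forall>c x. f (c * x) = c * f x)}"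
  have V_zero: "f 0 = 0" if "f \<in> V" for f
  proof -
    have "f (0 * 0) = 0 * f 0" using that unfolding V_def by blast
    then show ?thesis by simp
  qed
  have fin: "finite {d. \<exists>x \<in> deg_part ?M d. f x \<noteq> 0}" if "f \<in> V" for f
  proof -
    have "{d. \<exists>x \<in> deg_part ?M d. f x \<noteq> 0} \<subseteq> {0}"
      using V_zero[OF that] by (auto simp: one_dim_simps split: if_splits)
    then show ?thesis by (rule finite_subset) simp
  qed
  have "carrier ?D = {f \<in> V. finite {d. \<exists>x \<in> deg_part ?M d. f x \<noteq> 0}}"
    unfolding graded_dual_def Let_def V_def by (auto simp: one_dim_simps(1-3) scalar)
  also have "\<dots> = V" using fin by blast
  finally have carrier_D: "carrier ?D = V" .
  have D: "carrier ?D = V" "f \<oplus>\<^bsub>?D\<^esub> g = (\<lambda>x. f x + g x)" "a \<odot>\<^bsub>?D\<^esub> f = (\<lambda>x. f (a \<odot>\<^bsub>?M\<^esub> x))"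
    "deg_part ?D d = {f \<in> V. \<forall>d'. d' \<noteq> - d \<longrightarrow> (\<forall>x \<in> deg_part ?M d'. f x = 0)}" for f g a d
    unfolding carrier_D[symmetric] by (simp_all add: graded_dual_def Let_def one_dim_simps(1-3) star restrict_UNIV)
  have mult_V: "(\<lambda>y. c * y) \<in> V" for c by (simp add: V_def algebra_simps)
  have V_iff: "f \<in> V \<longleftrightarrow> f = (\<lambda>y. f 1 * y)" for f
  proof
    assume "f \<in> V"
    then have *: "f (y * 1) = y * f 1" for y unfolding V_def by blast
    show "f = (\<lambda>y. f 1 * y)"
    proof
      fix y
      show "f y = f 1 * y" using *[of y] by (metis mult.commute mult.right_neutral)
    qed
  next
    assume "f = (\<lambda>y. f 1 * y)"
    then show "f \<in> V" using mult_V by metis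
  qed
  have bij: "bij_betw (\<lambda>x y. x * y) (carrier ?M) (carrier ?D)"
    proof (rule bij_betwI[of _ _ _ "\<lambda>f. f 1"])
      show "(\<lambda>x y. x * y) \<in> carrier ?M \<rightarrow> carrier ?D"
        unfolding D by (rule Pi_I) (rule mult_V)
      show "(\<lambda>y. f 1 * y) = f" if "f \<in> carrier ?D" for f
        using that unfolding D by (rule V_iff[THEN iffD1, symmetric])
    qed (simp_all add: one_dim_simps)
  show ?thesis
    unfolding gmodule_iso_def
  proof (intro exI[of _ "\<lambda>x y. x * y"] conjI ballI allI)
    show "bij_betw (\<lambda>x y. x * y) (carrier ?M) (carrier ?D)" by (rule bij)
    show "(\<lambda>z. (x \<oplus>\<^bsub>?M\<^esub> y) * z) = (\<lambda>z. x * z) \<oplus>\<^bsub>?D\<^esub> (\<lambda>z. y * z)" for x y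
      unfolding D one_dim_simps by (simp add: distrib_right)
    show "(\<lambda>y. (a \<odot>\<^bsub>?M\<^esub> x) * y) = a \<odot>\<^bsub>?D\<^esub> (\<lambda>y. x * y)"
      if "a \<in> carrier (klr_algebra e \<kappa> n)" for a x
    proof (rule klr_algebra_cases[OF that])
      fix p :: "'f free" assume "p \<in> words_in e n" and a: "a = klr_class e \<kappa> n p"
      show ?thesis unfolding D a one_dim_smult by (simp add: algebra_simps)
    qed
    show "(\<lambda>x y. x * y) ` deg_part ?M d = deg_part ?D d" for d
    proof (cases "d = 0")
      case True
      have "(\<lambda>x y. x * y) ` UNIV = V"
        using bij_betw_imp_surj_on[OF bij] unfolding one_dim_simps D .
      moreover have "deg_part ?D 0 = V"
        unfolding D(4) one_dim_simps by (intro equalityI subsetI) (simp_all add: V_zero)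
      ultimately show ?thesis using True by (simp add: one_dim_simps)
    next
      case False
      have zero: "f = (\<lambda>y. 0)" if "f \<in> deg_part ?D d" for f
      proof
        fix y
        have "\<forall>d'. d' \<noteq> - d \<longrightarrow> (\<forall>x \<in> deg_part ?M d'. f x = 0)" using that unfolding D(4) by simp
        from this[rule_format, of 0 y] show "f y = 0" using False by (simp add: one_dim_simps)
      qed
      have "deg_part ?D d = {\<lambda>y. 0}"
      proof (intro equalityI subsetI)
        fix f :: "'f \<Rightarrow> 'f" assume "f \<in> {\<lambda>y. 0}"
        then show "f \<in> deg_part ?D d" unfolding D(4) V_def by simp
      qed (rule singleton_iff[THEN iffD2], erule zero)
      then show ?thesis using False by (simp add: one_dim_simps)
    qed
  qed
qed

end

section \<open>The residue sequence of the column and its character\<close>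

lemma col_res_Suc: "col_res e \<kappa> (Suc n) = col_res e \<kappa> n @ [res e \<kappa> (Suc n, 1, 2)]"
  by (simp add: col_res_def res_def)

context col_data
begin

lemma length_col_res [simp]: "length (col_res e \<kappa> n) = n"
  by (simp add: col_res_def)

lemma ent_col_res:
  assumes "1 \<le> r" "r \<le> n"
  shows "ent (col_res e \<kappa> n) r = (\<kappa> 2 - int (r - 1)) mod int e"
proof -
  have "r - 1 < n" using assms by linarith
  then show ?thesis by (simp add: col_res_def nth_upt)
qed

lemma col_res_in: "col_res e \<kappa> n \<in> res_seqs e n"
  using e by (auto simp: res_seqs_def col_res_def)

lemma ent_col_res_Suc:
  assumes "1 \<le> r" "r < n"
  shows "ent (col_res e \<kappa> n) (r + 1) = pred_res e (ent (col_res e \<kappa> n) r)"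
proof -
  have "ent (col_res e \<kappa> n) (r + 1) = (\<kappa> 2 - int r) mod int e"
    using ent_col_res[of "r + 1" n] assms by simp
  also have "\<kappa> 2 - int r = \<kappa> 2 - int (r - 1) - 1"
    using assms by linarith
  also have "(\<kappa> 2 - int (r - 1) - 1) mod int e = pred_res e (ent (col_res e \<kappa> n) r)"
    using ent_col_res[of r n] assms unfolding pred_res_def by (simp only: mod_diff_left_eq less_imp_le)
  finally show ?thesis .
qed

lemma ent_col_res_neq: "1 \<le> r \<Longrightarrow> r < n \<Longrightarrow> ent (col_res e \<kappa> n) r \<noteq> ent (col_res e \<kappa> n) (r + 1)"
  using pred_res_neq[of e "ent (col_res e \<kappa> n) r"] ent_col_res_Suc[of r n] ent_col_res[of r n] e by simp

text \<open>Entries two places apart differ by 2, which is nonzero modulo \<open>e\<close> because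
  \<open>e \<ge> 3\<close>. The vanishing of the braid error and the hypothesis \<open>i_neq\<close>
  of \<open>klr_insertion\<close> rest on this.\<close>

lemma ent_col_res_neq2:
  assumes "1 \<le> r" "r + 1 < n"
  shows "ent (col_res e \<kappa> n) (r + 2) \<noteq> ent (col_res e \<kappa> n) r"
proof
  assume "ent (col_res e \<kappa> n) (r + 2) = ent (col_res e \<kappa> n) r"
  then have "(\<kappa> 2 - int (r + 1)) mod int e = (\<kappa> 2 - int (r - 1)) mod int e"
    using ent_col_res[of "r + 2" n] ent_col_res[of r n] assms by simp
  then have "int e dvd (\<kappa> 2 - int (r + 1)) - (\<kappa> 2 - int (r - 1))"
    by (simp only: mod_eq_dvd_iff)
  also have "(\<kappa> 2 - int (r + 1)) - (\<kappa> 2 - int (r - 1)) = - 2"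
    using assms by (simp add: of_nat_diff)
  finally have "int e dvd 2" by simp
  then show False using e zdvd_imp_le[of "int e" 2] by simp
qed

text \<open>Four conditions decide whether the one-dimensional module exists: neighbouring entries
  differ, so the \<open>delta\<close> terms vanish; they are neighbours in the quiver, so no square
  of a \<open>\<psi>\<close> is 1; entries two apart differ, so there is no braid error; and the
  first entry is \<kappa> 2, so the cyclotomic exponent is positive.\<close>

lemma col_res_char: "klr_char TYPE('f::field) e \<kappa> n (col_res e \<kappa> n)"
proof
  show "col_res e \<kappa> n \<in> res_seqs e n" by (rule col_res_in)
  fix p :: "'f free" assume "p \<in> klr_ideal e \<kappa> n"
  then show "one_dim_char (col_res e \<kappa> n) p = 0"
  proof (induction rule: klr_ideal_induct)
    case (relator p)
    then show ?case
    proof cases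
      case idem_sum
      then show ?thesis by (simp add: one_dim_char_sum finite_res_seqs col_res_in)
    next
      case (psi_y_next r ks)
      then show ?thesis using ent_col_res_neq[of r n] by (auto simp: delta_def)
    next
      case (y_next_psi r ks)
      then show ?thesis using ent_col_res_neq[of r n] by (auto simp: delta_def)
    next
      case (psi_sq r ks)
      then show ?thesis
        using ent_col_res_Suc[of r n] by (cases "ks = col_res e \<kappa> n") (auto simp: psi_square_def)
    next
      case (braid r ks)
      then show ?thesis
        using ent_col_res_neq2[of r n] by (cases "ks = col_res e \<kappa> n") (auto simp: braid_error_def)
    next
      case (cyclotomic ks)
      then have "card {k \<in> {1, 2}. \<kappa> k = ent (col_res e \<kappa> n) 1} \<noteq> 0"
        using ent_col_res[of 1 n] \<kappa>2 by auto
      then show ?thesis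
        unfolding cyclotomic(1)
        by (cases "ks = col_res e \<kappa> n") (simp_all add: one_dim_char_power power_0_left)
    qed auto
  qed auto
qed

end

section \<open>Composition series and multiplicities of a one-dimensional module\<close>

context klr_char
begin

context
  fixes d :: int and S :: "('f, 'f) klr_gmodule"
  assumes S_def: "S = one_dim_module is d"
begin

lemma S_simps: "carrier S = UNIV" "x \<oplus>\<^bsub>S\<^esub> y = x + y" "\<zero>\<^bsub>S\<^esub> = 0"
  "deg_part S d' = (if d' = d then UNIV else {0})"
  unfolding S_def by (rule one_dim_simps)+

lemma S_irreducible: "irreducible_gmodule (klr_algebra e \<kappa> n) S"
  unfolding S_def by (rule one_dim_irreducible)

lemma S_graded_submodule:
  assumes "N = {0} \<or> N = UNIV"
  shows "graded_submodule (klr_algebra e \<kappa> n) S N"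
proof -
  interpret klr_gmod e \<kappa> n S
    by (rule klr_graded_module_gmod) (simp add: S_def one_dim_graded_module)
  have zero: "act p 0 = 0" if "p \<in> words_in e n" for p
    using act_zero_right[OF that] unfolding S_simps .
  show ?thesis
  proof (rule graded_submoduleI)
    show "submodule N (klr_algebra e \<kappa> n) S"
      by (rule submoduleI) (use assms zero in \<open>auto simp: S_simps words_in_X\<close>)
    show "\<forall>x\<in>N. P x" if "P \<zero>\<^bsub>S\<^esub>" "\<And>x d. x \<in> N \<Longrightarrow> x \<in> deg_part S d \<Longrightarrow> P x" for P
      using that(2)[of _ d] unfolding S_simps by auto
  qed
qed

text \<open>The cosets of the zero submodule are singletons, and \<open>x\<close> is sent to its
  singleton.\<close>

lemma comp_factor_S:
  assumes "Ns ! j = {0}" "Ns ! Suc j = UNIV"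
  shows "gmodule_iso (klr_algebra e \<kappa> n) S (comp_factor S Ns j)"
    and "gmodule_iso (klr_algebra e \<kappa> n) (comp_factor S Ns j) S"
    and "irreducible_gmodule (klr_algebra e \<kappa> n) (comp_factor S Ns j)"
proof -
  let ?Q = "comp_factor S Ns j"
  have coset: "{0} +>\<^bsub>sub_gmodule S UNIV\<^esub> x = {x}" for x
    by (simp add: a_r_coset_def r_coset_def sub_gmodule_def S_simps)
  have Q: "carrier ?Q = range (\<lambda>x. {x})" "{x} \<oplus>\<^bsub>?Q\<^esub> {y} = {x + y}" "\<zero>\<^bsub>?Q\<^esub> = {0}"
    "a \<odot>\<^bsub>?Q\<^esub> {x} = {a \<odot>\<^bsub>S\<^esub> x}" "deg_part ?Q d' = (\<lambda>x. {x}) ` deg_part S d'" for x y a d'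
    unfolding comp_factor_def assms quot_gmodule_def
    by (simp_all add: A_RCOSETS_def RCOSETS_def a_r_coset_def[symmetric] coset)
       (auto simp: sub_gmodule_def S_simps set_add_def set_mult_def)
  show iso: "gmodule_iso (klr_algebra e \<kappa> n) S ?Q"
    unfolding gmodule_iso_def Q S_simps
    by (intro exI[of _ "\<lambda>x. {x}"]) (simp add: Q bij_betw_def)
  then show iso': "gmodule_iso (klr_algebra e \<kappa> n) ?Q S"
    by (rule gmodule_iso_sym) (simp_all add: S_simps)
  have "gmodule_iso (klr_algebra e \<kappa> n) ?Q (one_dim_module is d :: ('f, 'f) klr_gmodule)"
    using iso' by (simp only: S_def)
  then show "irreducible_gmodule (klr_algebra e \<kappa> n) ?Q"
    by (rule irreducible_one_dim) (auto simp: Q S_simps)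
qed

lemma comp_series_S: "comp_series (klr_algebra e \<kappa> n) S [{0}, UNIV]"
  unfolding comp_series_def
  using S_graded_submodule comp_factor_S(3)[of "[{0}, UNIV]" 0]
  by (auto simp: S_simps less_Suc_eq)

text \<open>A series consists of copies of zero and of the whole module, and a repetition would give
  a zero factor. So there is only one, and the \<open>SOME\<close> in \<open>comp_mult\<close> is
  determined.\<close>

lemma comp_series_S_unique:
  assumes "comp_series (klr_algebra e \<kappa> n) S Ns"
  shows "Ns = [{0}, UNIV]"
proof -
  have Ns: "Ns \<noteq> []" "hd Ns = {0}" "last Ns = UNIV"
    "\<forall>N \<in> set Ns. graded_submodule (klr_algebra e \<kappa> n) S N"
    "\<And>j. Suc j < length Ns \<Longrightarrow> Ns ! j \<subseteq> Ns ! Suc j"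
    "\<And>j. Suc j < length Ns \<Longrightarrow> irreducible_gmodule (klr_algebra e \<kappa> n) (comp_factor S Ns j)"
    using assms unfolding comp_series_def S_simps by simp_all
  have cases: "Ns ! j = {0} \<or> Ns ! j = UNIV" if "j < length Ns" for j
    using Ns(4) S_irreducible nth_mem[OF that] unfolding irreducible_gmodule_def S_simps by blast
  \<comment> \<open>If two successive terms agree, all their elements lie in a single coset, so the
    factor is zero and cannot be irreducible.\<close>
  have neq: "Ns ! j \<noteq> Ns ! Suc j" if j: "Suc j < length Ns" for j
  proof
    assume eq: "Ns ! j = Ns ! Suc j"
    let ?N = "Ns ! j" and ?Q = "comp_factor S Ns j"
    have "j < length Ns" using j by simp
    note N = cases[OF this]
    have coset: "?N +>\<^bsub>sub_gmodule S ?N\<^esub> x = ?N" if "x \<in> ?N" for x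
    proof -
      have "?N +>\<^bsub>sub_gmodule S ?N\<^esub> x = (\<lambda>h. h + x) ` ?N"
        unfolding a_r_coset_def r_coset_def by (simp add: sub_gmodule_def S_simps UNION_singleton_eq_range)
      also from N have "\<dots> = ?N"
      proof
        assume "?N = {0}"
        then show ?thesis using that by simp
      next
        assume U: "?N = UNIV"
        have "y \<in> range (\<lambda>h. h + x)" for y by (rule range_eqI[of _ _ "y - x"]) simp
        then show ?thesis unfolding U by (intro equalityI subsetI) simp_all
      qed
      finally show ?thesis .
    qed
    have "0 \<in> ?N" using N by (elim disjE) simp_all
    have "carrier ?Q = (\<Union>x\<in>?N. {?N +>\<^bsub>sub_gmodule S ?N\<^esub> x})"
      unfolding comp_factor_def eq[symmetric] quot_gmodule_def
      by (simp add: A_RCOSETS_def RCOSETS_def a_r_coset_def[symmetric]) (simp add: sub_gmodule_def)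
    also have "\<dots> = (\<Union>x\<in>?N. {?N})"
      by (rule SUP_cong[OF refl]) (simp only: coset)
    also have "\<dots> = {?N}"
      using \<open>0 \<in> ?N\<close> by (intro UN_constant_eq[of 0]) simp_all
    finally have "carrier ?Q = {\<zero>\<^bsub>?Q\<^esub>}"
      unfolding comp_factor_def eq[symmetric] by (simp add: quot_gmodule_def)
    then show False using Ns(6)[OF j] unfolding irreducible_gmodule_def by simp
  qed
  have step: "Ns ! j = {0} \<and> Ns ! Suc j = UNIV" if "Suc j < length Ns" for j
    using cases[of j] cases[of "Suc j"] neq[OF that] Ns(5)[OF that] that
    by (metis Suc_lessD top.extremum_uniqueI)
  have ne: "{0} \<noteq> (UNIV :: 'f set)"
    by (metis UNIV_I singletonD zero_neq_one)
  have "length Ns \<noteq> 1"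
    using Ns(1-3) ne by (cases Ns) auto
  moreover have "\<not> 2 < length Ns"
    using step[of 0] step[of 1] ne by auto
  ultimately have len: "length Ns = 2" using Ns(1) by (cases "length Ns") auto
  then have "Ns = [Ns ! 0, Ns ! Suc 0]"
    by (cases Ns; cases "tl Ns") auto
  then show ?thesis using step[of 0] len by simp
qed

lemma comp_mult_S:
  "comp_mult (klr_algebra e \<kappa> n) S D = (if gmodule_iso (klr_algebra e \<kappa> n) S D then 1 else 0)"
proof -
  let ?Ns = "[{0}, UNIV] :: 'f set list"
  have "(SOME Ns. comp_series (klr_algebra e \<kappa> n) S Ns) = ?Ns"
    using comp_series_S comp_series_S_unique by (rule some_equality)
  then have "comp_mult (klr_algebra e \<kappa> n) S D =
      card {j. Suc j < 2 \<and> gmodule_iso (klr_algebra e \<kappa> n) (comp_factor S ?Ns j) D}"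
    by (simp add: comp_mult_def)
  also have "{j. Suc j < 2 \<and> gmodule_iso (klr_algebra e \<kappa> n) (comp_factor S ?Ns j) D} =
      (if gmodule_iso (klr_algebra e \<kappa> n) (comp_factor S ?Ns 0) D then {0} else {})"
    by auto
  also have "gmodule_iso (klr_algebra e \<kappa> n) (comp_factor S ?Ns 0) D \<longleftrightarrow> gmodule_iso (klr_algebra e \<kappa> n) S D"
  proof
    assume "gmodule_iso (klr_algebra e \<kappa> n) (comp_factor S ?Ns 0) D"
    then show "gmodule_iso (klr_algebra e \<kappa> n) S D"
      by (rule gmodule_iso_trans[OF comp_factor_S(1), rotated 2]) simp_all
  next
    assume "gmodule_iso (klr_algebra e \<kappa> n) S D"
    then show "gmodule_iso (klr_algebra e \<kappa> n) (comp_factor S ?Ns 0) D"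
      by (rule gmodule_iso_trans[OF comp_factor_S(2), rotated 2]) simp_all
  qed
  finally show ?thesis by simp
qed

text \<open>The shift of \<open>D\<close> by \<open>k\<close> is concentrated in degree
  \<open>k\<close>, so only \<open>k = d\<close> contributes to the sum over all shifts.\<close>

lemma graded_mult_S:
  fixes D :: "('f, 'b) klr_gmodule"
  assumes iso: "gmodule_iso (klr_algebra e \<kappa> n) D (one_dim_module is 0 :: ('f, 'f) klr_gmodule)"
    and D: "left_module (klr_algebra e \<kappa> n) D" "\<And>k. deg_part D k \<subseteq> carrier D"
  shows "graded_mult (klr_algebra e \<kappa> n) S D = vpow d"
proof -
  have shift_iso: "gmodule_iso (klr_algebra e \<kappa> n) (grade_shift k D) (one_dim_module is k :: ('f, 'f) klr_gmodule)" for k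
    using iso by (simp add: gmodule_iso_grade_shift)
  interpret D: left_module "klr_algebra e \<kappa> n" D by (rule D(1))
  have iff: "gmodule_iso (klr_algebra e \<kappa> n) S (grade_shift k D) \<longleftrightarrow> k = d" for k
  proof
    assume "gmodule_iso (klr_algebra e \<kappa> n) S (grade_shift k D)"
    from gmodule_iso_trans[OF this shift_iso] have "d = k"
      unfolding S_def by (intro one_dim_shift_unique[OF gmodule_iso_refl]) (auto simp: one_dim_simps)
    then show "k = d" by simp
  next
    assume "k = d"
    then show "gmodule_iso (klr_algebra e \<kappa> n) S (grade_shift k D)"
      unfolding S_def
      by (simp only: \<open>k = d\<close>, intro gmodule_iso_sym[OF shift_iso])
         (simp_all add: grade_shift_def D(2) D.left_smult_closed)
  qed
  have "graded_mult (klr_algebra e \<kappa> n) S D = (\<Sum>k. Poly_Mapping.single k (if k = d then 1 else 0))"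
    unfolding graded_mult_def comp_mult_S iff by (intro Sum_any.cong) simp
  also have "\<dots> = (\<Sum>k\<in>{d}. Poly_Mapping.single k (if k = d then 1 else 0))"
    by (rule Sum_any.expand_superset) auto
  finally show ?thesis by (simp add: vpow_def)
qed

lemma graded_mult_S_zero:
  assumes "\<And>k. \<not> gmodule_iso (klr_algebra e \<kappa> n) S (grade_shift k D)"
  shows "graded_mult (klr_algebra e \<kappa> n) S D = 0"
  unfolding graded_mult_def comp_mult_S using assms by simp

end

end

section \<open>The simple modules of the regularised shapes\<close>

context col_data
begin

abbreviation cs :: "nat \<Rightarrow> int list" where "cs \<equiv> col_res e \<kappa>"

lemma col_in: "col n \<in> {0..<int e}"
  using e by (simp add: res_def)

lemma cs_Suc: "cs (Suc n) = cs n @ [col n]"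
  by (rule col_res_Suc)

lemma is_simple_D_graded: "is_simple_D e \<kappa> n \<mu> D \<Longrightarrow> klr_graded_module e \<kappa> n D"
  by (induction rule: is_simple_D.induct) simp_all

lemma is_simple_D_bipartition: "is_simple_D e \<kappa> n \<mu> D \<Longrightarrow> is_bipartition \<mu>"
  by (induction rule: is_simple_D.induct)
     (auto simp: up_arrow_def adds_to_def is_bipartition_def is_partition_def)

lemma klr_restrictionI:
  fixes D :: "('f::field, 'b) klr_gmodule"
  assumes "klr_graded_module e \<kappa> (Suc n) D" "i \<in> {0..<int e}"
  shows "klr_restriction e \<kappa> n i D"
  using assms klr_gradedI[OF assms(1)]
  by (simp add: klr_restriction_def residue_def)

text \<open>All modules on the path sit in degree 0, as self-duality requires, so the shift in the
  recursion is 0 at each step.\<close>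

lemma one_dim_simple:
  "is_simple_D e \<kappa> n (lam n) (one_dim_module (cs n) 0 :: ('f::field, 'f) klr_gmodule)"
proof (induction n)
  case 0
  interpret c: klr_char e \<kappa> 0 "cs 0" "TYPE('f)" by (rule col_res_char)
  have "lam 0 = ([], [])" by (cases "l = 0") (auto simp: reg_col_def braces_0)
  moreover have "cs 0 = []" by (simp add: col_res_def)
  ultimately show ?case
    using is_simple_D.empty[OF c.one_dim_graded_module[of 0]] gmodule_iso_refl by metis
next
  case (Suc n)
  interpret c: klr_char e \<kappa> "Suc n" "cs (Suc n)" "TYPE('f)" by (rule col_res_char)
  let ?D = "one_dim_module (cs (Suc n)) 0 :: ('f, 'f) klr_gmodule"
  interpret r: klr_restriction e \<kappa> n "col n" ?D
    by (rule klr_restrictionI[OF c.one_dim_graded_module col_in])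
  have soc: "gmodule_iso (klr_algebra e \<kappa> n) (socle (klr_algebra e \<kappa> n) r.Res)
      (grade_shift 0 (one_dim_module (cs n) 0 :: ('f, 'f) klr_gmodule))"
    unfolding grade_shift_0
    by (rule r.socle_same_residue(1)[OF col_res_char _ _ refl])
       (use col_res_char[of "Suc n", where ?'f = 'f] gmodule_iso_refl in \<open>simp_all add: cs_Suc\<close>)
  show ?case
    using is_simple_D.step[OF Suc col_in lam_up, of ?D 0] soc
      c.one_dim_graded_module[of 0] c.one_dim_irreducible[of 0] c.one_dim_self_dual
    by simp
qed

text \<open>The label is left variable, with an equation as premise, so that the induction can run
  over the recursion. \<open>lam_pred\<close> determines the previous label and the residue, hence
  the induction hypothesis describes the socle of the restriction, and \<open>klr_insertion\<close>
  rebuilds the module.\<close>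

lemma simple_lam_one_dim:
  fixes D :: "('f::field, 'b) klr_gmodule"
  assumes "is_simple_D e \<kappa> n \<mu> D" "\<mu> = lam n"
  shows "gmodule_iso (klr_algebra e \<kappa> n) D (one_dim_module (cs n) 0 :: ('f, 'f) klr_gmodule)"
  using assms
proof (induction rule: is_simple_D.induct)
  case (empty D)
  then show ?case by (simp add: col_res_def)
next
  case (step n \<mu> D i \<nu> D' k)
  have \<mu>: "is_bipartition \<mu>" using step.hyps(1) by (rule is_simple_D_bipartition)
  have "up_arrow e \<kappa> i \<mu> (lam (Suc n))" using step.hyps(3) step.prems by simp
  from lam_pred[OF this \<mu>] have \<mu>i: "\<mu> = lam n" "i = col n" by auto
  interpret c: klr_char e \<kappa> n "cs n" "TYPE('f)" by (rule col_res_char)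
  interpret c': klr_char e \<kappa> "Suc n" "cs (Suc n)" "TYPE('f)" by (rule col_res_char)
  have D': "klr_graded_module e \<kappa> (Suc n) D'" using step.hyps(4) by simp
  interpret r: klr_restriction e \<kappa> n "col n" D'
    by (rule klr_restrictionI[OF D' col_in])
  have "gmodule_iso (klr_algebra e \<kappa> n) (grade_shift k D) (one_dim_module (cs n) k :: ('f, 'f) klr_gmodule)"
    using step.IH[OF \<mu>i(1)] by (simp add: gmodule_iso_grade_shift)
  from gmodule_iso_trans[OF step.hyps(7) this]
  have soc: "gmodule_iso (klr_algebra e \<kappa> n) (socle (klr_algebra e \<kappa> n) r.Res)
      (one_dim_module (cs n) k :: ('f, 'f) klr_gmodule)"
    unfolding \<mu>i(2) .
  obtain x where x: "x \<in> deg_part D' k" "x \<noteq> \<zero>\<^bsub>D'\<^esub>" "r.act (yy (Suc n)) x = \<zero>\<^bsub>D'\<^esub>"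
    "\<And>g. g \<in> gens e n \<Longrightarrow> r.act (X (append_res (col n) g)) x = r.act (scal (one_dim_char (cs n) (X g))) x"
    using r.socle_one_dim_generator[OF col_res_char soc] by metis
  have x_closed: "x \<in> carrier D'" by (rule r.deg_closed[OF x(1)])
  interpret ins: klr_insertion e \<kappa> n D' "cs n" "col n" x k
  proof
    show "e \<ge> 2" using e by simp
    show "col n \<in> {0..<int e}" by (rule col_in)
    show "cs n \<in> res_seqs e n" by (rule col_res_in)
    have last: "ent (cs (Suc n)) (Suc n) = col n"
      by (simp add: cs_Suc nth_append)
    have ent: "ent (cs (Suc n)) r = ent (cs n) r" if "1 \<le> r" "r \<le> n" for r
      using that ent_col_res[of r "Suc n"] ent_col_res[of r n] by simp
    show "col n = pred_res e (ent (cs n) n)" if "1 \<le> n"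
      using ent_col_res_Suc[of n "Suc n"] that last ent[of n] by simp
    show "col n \<noteq> ent (cs n) (n - 1)" if "2 \<le> n"
    proof -
      have "ent (cs (Suc n)) (n - 1 + 2) \<noteq> ent (cs (Suc n)) (n - 1)"
        using that by (intro ent_col_res_neq2) auto
      moreover have "n - 1 + 2 = Suc n" using that by simp
      ultimately show ?thesis using last ent[of "n - 1"] that by simp
    qed
    show "irreducible_gmodule (klr_algebra e \<kappa> (Suc n)) D'" using step.hyps(5) by simp
    show "x \<in> deg_part D' k" "x \<noteq> \<zero>\<^bsub>D'\<^esub>" by (rule x)+
    show "r.act (ee (cs n @ [col n])) x = x"
      using x(4)[of "E (cs n)"] x_closed col_res_in[of n] by simp
    show "r.act (yy r) x = \<zero>\<^bsub>D'\<^esub>" if "1 \<le> r" "r \<le> Suc n" for r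
      using x(3) x(4)[of "Y r"] that x_closed by (cases "r = Suc n") auto
    show "r.act (psi r) x = \<zero>\<^bsub>D'\<^esub>" if "1 \<le> r" "r < n" for r
      using x(4)[of "Psi r"] that x_closed by auto
  qed
  have iso: "gmodule_iso (klr_algebra e \<kappa> (Suc n)) D' (one_dim_module (cs (Suc n)) k :: ('f, 'f) klr_gmodule)"
    using ins.iso_one_dim[folded cs_Suc] col_res_char[of "Suc n", where ?'f = 'f] by simp
  \<comment> \<open>The recursion leaves the shift free; the self-duality required of
    \<open>D'\<close> fixes it.\<close>
  have "k = 0"
    using c'.self_dual_degree[OF iso] step.hyps(6) r.deg_closed by auto
  then show ?case using iso by simp
qed

text \<open>A shift of a labelled module is never isomorphic to a zero socle; this excludes wrong
  residues in \<open>simple_one_dim_lam\<close>.\<close>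

lemma simple_nontrivial:
  fixes D :: "('f::field, 'b) klr_gmodule"
  assumes "is_simple_D e \<kappa> n \<mu> D"
  shows "\<exists>x\<in>carrier D. \<exists>y\<in>carrier D. x \<noteq> y"
  using assms
proof (induction rule: is_simple_D.induct)
  case (empty D)
  have c: "klr_char TYPE('f) e \<kappa> 0 []"
    using col_res_char[of 0, where ?'f = 'f] by (simp add: col_res_def)
  obtain \<phi> where \<phi>: "bij_betw \<phi> (carrier D) (UNIV :: 'f set)"
    by (rule klr_char.gmodule_iso_one_dimE[OF c empty(2)]) (rule that)
  then have "{0, 1} \<subseteq> \<phi> ` carrier D" by (simp add: bij_betw_def)
  then obtain x y where "x \<in> carrier D" "\<phi> x = 0" "y \<in> carrier D" "\<phi> y = 1" by auto
  then show ?case by (intro bexI[of _ x] bexI[of _ y]) auto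
next
  case (step n \<mu> D i \<nu> D' k)
  interpret klr_graded e \<kappa> "n + 1" D' by (rule klr_gradedI[OF step.hyps(4)])
  have "carrier D' \<noteq> {\<zero>\<^bsub>D'\<^esub>}"
    using step.hyps(5) by (simp add: irreducible_gmodule_def)
  then show ?case using M.zero_closed by blast
qed

text \<open>The degree \<open>d\<close> is arbitrary because the shift \<open>k\<close> changes it
  at each step. If the residue of the arrow were not the last entry, the socle of the restriction
  would be zero. So it is the last entry, the socle has the shortened sequence, and the label
  follows because the arrow has at most one value.\<close>

lemma simple_one_dim_lam:
  fixes D :: "('f::field, 'b) klr_gmodule"
  assumes "is_simple_D e \<kappa> n \<mu> D"
    and "gmodule_iso (klr_algebra e \<kappa> n) D (one_dim_module (cs n) d :: ('f, 'f) klr_gmodule)"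
  shows "\<mu> = lam n"
  using assms
proof (induction arbitrary: d rule: is_simple_D.induct)
  case (empty D)
  then show ?case by (cases "l = 0") (auto simp: reg_col_def braces_0)
next
  case (step n \<mu> D i \<nu> D' k)
  have D': "klr_graded_module e \<kappa> (Suc n) D'" using step.hyps(4) by simp
  interpret r: klr_restriction e \<kappa> n i D'
    by (rule klr_restrictionI[OF D' step.hyps(2)])
  have char_Suc: "klr_char TYPE('f) e \<kappa> (Suc n) (cs n @ [col n])"
    using col_res_char[of "Suc n", where ?'f = 'f] by (simp add: cs_Suc)
  have iso: "gmodule_iso (klr_algebra e \<kappa> (Suc n)) D' (one_dim_module (cs n @ [col n]) d :: ('f, 'f) klr_gmodule)"
    using step.prems by (simp add: cs_Suc)
  have i: "i = col n"
  proof (rule ccontr)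
    assume "i \<noteq> col n"
    then have S: "r.S = {\<zero>\<^bsub>D'\<^esub>}"
      by (rule r.socle_other_residue[OF col_res_char char_Suc iso])
    obtain \<phi> where "bij_betw \<phi> r.S (carrier (grade_shift k D))"
      by (rule gmodule_isoE[OF step.hyps(7), unfolded r.socle_simps(1)]) (rule that)
    then have "carrier D = {\<phi> \<zero>\<^bsub>D'\<^esub>}"
      unfolding S by (simp add: bij_betw_def grade_shift_def)
    then show False using simple_nontrivial[OF step.hyps(1)] by auto
  qed
  note soc = r.socle_same_residue[OF col_res_char char_Suc iso i]
  have "gmodule_iso (klr_algebra e \<kappa> n) (grade_shift k D) (socle (klr_algebra e \<kappa> n) r.Res)"
  proof (rule gmodule_iso_sym[OF step.hyps(7)], unfold r.socle_simps)
    show "x \<oplus>\<^bsub>D'\<^esub> y \<in> r.S" if "x \<in> r.S" "y \<in> r.S" for x y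
      using that by (rule r.S_add)
    show "a \<odot>\<^bsub>r.Res\<^esub> x \<in> r.S" if "a \<in> carrier (klr_algebra e \<kappa> n)" "x \<in> r.S" for a x
      by (rule klr_algebra_cases[OF that(1)]) (use r.S_act that(2) in \<open>simp add: r.Res.act_def\<close>)
  qed auto
  from gmodule_iso_trans[OF this soc(1)]
  have "gmodule_iso (klr_algebra e \<kappa> n) D (one_dim_module (cs n) (d - k) :: ('f, 'f) klr_gmodule)"
    by (simp add: gmodule_iso_grade_shift)
  then have "\<mu> = lam n" by (rule step.IH)
  then have "\<nu> = lam (Suc n)"
    using up_arrow_unique[OF step.hyps(3)] lam_up[of n] i by simp
  then show ?case by simp
qed

section \<open>The degree of the column tableau\<close>

lemma div_Suc_step:
  "(x + 1) div int e = x div int e + (if int e dvd x + 1 then 1 else 0)"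
proof -
  define q r where "q = x div int e" and "r = x mod int e"
  have x: "x = int e * q + r" and r: "0 \<le> r" "r < int e"
    unfolding q_def r_def using e by simp_all
  show ?thesis
  proof (cases "r + 1 = int e")
    case True
    then have x1: "x + 1 = int e * (q + 1) + 0" using x by (simp add: algebra_simps)
    have "(x + 1) div int e = q + 1" by (rule int_div_pos_eq[OF x1]) (use e in auto)
    moreover have "int e dvd x + 1" unfolding x1 by simp
    ultimately show ?thesis by (simp add: q_def)
  next
    case False
    then have r1: "0 \<le> r + 1" "r + 1 < int e" using r by auto
    have x1: "x + 1 = int e * q + (r + 1)" using x by simp
    have "(x + 1) div int e = q" by (rule int_div_pos_eq[OF x1 r1])
    moreover have "(x + 1) mod int e = r + 1" by (rule int_mod_pos_eq[OF x1 r1])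
    then have "\<not> int e dvd x + 1" using r by (simp add: dvd_eq_mod_eq_0)
    ultimately show ?thesis by (simp add: q_def)
  qed
qed

text \<open>The addable nodes above \<open>(k, 1, 2)\<close> that can count are
  \<open>(1, 2, 2)\<close>, if \<open>e\<close> divides \<open>k\<close>, and
  \<open>(1, 1, 1)\<close>, if \<open>e\<close> divides \<open>k - l - 1\<close>; no removable node
  lies above. Both conditions are counted over \<open>k \<le> n\<close> by quotients that jump at
  multiples of \<open>e\<close>.\<close>

lemma col_deg_eq: "col_deg e \<kappa> n = int n div int e + (int n - int l - 1) div int e + 1"
proof -
  have summand: "int (card {A. addable ([], replicate k 1) A \<and> res e \<kappa> A = res e \<kappa> (k, 1, 2) \<and> above A (k, 1, 2)})
     - int (card {A. removable ([], replicate k 1) A \<and> res e \<kappa> A = res e \<kappa> (k, 1, 2) \<and> above A (k, 1, 2)})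
    = (if int e dvd int k then 1 else 0) + (if int e dvd int k - int l - 1 then 1 else 0)"
    if k: "1 \<le> k" for k
  proof -
    let ?\<mu> = "([], replicate k 1) :: bipartition"
    have \<mu>: "is_bipartition ?\<mu>"
      using replicate_partition[of k] by (simp add: is_bipartition_def) (simp add: is_partition_def)
    have rows: "row_len (component ?\<mu> 1) r = 0"
      "row_len (component ?\<mu> 2) r = (if 1 \<le> r \<and> r \<le> k then 1 else 0)" for r
      by (simp_all only: component_simps row_len_replicate row_len_Nil)
    have add1: "addable ?\<mu> (r, j, 1) \<longleftrightarrow> r = 1 \<and> j = 1" for r j
      unfolding addable_iff[OF \<mu>] rows by auto
    have add2: "addable ?\<mu> (r, j, 2) \<and> r < k \<longleftrightarrow> r = 1 \<and> j = 2 \<and> 1 < k" for r j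
      unfolding addable_iff[OF \<mu>] rows by auto
    have c: "c \<in> {1, 2}" if "addable ?\<mu> (r, j, c)" for r j c
      using that unfolding addable_iff[OF \<mu>] by blast
    obtain t where t: "\<kappa> 2 = \<kappa> 1 + int l + int e * t" using \<kappa>2_eq by blast
    have res1: "res e \<kappa> (1, 1, 1) = res e \<kappa> (k, 1, 2) \<longleftrightarrow> int e dvd int k - int l - 1"
      unfolding res_eq_iff t by (intro dvd_shift[of _ _ _ "- t"]) (simp add: algebra_simps)
    have res2: "res e \<kappa> (1, 2, 2) = res e \<kappa> (k, 1, 2) \<longleftrightarrow> int e dvd int k"
      unfolding res_eq_iff by simp
    \<comment> \<open>The node \<open>(1, 2, 2)\<close> lies strictly above \<open>(k, 1, 2)\<close>
      only for \<open>k > 1\<close>, and divisibility by \<open>e\<close> guarantees this.\<close>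
    have large: "1 < k" if "int e dvd int k" using that k e zdvd_imp_le[of "int e" "int k"] by simp
    have "addable ?\<mu> A \<and> res e \<kappa> A = res e \<kappa> (k, 1, 2) \<and> above A (k, 1, 2) \<longleftrightarrow>
        A = (1, 2, 2) \<and> int e dvd int k \<or> A = (1, 1, 1) \<and> int e dvd int k - int l - 1" for A
    proof -
      obtain r j c where A: "A = (r, j, c)" by (metis prod.exhaust)
      consider "c = 1" | "c = 2" | "c \<notin> {1, 2}" by blast
      then show ?thesis
      proof cases
        case 1
        then show ?thesis unfolding A using add1[of r j] res1 by (auto simp: above_def)
      next
        case 2
        then show ?thesis unfolding A using add2[of r j] res2 large by (auto simp: above_def)
      next
        case 3
        then show ?thesis unfolding A using c[of r j c] by auto
      qed
    qed
    then have "{A. addable ?\<mu> A \<and> res e \<kappa> A = res e \<kappa> (k, 1, 2) \<and> above A (k, 1, 2)} =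
        (if int e dvd int k then {(1, 2, 2)} else {}) \<union>
        (if int e dvd int k - int l - 1 then {(1, 1, 1)} else {})"
      by (intro Set.set_eqI) auto
    then have card_add: "card {A. addable ?\<mu> A \<and> res e \<kappa> A = res e \<kappa> (k, 1, 2) \<and> above A (k, 1, 2)} =
        (if int e dvd int k then 1 else 0) + (if int e dvd int k - int l - 1 then 1 else 0)"
      by simp
    have "\<not> (removable ?\<mu> A \<and> above A (k, 1, 2))" for A
    proof
      assume rem: "removable ?\<mu> A \<and> above A (k, 1, 2)"
      obtain r j c where A: "A = (r, j, c)" by (metis prod.exhaust)
      note a = removableD[OF \<mu> rem[THEN conjunct1, unfolded A]]
      have "c = 2" using a(1,3,4) rows(1) by auto
      then show False using a rem rows(2) unfolding A by (auto simp: above_def split: if_splits)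
    qed
    then have rem_empty: "{A. removable ?\<mu> A \<and> res e \<kappa> A = res e \<kappa> (k, 1, 2) \<and> above A (k, 1, 2)} = {}"
      by blast
    show ?thesis unfolding card_add rem_empty by simp
  qed
  show ?thesis
  proof (induction n)
    case 0
    \<comment> \<open>The second quotient starts at \<open>- 1\<close> for \<open>n = 0\<close>
      because \<open>0 \<le> l < e\<close>; the summand 1 in the formula compensates for
      this.\<close>
    have "(- int l - 1) div int e = - 1"
      using l_less by (intro int_div_pos_eq[of _ _ _ "int e - int l - 1"]) auto
    then show ?case by (simp add: col_deg_def)
  next
    case (Suc n)
    have "col_deg e \<kappa> (Suc n) = col_deg e \<kappa> n
        + ((if int e dvd int (Suc n) then 1 else 0) + (if int e dvd int (Suc n) - int l - 1 then 1 else 0))"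
      using summand[of "Suc n"] unfolding col_deg_def by (simp del: replicate_Suc)
    moreover have "int (Suc n) div int e = int n div int e + (if int e dvd int (Suc n) then 1 else 0)"
      using div_Suc_step[of "int n"] by (simp add: add.commute)
    moreover have "(int (Suc n) - int l - 1) div int e = (int n - int l - 1) div int e
        + (if int e dvd int (Suc n) - int l - 1 then 1 else 0)"
      using div_Suc_step[of "int n - int l - 1"] by (simp add: algebra_simps)
    ultimately show ?case using Suc by simp
  qed
qed

text \<open>In the first case \<open>l = e - 1\<close>, so the second quotient is that of
  \<open>n - e\<close>, which is one less than that of \<open>n\<close>.\<close>

lemma col_deg_cases:
  "col_deg e \<kappa> n = (if [\<kappa> 2 = \<kappa> 1 - 1] (mod int e) then 2 * (int n div int e)
    else int n div int e + (int n - int l - 1) div int e + 1)"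
proof (cases "[\<kappa> 2 = \<kappa> 1 - 1] (mod int e)")
  case True
  then have "(\<kappa> 2 - \<kappa> 1) mod int e = (- 1) mod int e"
    unfolding cong_iff_dvd_diff mod_eq_dvd_iff by (simp add: algebra_simps)
  then have "int l = int e - 1" using l e by (simp add: zmod_minus1)
  then have "(int n - int l - 1) div int e = (int n + int e * (- 1)) div int e" by simp
  also have "\<dots> = int n div int e - 1" using e by (simp only: div_mult_self2)
  finally show ?thesis using True col_deg_eq by simp
qed (simp add: col_deg_eq)

end

theorem lemma8p1:
  fixes e n l :: nat and \<kappa> :: "nat \<Rightarrow> int" and lam :: bipartition
    and S :: "('f::field, 'f) klr_gmodule"
  assumes "e \<ge> 3" and "\<kappa> 1 \<in> {0..<int e}" and "\<kappa> 2 \<in> {0..<int e}" and "n \<ge> 1"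
    and "int l = (\<kappa> 2 - \<kappa> 1) mod int e"
    and "lam = (if n < l then ([], replicate n 1) else (braces e (n - l), replicate l 1))"
    and "S = specht_col e \<kappa> n"
  shows "klr_graded_module e \<kappa> n S
    \<and> lam \<in> reg_bipartitions e \<kappa> n
    \<and> (\<exists>D :: ('f, 'f) klr_gmodule. is_simple_D e \<kappa> n lam D)
    \<and> (\<forall>D :: ('f, 'b) klr_gmodule. is_simple_D e \<kappa> n lam D \<longrightarrow>
        graded_mult (klr_algebra e \<kappa> n) S D =
          (if [\<kappa> 2 = \<kappa> 1 - 1] (mod int e) then vpow (2 * (int n div int e))
           else vpow (int n div int e + (int n - int l - 1) div int e + 1)))
    \<and> (\<forall>\<mu> \<in> reg_bipartitions e \<kappa> n. \<mu> \<noteq> lam \<longrightarrow>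
        (\<forall>D :: ('f, 'b) klr_gmodule. is_simple_D e \<kappa> n \<mu> D \<longrightarrow>
          graded_mult (klr_algebra e \<kappa> n) S D = 0))"
proof -
  interpret col_data e \<kappa> l by unfold_locales (rule assms)+
  interpret c: klr_char e \<kappa> n "cs n" "TYPE('f)" by (rule col_res_char)
  have lam: "lam = reg_col e l n" unfolding assms(6) reg_col_def ..
  have S: "S = one_dim_module (cs n) (col_deg e \<kappa> n)" unfolding assms(7) specht_col_def ..
  have D_module: "left_module (klr_algebra e \<kappa> n) D \<and> deg_part D k \<subseteq> carrier D"
    if "is_simple_D e \<kappa> n \<mu> D" for \<mu> k and D :: "('f, 'b) klr_gmodule"
  proof -
    interpret D: klr_gmod e \<kappa> n D
      by (rule klr_graded_module_gmod[OF is_simple_D_graded[OF that]])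
    show ?thesis using D.lm D.deg_closed by blast
  qed
  show ?thesis
  proof (intro conjI allI ballI impI)
    show "klr_graded_module e \<kappa> n S"
      unfolding S by (rule c.one_dim_graded_module)
    show "lam \<in> reg_bipartitions e \<kappa> n"
      using lam_regular[of n] reg_col_size[of e l n] e by (simp add: reg_bipartitions_def lam)
    show "\<exists>D :: ('f, 'f) klr_gmodule. is_simple_D e \<kappa> n lam D"
      unfolding lam using one_dim_simple by blast
    fix D :: "('f, 'b) klr_gmodule"
    assume D: "is_simple_D e \<kappa> n lam D"
    have "graded_mult (klr_algebra e \<kappa> n) S D = vpow (col_deg e \<kappa> n)"
      by (rule c.graded_mult_S[OF S simple_lam_one_dim[OF D lam]]) (use D_module[OF D] in blast)+
    then show "graded_mult (klr_algebra e \<kappa> n) S D =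
        (if [\<kappa> 2 = \<kappa> 1 - 1] (mod int e) then vpow (2 * (int n div int e))
         else vpow (int n div int e + (int n - int l - 1) div int e + 1))"
      unfolding col_deg_cases by simp
  next
    fix \<mu> and D :: "('f, 'b) klr_gmodule"
    assume neq: "\<mu> \<noteq> lam" and D: "is_simple_D e \<kappa> n \<mu> D"
    interpret D: left_module "klr_algebra e \<kappa> n" D using D_module[OF D] by blast
    show "graded_mult (klr_algebra e \<kappa> n) S D = 0"
    proof (rule c.graded_mult_S_zero[OF S])
      fix k
      show "\<not> gmodule_iso (klr_algebra e \<kappa> n) S (grade_shift k D)"
      proof
        assume "gmodule_iso (klr_algebra e \<kappa> n) S (grade_shift k D)"
        then have "gmodule_iso (klr_algebra e \<kappa> n) (grade_shift k D) S"
          by (rule gmodule_iso_sym) (auto simp: S c.one_dim_simps)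
        \<comment> \<open>Undoing the shift, \<open>D\<close> would itself be one-dimensional with
          the column sequence, in some degree, and its label would have to be
          \<open>lam\<close>.\<close>
        then have "gmodule_iso (klr_algebra e \<kappa> n) D (one_dim_module (cs n) (- k + col_deg e \<kappa> n) :: ('f, 'f) klr_gmodule)"
          unfolding S gmodule_iso_grade_shift[of _ k D] grade_shift_one_dim by (simp add: add.commute)
        then show False using simple_one_dim_lam[OF D] neq lam by blast
      qed
    qed
  qed
qed

end
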